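(* (Energy stability of the weight-adjusted DG method.) In the setting of the context, let $w=1/c^2$ and let $(p,\boldsymbol{u})(t)\in V_h\times (V_h)^d$ be a (continuously differentiable in time) solution of the weight-adjusted DG method, i.e. for every element $D^k$, all $v\in P^N(D^k)$ and all $\boldsymbol{\tau}\in(P^N(D^k))^d$, $$\int_{D^k}T_{1/w}^{-1}\Big(\frac{\partial p}{\partial t}\Big)v=-\int_{D^k}(\nabla\cdot\boldsymbol{u})v+\int_{\partial D^k}\tfrac12\big(\tau_p[\![p]\!]-\boldsymbol{n}\cdot[\![\boldsymbol{u}]\!]\big)v^-,$$ $$\int_{D^k}\frac{\partial\boldsymbol{u}}{\partial t}\cdot\boldsymbol{\tau}=-\int_{D^k}\nabla p\cdot\boldsymbol{\tau}+\int_{\partial D^k}\tfrac12\big(\tau_u[\![\boldsymbol{u}]\!]\cdot\boldsymbol{n}^--[\![p]\!]\big)\boldsymbol{\tau}^-\cdot\boldsymbol{n}^-.$$ Then $$\frac{\partial}{\partial t}\sum_k\int_{D^k}\Big((T_{1/w}^{-1}p)\,p+|\boldsymbol{u}|^2\Big)=-\sum_k\frac12\int_{\partial D^k}\Big(\tau_p[\![p]\!]^2+\tau_u(\boldsymbol{n}\cdot[\![\boldsymbol{u}]\!])^2\Big)\le 0.$$ Moreover the quantity $\sum_k\int_{D^k}\big((T_{1/w}^{-1}p)p+|\boldsymbol{u}|^2\big)$ is a squared norm on $V_h\times(V_h)^d$, and, with $0<w_{\min}\le w\le w_{\max}<\infty$, $$w_{\min}\|p\|_{L^2(\Omega)}^2+\|\boldsymbol{u}\|_{L^2(\Omega)}^2\le\sum_k\int_{D^k}\Big((T_{1/w}^{-1}p)\,p+|\boldsymbol{u}|^2\Big)\le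 w_{\max}\|p\|_{L^2(\Omega)}^2+\|\boldsymbol{u}\|_{L^2(\Omega)}^2 .$$
   Context: Setting. $d\in\{2,3\}$, $\Omega\subset\mathbb{R}^d$ is a bounded Lipschitz domain represented exactly by a conforming triangulation $\Omega_h$ whose elements $D^k$ are planar simplices (affine images of a reference simplex). $N\ge0$ is an integer, $P^N(D^k)$ is the space of polynomials of total degree at most $N$ on $D^k$, and $V_h=\bigoplus_kP^N(D^k)$. The wavespeed $c^2$ is a measurable function on $\Omega$ bounded above and below by positive constants. Operator. For a weight $\omega$ bounded above and below by positive constants, $T_\omega^{-1}:L^2(D^k)\to P^N(D^k)$ is defined by: $T_\omega^{-1}f\in P^N(D^k)$ and $\int_{D^k}\omega\,(T_\omega^{-1}f)\,v=\int_{D^k}fv$ for all $v\in P^N(D^k)$. Jumps. On a face shared by $D^k$ (interior side $-$) and its neighbour (side $+$), $[\![f]\!]=f^+-f^-$ for scalar or vector $f$; $\boldsymbol{n}=\boldsymbol{n}^-$ is the outward unit normal to $D^k$. On boundary faces (homogeneous Dirichlet condition $p=0$) one sets $p^+=-p^-$ and $\boldsymbol{n}^-\cdot\boldsymbol{u}^+=\boldsymbol{n}^-\cdot\boldsymbol{u}^-$. The penalty parameters $\tau_p,\tau_u\ge0$ are bounded nonnegative functions on the faces, single-valued on each face (the same value seen from both sides). *)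

theory Defs
  imports "HOL-Analysis.Analysis"
begin

definition lipschitz_domain :: "(real^'n) set \<Rightarrow> bool" where
  "lipschitz_domain \<Omega> \<longleftrightarrow>
     open \<Omega> \<and> connected \<Omega> \<and> \<Omega> \<noteq> {} \<and>
     (\<forall>z\<in>frontier \<Omega>. \<exists>e r L \<gamma>. norm e = 1 \<and> r > 0 \<and> L-lipschitz_on {y. y \<bullet> e = 0} \<gamma> \<and>
        (\<forall>x\<in>ball z r. x \<in> \<Omega> \<longleftrightarrow> \<gamma> (x - (x \<bullet> e) *\<^sub>R e) < x \<bullet> e))"

text \<open>
  The library's \<^const>\<open>triangulation\<close> demands that any two members meet in a common (possibly
  empty) face of both, which is conformity of the mesh.
\<close>

definition conforming_mesh :: "(real^'n) set \<Rightarrow> (real^'n) set set \<Rightarrow> bool" where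
  "conforming_mesh \<Omega> \<T> \<longleftrightarrow>
     triangulation \<T> \<and> (\<forall>K\<in>\<T>. int CARD('n) simplex K) \<and> \<Union>\<T> = closure \<Omega>"

definition mesh_faces :: "(real^'n) set set \<Rightarrow> (real^'n) set set" where
  "mesh_faces \<T> = {F. \<exists>K\<in>\<T>. F facet_of K}"

text \<open>
  Elements have nonempty interior, so a polynomial on an element is identified with the
  polynomial on the whole space that extends it. A member of the broken space is a family
  of polynomials indexed by the elements (themselves point sets).
\<close>

definition polys :: "nat \<Rightarrow> (real^'n \<Rightarrow> real) set" where
  "polys N = {f. \<exists>c. \<forall>x. f x = (\<Sum>\<alpha>\<in>{\<alpha>::'n \<Rightarrow> nat. (\<Sum>i\<in>UNIV. \<alpha> i) \<le> N}.
                               c \<alpha> * (\<Prod>i\<in>UNIV. (x $ i) ^ \<alpha> i))}"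

definition vpolys :: "nat \<Rightarrow> (real^'n \<Rightarrow> real^'n) set" where
  "vpolys N = {f. \<forall>i. (\<lambda>x. f x $ i) \<in> polys N}"

definition broken_polys ::
    "(real^'n) set set \<Rightarrow> nat \<Rightarrow> ((real^'n) set \<Rightarrow> real^'n \<Rightarrow> real) set" where
  "broken_polys \<T> N = {p. \<forall>K\<in>\<T>. p K \<in> polys N}"

definition broken_vpolys ::
    "(real^'n) set set \<Rightarrow> nat \<Rightarrow> ((real^'n) set \<Rightarrow> real^'n \<Rightarrow> real^'n) set" where
  "broken_vpolys \<T> N = {u. \<forall>K\<in>\<T>. u K \<in> vpolys N}"

text \<open>
  The function on the domain represented by a family of functions on the elements; it is set
  to 0 on the element boundaries, a null set.
\<close>

definition assemble ::
    "(real^'n) set set \<Rightarrow> ((real^'n) set \<Rightarrow> real^'n \<Rightarrow> 'b::real_normed_vector) \<Rightarrow> real^'n \<Rightarrow> 'b"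
  where "assemble \<T> p x = (\<Sum>K\<in>\<T>. indicator (interior K) x *\<^sub>R p K x)"

definition l2norm :: "(real^'n) set \<Rightarrow> (real^'n \<Rightarrow> 'b::real_normed_vector) \<Rightarrow> real" where
  "l2norm \<Omega> f = sqrt (LINT x|lebesgue_on \<Omega>. (norm (f x))\<^sup>2)"

definition gradient :: "(real^'n \<Rightarrow> real) \<Rightarrow> real^'n \<Rightarrow> real^'n" where
  "gradient f x = (\<chi> i. frechet_derivative f (at x) (axis i 1))"

definition divergence :: "(real^'n \<Rightarrow> real^'n) \<Rightarrow> real^'n \<Rightarrow> real" where
  "divergence f x = (\<Sum>i\<in>UNIV. frechet_derivative f (at x) (axis i 1) $ i)"

definition Tinv ::
    "nat \<Rightarrow> (real^'n) set \<Rightarrow> (real^'n \<Rightarrow> real) \<Rightarrow> (real^'n \<Rightarrow> real) \<Rightarrow> real^'n \<Rightarrow> real" where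
  "Tinv N K \<omega> f = (THE g. g \<in> polys N \<and>
     (\<forall>v\<in>polys N. (LINT x|lebesgue_on K. \<omega> x * g x * v x) = (LINT x|lebesgue_on K. f x * v x)))"

text \<open>
  Surface measure of a facet F, i.e. Lebesgue measure of codimension one on the hyperplane
  spanned by F, restricted to F. Lebesgue measure of the whole space is the product of the
  Lebesgue measures of the hyperplane and of its normal line, so the measure of a subset of
  F is the volume of the cylinder of height 1 (from -1/2 to 1/2 in normal direction) over it:
  the surface measure is the image of the volume of the cylinder over F under the orthogonal
  projection onto the hyperplane.
\<close>

definition face_measure :: "(real^'n) set \<Rightarrow> (real^'n) measure" where
  "face_measure F = completion
     (distr (lebesgue_on {z. closest_point (affine hull F) z \<in> F \<and> infdist z (affine hull F) \<le> 1/2})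
        borel (closest_point (affine hull F)))"

definition outward_normal :: "(real^'n) set \<Rightarrow> (real^'n) set \<Rightarrow> real^'n" where
  "outward_normal K F = (THE n. norm n = 1 \<and> (\<forall>x\<in>F. \<forall>y\<in>K. n \<bullet> y \<le> n \<bullet> x))"

text \<open>The integrand of a boundary integral may depend on the facet as well as on the point.\<close>

definition boundary_integral ::
    "(real^'n) set \<Rightarrow> ((real^'n) set \<Rightarrow> real^'n \<Rightarrow> real) \<Rightarrow> real" where
  "boundary_integral K g = (\<Sum>F\<in>{F. F facet_of K}. LINT x|face_measure F. g F x)"

definition shared_face :: "(real^'n) set set \<Rightarrow> (real^'n) set \<Rightarrow> (real^'n) set \<Rightarrow> bool" where
  "shared_face \<T> K F \<longleftrightarrow> (\<exists>K'\<in>\<T>. K' \<noteq> K \<and> F facet_of K')"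

definition neighbour :: "(real^'n) set set \<Rightarrow> (real^'n) set \<Rightarrow> (real^'n) set \<Rightarrow> (real^'n) set" where
  "neighbour \<T> K F = (THE K'. K' \<in> \<T> \<and> K' \<noteq> K \<and> F facet_of K')"

text \<open>
  Traces from the exterior (side +) of K on its facet F. Only the normal component, with
  respect to the outward normal of K, of the velocity is prescribed on boundary faces, and
  only that component enters the method.
\<close>

definition ext_trace ::
    "(real^'n) set set \<Rightarrow> ((real^'n) set \<Rightarrow> real^'n \<Rightarrow> real) \<Rightarrow>
     (real^'n) set \<Rightarrow> (real^'n) set \<Rightarrow> real^'n \<Rightarrow> real" where
  "ext_trace \<T> p K F x = (if shared_face \<T> K F then p (neighbour \<T> K F) x else - p K x)"

definition ext_normal_trace ::
    "(real^'n) set set \<Rightarrow> ((real^'n) set \<Rightarrow> real^'n \<Rightarrow> real^'n) \<Rightarrow>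
     (real^'n) set \<Rightarrow> (real^'n) set \<Rightarrow> real^'n \<Rightarrow> real" where
  "ext_normal_trace \<T> u K F x =
     (if shared_face \<T> K F then outward_normal K F \<bullet> u (neighbour \<T> K F) x
      else outward_normal K F \<bullet> u K x)"

definition jump ::
    "(real^'n) set set \<Rightarrow> ((real^'n) set \<Rightarrow> real^'n \<Rightarrow> real) \<Rightarrow>
     (real^'n) set \<Rightarrow> (real^'n) set \<Rightarrow> real^'n \<Rightarrow> real" where
  "jump \<T> p K F x = ext_trace \<T> p K F x - p K x"

definition normal_jump ::
    "(real^'n) set set \<Rightarrow> ((real^'n) set \<Rightarrow> real^'n \<Rightarrow> real^'n) \<Rightarrow>
     (real^'n) set \<Rightarrow> (real^'n) set \<Rightarrow> real^'n \<Rightarrow> real" where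
  "normal_jump \<T> u K F x = ext_normal_trace \<T> u K F x - outward_normal K F \<bullet> u K x"

text \<open>
  Penalty parameters are indexed by the face (not by the element), hence single-valued.
\<close>

definition penalty :: "(real^'n) set set \<Rightarrow> ((real^'n) set \<Rightarrow> real^'n \<Rightarrow> real) \<Rightarrow> bool" where
  "penalty \<T> \<tau> \<longleftrightarrow>
     (\<forall>F\<in>mesh_faces \<T>. \<tau> F \<in> borel_measurable (face_measure F)) \<and>
     (\<exists>B. \<forall>F\<in>mesh_faces \<T>. \<forall>x\<in>F. 0 \<le> \<tau> F x \<and> \<tau> F x \<le> B)"

text \<open>
  Continuous differentiability in time of a curve in a space of broken polynomials is stated
  pointwise in space; as that space has finite dimension, this is the same as for any norm on it.
\<close>

definition C1_in_time ::
    "(real^'n) set set \<Rightarrow> real set \<Rightarrow>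
     (real \<Rightarrow> (real^'n) set \<Rightarrow> real^'n \<Rightarrow> 'b::real_normed_vector) \<Rightarrow>
     (real \<Rightarrow> (real^'n) set \<Rightarrow> real^'n \<Rightarrow> 'b) \<Rightarrow> bool" where
  "C1_in_time \<T> J q dq \<longleftrightarrow>
     (\<forall>K\<in>\<T>. \<forall>x\<in>K. continuous_on J (\<lambda>t. dq t K x) \<and>
        (\<forall>t\<in>J. ((\<lambda>s. q s K x) has_vector_derivative dq t K x) (at t within J)))"

definition wadg_solution ::
    "(real^'n) set set \<Rightarrow> nat \<Rightarrow> (real^'n \<Rightarrow> real) \<Rightarrow>
     ((real^'n) set \<Rightarrow> real^'n \<Rightarrow> real) \<Rightarrow> ((real^'n) set \<Rightarrow> real^'n \<Rightarrow> real) \<Rightarrow> real set \<Rightarrow>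
     (real \<Rightarrow> (real^'n) set \<Rightarrow> real^'n \<Rightarrow> real) \<Rightarrow>
     (real \<Rightarrow> (real^'n) set \<Rightarrow> real^'n \<Rightarrow> real^'n) \<Rightarrow> bool" where
  "wadg_solution \<T> N w \<tau>p \<tau>u J p u \<longleftrightarrow>
     (\<forall>t\<in>J. p t \<in> broken_polys \<T> N \<and> u t \<in> broken_vpolys \<T> N) \<and>
     (\<exists>dp du. C1_in_time \<T> J p dp \<and> C1_in_time \<T> J u du \<and>
       (\<forall>t\<in>J. \<forall>K\<in>\<T>.
         (\<forall>v\<in>polys N.
            (LINT x|lebesgue_on K. Tinv N K (\<lambda>y. 1 / w y) (dp t K) x * v x)
            = - (LINT x|lebesgue_on K. divergence (u t K) x * v x)
              + boundary_integral K (\<lambda>F x.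
                  1/2 * (\<tau>p F x * jump \<T> (p t) K F x - normal_jump \<T> (u t) K F x) * v x)) \<and>
         (\<forall>\<tau>\<in>vpolys N.
            (LINT x|lebesgue_on K. du t K x \<bullet> \<tau> x)
            = - (LINT x|lebesgue_on K. gradient (p t K) x \<bullet> \<tau> x)
              + boundary_integral K (\<lambda>F x.
                  1/2 * (\<tau>u F x * normal_jump \<T> (u t) K F x - jump \<T> (p t) K F x)
                      * (\<tau> x \<bullet> outward_normal K F)))))"

definition energy ::
    "(real^'n) set set \<Rightarrow> nat \<Rightarrow> (real^'n \<Rightarrow> real) \<Rightarrow>
     ((real^'n) set \<Rightarrow> real^'n \<Rightarrow> real) \<Rightarrow> ((real^'n) set \<Rightarrow> real^'n \<Rightarrow> real^'n) \<Rightarrow> real" where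
  "energy \<T> N w p u =
     (\<Sum>K\<in>\<T>. LINT x|lebesgue_on K. Tinv N K (\<lambda>y. 1 / w y) (p K) x * p K x + (norm (u K x))\<^sup>2)"

text \<open>
  Norms on the product of the scalar and the vector broken polynomial space. The zero element
  is the pair that vanishes on every element; vector space operations are pointwise.
\<close>

definition broken_norm ::
    "(real^'n) set set \<Rightarrow> nat \<Rightarrow>
     (((real^'n) set \<Rightarrow> real^'n \<Rightarrow> real) \<Rightarrow> ((real^'n) set \<Rightarrow> real^'n \<Rightarrow> real^'n) \<Rightarrow> real) \<Rightarrow> bool" where
  "broken_norm \<T> N \<nu> \<longleftrightarrow>
     (\<forall>p\<in>broken_polys \<T> N. \<forall>u\<in>broken_vpolys \<T> N.
        0 \<le> \<nu> p u \<and>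
        (\<nu> p u = 0 \<longleftrightarrow> (\<forall>K\<in>\<T>. \<forall>x\<in>K. p K x = 0 \<and> u K x = 0)) \<and>
        (\<forall>a. \<nu> (\<lambda>K x. a * p K x) (\<lambda>K x. a *\<^sub>R u K x) = \<bar>a\<bar> * \<nu> p u) \<and>
        (\<forall>q\<in>broken_polys \<T> N. \<forall>v\<in>broken_vpolys \<T> N.
           \<nu> (\<lambda>K x. p K x + q K x) (\<lambda>K x. u K x + v K x) \<le> \<nu> p u + \<nu> q v))"

end

theory Submission
  imports Defs
begin

text \<open>
Testing the two equations with \<open>v = p\<close> and \<open>\<tau> = u\<close> gives half the time derivative of the energy, because
the form \<open>(p, q) \<mapsto> \<integral> (T\<inverse>p) q\<close> is symmetric: \<open>T\<inverse>\<close> is the inverse of the weighted mass operator,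
so the form equals \<open>\<integral> \<omega> (T\<inverse>p) (T\<inverse>q)\<close>, with \<open>\<omega> = 1/w\<close>. The two volume terms
\<open>(div u) p\<close> and \<open>(grad p) \<bullet> u\<close> combine, by the divergence theorem, into the boundary integral of
\<open>p (u \<bullet> n)\<close>, and only integrals over facets remain. On a shared facet the integrand differs from the claimed
dissipation by a term that changes its sign when the two neighbours exchange their roles, so that it
cancels in the sum over the mesh; on the boundary of the domain this term vanishes by the choice of the
exterior traces (lemma \<open>flux_balance\<close>).

Three ingredients carry this.

The divergence theorem on a simplex (lemma \<open>gauss\<close>) is proved first for the direction
\<open>v - w\<close> of an edge, to which all facets are parallel except the two opposite to \<open>v\<close> and \<open>w\<close>; there it is the
fundamental theorem of calculus on the lines parallel to the edge. The directions of the edges at one vertex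
span the space. To integrate over the lines of a given direction without choosing coordinates, one
averages over a slab that cuts from each line a segment of parameter length 1 (lemma
\<open>integral_lines\<close>, from Tonelli and translation invariance). The same averaging shows that shears
preserve volume, so that the volume of a straight cylinder over a facet, by which surface measure is
defined, may be computed with an oblique one.

The pairing of facets needs that a facet belongs to at most two elements, with opposite normals. If
two elements had the same outward normal at a common facet, then both would contain the points just
below the centre of that facet, but interiors of distinct elements of a triangulation are disjoint.

Existence of \<open>T\<inverse>\<close>, and differentiability in time of the energy when only pointwise derivatives are
given, are finite-dimensional linear algebra. Both follow from one fact: a family of
functionals that separates the points of a finite-dimensional space contains a basis of the dual
(lemma \<open>dual_basis\<close>). For the functionals given by an inner product this yields the representation of
functionals; for the point evaluations it yields interpolation points, through which the energy is a
quadratic form in finitely many differentiable functions of time.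

The bounds on the energy come from expanding the squares \<open>\<integral> (g - w_max p)\<^sup>2\<close> and
\<open>\<integral> \<omega> (g - w_min p)\<^sup>2\<close>, both nonnegative, where \<open>g = T\<inverse>p\<close>.
\<close>

section \<open>Integration along lines and oblique cylinders\<close>

text \<open>
The indicator of an interval of length 1 serves as the weight in averages along lines. It is symmetric
about 0, so that a function and its negative have the same slab.
\<close>

abbreviation unit_window :: "real \<Rightarrow> real" where
  "unit_window \<equiv> indicator {-1/2..1/2}"

text \<open>
After exchanging the integrals and shifting \<open>x\<close> by \<open>s e\<close>, the variable \<open>s\<close> occurs only in the window,
whose integral is 1. The slab plays the role of a transversal hyperplane, on which
coordinates would otherwise have to be chosen.
\<close>

lemma nn_integral_lines:
  fixes e :: "'a::euclidean_space" and \<xi> :: "'a \<Rightarrow> real" and h :: "'a \<Rightarrow> ennreal"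
  assumes [measurable]: "\<xi> \<in> borel_measurable borel" "h \<in> borel_measurable borel"
    and \<xi>: "\<And>x s. \<xi> (x + s *\<^sub>R e) = \<xi> x + s"
  shows "(\<integral>\<^sup>+x. (\<integral>\<^sup>+s. indicator {-1/2..1/2} (\<xi> x) * h (x + s *\<^sub>R e) \<partial>lborel) \<partial>lborel) = (\<integral>\<^sup>+x. h x \<partial>lborel)"
proof -
  have "(\<integral>\<^sup>+x. (\<integral>\<^sup>+s. indicator {-1/2..1/2} (\<xi> x) * h (x + s *\<^sub>R e) \<partial>lborel) \<partial>lborel)
      = (\<integral>\<^sup>+s. (\<integral>\<^sup>+x. indicator {-1/2..1/2} (\<xi> x) * h (x + s *\<^sub>R e) \<partial>lborel) \<partial>lborel)"
    by (rule lborel_pair.Fubini'[symmetric]) measurable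
  also have "\<dots> = (\<integral>\<^sup>+s. (\<integral>\<^sup>+x. indicator {-1/2..1/2} (\<xi> x - s) * h x \<partial>lborel) \<partial>lborel)"
  proof (rule nn_integral_cong)
    fix s :: real
    have "(\<integral>\<^sup>+x. indicator {-1/2..1/2} (\<xi> x - s) * h x \<partial>lborel)
        = (\<integral>\<^sup>+x. indicator {-1/2..1/2} (\<xi> x - s) * h x \<partial>distr lborel borel ((+) (s *\<^sub>R e)))"
      by (simp add: lborel_distr_plus)
    also have "\<dots> = (\<integral>\<^sup>+x. indicator {-1/2..1/2} (\<xi> (s *\<^sub>R e + x) - s) * h (s *\<^sub>R e + x) \<partial>lborel)"
      by (subst nn_integral_distr) measurable
    also have "\<dots> = (\<integral>\<^sup>+x. indicator {-1/2..1/2} (\<xi> x) * h (x + s *\<^sub>R e) \<partial>lborel)"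
      using \<xi> by (intro nn_integral_cong) (simp add: add.commute)
    finally show "(\<integral>\<^sup>+x. indicator {-1/2..1/2} (\<xi> x) * h (x + s *\<^sub>R e) \<partial>lborel)
        = (\<integral>\<^sup>+x. indicator {-1/2..1/2} (\<xi> x - s) * h x \<partial>lborel)" by simp
  qed
  also have "\<dots> = (\<integral>\<^sup>+x. (\<integral>\<^sup>+s. indicator {-1/2..1/2} (\<xi> x - s) * h x \<partial>lborel) \<partial>lborel)"
    by (rule lborel_pair.Fubini') measurable
  also have "\<dots> = (\<integral>\<^sup>+x. h x \<partial>lborel)"
  proof (rule nn_integral_cong)
    fix x
    have "(\<integral>\<^sup>+s. indicator {-1/2..1/2} (\<xi> x - s) * h x \<partial>lborel)
        = (\<integral>\<^sup>+s. indicator {\<xi> x - 1/2..\<xi> x + 1/2} s * h x \<partial>lborel)"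
      by (intro nn_integral_cong) (auto split: split_indicator)
    also have "\<dots> = h x"
      by (subst nn_integral_multc) auto
    finally show "(\<integral>\<^sup>+s. indicator {-1/2..1/2} (\<xi> x - s) * h x \<partial>lborel) = h x" .
  qed
  finally show ?thesis .
qed

text \<open>
The previous lemma says that Lebesgue measure is an image of the product of the slab with the line;
hence the version for integrable functions.
\<close>

lemma integral_lines:
  fixes e :: "'a::euclidean_space" and \<xi> h :: "'a \<Rightarrow> real"
  assumes [measurable]: "\<xi> \<in> borel_measurable borel" and h: "integrable lborel h"
      "h \<in> borel_measurable borel"
    and \<xi>: "\<And>x s. \<xi> (x + s *\<^sub>R e) = \<xi> x + s"
  shows "(LINT x|lborel. h x)
    = (LINT x|lborel. unit_window (\<xi> x) * (LINT s|lborel. h (x + s *\<^sub>R e)))"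
proof -
  note [measurable] = h(2)
  let ?D = "density (lborel \<Otimes>\<^sub>M lborel) (\<lambda>(x::'a, s::real). indicator {-1/2..1/2} (\<xi> x) :: ennreal)"
  let ?f = "\<lambda>(x, s). x + s *\<^sub>R e"
  have distr: "distr ?D borel ?f = lborel"
  proof (rule measure_eqI)
    fix A :: "'a set" assume "A \<in> sets (distr ?D borel ?f)"
    then have [measurable]: "A \<in> sets borel" by simp
    have "emeasure (distr ?D borel ?f) A
        = (\<integral>\<^sup>+z. indicator A z \<partial>distr ?D borel ?f)" by simp
    also have "\<dots> = (\<integral>\<^sup>+z. indicator A (?f z) \<partial>?D)"
      by (subst nn_integral_distr) (auto simp: case_prod_beta')
    also have "\<dots> = (\<integral>\<^sup>+z. (\<lambda>(x, s). indicator {-1/2..1/2} (\<xi> x)) z * indicator A (?f z) \<partial>(lborel \<Otimes>\<^sub>M lborel))"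
      by (subst nn_integral_density) (auto simp: case_prod_beta')
    also have "\<dots> = (\<integral>\<^sup>+x. (\<integral>\<^sup>+s. indicator {-1/2..1/2} (\<xi> x) * indicator A (x + s *\<^sub>R e) \<partial>lborel) \<partial>lborel)"
      by (subst lborel.nn_integral_fst[symmetric]) (auto simp: case_prod_beta')
    also have "\<dots> = (\<integral>\<^sup>+x. indicator A x \<partial>lborel)"
      by (rule nn_integral_lines) (use \<xi> in auto)
    finally show "emeasure (distr ?D borel ?f) A = emeasure lborel A" by simp
  qed simp
  have int: "integrable (lborel \<Otimes>\<^sub>M lborel) (\<lambda>z. unit_window (\<xi> (fst z)) *\<^sub>R h (?f z))"
  proof -
    have "integrable ?D (\<lambda>z. h (?f z))"
      using h(1) distr by (subst integrable_distr_eq[symmetric, where N=borel]) (auto simp: case_prod_beta')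
    then have "integrable (density (lborel \<Otimes>\<^sub>M lborel) (\<lambda>z::'a \<times> real. ennreal (unit_window (\<xi> (fst z))))) (\<lambda>z. h (?f z))"
      by (simp add: case_prod_beta' ennreal_indicator)
    then show ?thesis
      by (subst (asm) integrable_density) (auto simp: case_prod_beta')
  qed
  have "(LINT x|lborel. h x) = (LINT z|?D. h (?f z))"
    by (subst distr[symmetric], subst integral_distr) (auto simp: case_prod_beta')
  also have "\<dots> = (LINT z|density (lborel \<Otimes>\<^sub>M lborel) (\<lambda>z::'a \<times> real. ennreal (unit_window (\<xi> (fst z)))). h (?f z))"
    by (simp add: case_prod_beta' ennreal_indicator)
  also have "\<dots> = (LINT z|(lborel \<Otimes>\<^sub>M lborel). unit_window (\<xi> (fst z)) *\<^sub>R h (?f z))"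
    by (subst integral_density) (auto simp: case_prod_beta')
  also have "\<dots> = (LINT x|lborel. LINT s|lborel. unit_window (\<xi> x) *\<^sub>R h (x + s *\<^sub>R e))"
    using lborel_pair.integral_fst'[OF int] by simp
  also have "\<dots> = (LINT x|lborel. unit_window (\<xi> x) * (LINT s|lborel. h (x + s *\<^sub>R e)))"
    by simp
  finally show ?thesis .
qed

text \<open>
A shear along \<open>v\<close> translates each line parallel to \<open>v\<close>, which changes no integral over the line.
\<close>

lemma integral_shear:
  fixes v :: "'a::euclidean_space" and \<sigma> f :: "'a \<Rightarrow> real"
  assumes [measurable]: "\<sigma> \<in> borel_measurable borel" "f \<in> borel_measurable borel"
    and \<sigma>: "\<And>x s. \<sigma> (x + s *\<^sub>R v) = \<sigma> x"
  shows "(LINT x|lborel. f (x + \<sigma> x *\<^sub>R v)) = (LINT x|lborel. f x)"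
proof (cases "v = 0")
  case False
  define \<xi> where "\<xi> x = (x \<bullet> v) / (v \<bullet> v)" for x
  have [measurable]: "\<xi> \<in> borel_measurable borel" unfolding \<xi>_def by measurable
  have \<xi>: "\<xi> (x + s *\<^sub>R v) = \<xi> x + s" for x s
    using False by (simp add: \<xi>_def inner_add_left add_divide_distrib)
  have nn: "(\<integral>\<^sup>+x. h (x + \<sigma> x *\<^sub>R v) \<partial>lborel) = (\<integral>\<^sup>+x. h x \<partial>lborel)"
    if [measurable]: "h \<in> borel_measurable borel" for h :: "'a \<Rightarrow> ennreal"
  proof -
    have "(\<integral>\<^sup>+x. h (x + \<sigma> x *\<^sub>R v) \<partial>lborel)
       = (\<integral>\<^sup>+x. (\<integral>\<^sup>+s. indicator {-1/2..1/2} (\<xi> x) * h ((x + s *\<^sub>R v) + \<sigma> (x + s *\<^sub>R v) *\<^sub>R v) \<partial>lborel) \<partial>lborel)"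
      by (rule nn_integral_lines[symmetric]) (use \<xi> in measurable)
    also have "\<dots> = (\<integral>\<^sup>+x. (\<integral>\<^sup>+s. indicator {-1/2..1/2} (\<xi> x) * h (x + s *\<^sub>R v) \<partial>lborel) \<partial>lborel)"
    proof (rule nn_integral_cong)
      fix x
      let ?g = "\<lambda>s. indicator {-1/2..1/2} (\<xi> x) * h (x + s *\<^sub>R v)"
      have "(\<integral>\<^sup>+s. ?g s \<partial>lborel) = (\<integral>\<^sup>+s. ?g s \<partial>distr lborel borel ((+) (\<sigma> x)))"
        by (simp add: lborel_distr_plus)
      also have "\<dots> = (\<integral>\<^sup>+s. ?g (\<sigma> x + s) \<partial>lborel)"
        by (subst nn_integral_distr) measurable
      finally show "(\<integral>\<^sup>+s. indicator {-1/2..1/2} (\<xi> x) * h ((x + s *\<^sub>R v) + \<sigma> (x + s *\<^sub>R v) *\<^sub>R v) \<partial>lborel)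
        = (\<integral>\<^sup>+s. ?g s \<partial>lborel)"
        by (simp add: \<sigma> algebra_simps)
    qed
    also have "\<dots> = (\<integral>\<^sup>+x. h x \<partial>lborel)"
      by (rule nn_integral_lines) (use \<xi> in measurable)
    finally show ?thesis .
  qed
  have "distr lborel borel (\<lambda>x. x + \<sigma> x *\<^sub>R v) = lborel"
  proof (rule measure_eqI)
    fix A :: "'a set" assume "A \<in> sets (distr lborel borel (\<lambda>x. x + \<sigma> x *\<^sub>R v))"
    then have [measurable]: "A \<in> sets borel" by simp
    have "emeasure (distr lborel borel (\<lambda>x. x + \<sigma> x *\<^sub>R v)) A
       = (\<integral>\<^sup>+z. indicator A z \<partial>distr lborel borel (\<lambda>x. x + \<sigma> x *\<^sub>R v))" by simp
    also have "\<dots> = (\<integral>\<^sup>+x. indicator A (x + \<sigma> x *\<^sub>R v) \<partial>lborel)"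
      by (subst nn_integral_distr) auto
    finally show "emeasure (distr lborel borel (\<lambda>x. x + \<sigma> x *\<^sub>R v)) A = emeasure lborel A"
      by (simp add: nn)
  qed simp
  then have "(LINT x|lborel. f x) = (LINT x|distr lborel borel (\<lambda>x. x + \<sigma> x *\<^sub>R v). f x)"
    by simp
  also have "\<dots> = (LINT x|lborel. f (x + \<sigma> x *\<^sub>R v))"
    by (subst integral_distr) auto
  finally show ?thesis by simp
qed simp

text \<open>
A function that is constant along \<open>e\<close> has the same integral over every slab that cuts the lines in
segments of length 1, and thickness scales this integral linearly.
\<close>

lemma integral_window:
  fixes e :: "'a::euclidean_space" and \<xi> \<zeta> f :: "'a \<Rightarrow> real"
  assumes [measurable]: "\<xi> \<in> borel_measurable borel" "\<zeta> \<in> borel_measurable borel"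
      "f \<in> borel_measurable borel"
    and \<xi>: "\<And>x s. \<xi> (x + s *\<^sub>R e) = \<xi> x + s"
    and \<zeta>: "\<And>x s. \<zeta> (x + s *\<^sub>R e) = \<zeta> x + c * s" and c: "c \<noteq> 0"
    and f: "\<And>x s. f (x + s *\<^sub>R e) = f x"
    and int: "integrable lborel (\<lambda>x. unit_window (\<zeta> x) * f x)"
  shows "\<bar>c\<bar> * (LINT x|lborel. unit_window (\<zeta> x) * f x) = (LINT x|lborel. unit_window (\<xi> x) * f x)"
proof -
  have w: "(LINT s|lborel. unit_window (y + c * s)) = 1 / \<bar>c\<bar>" for y
  proof -
    have "(LINT s|lborel. unit_window s) = \<bar>c\<bar> * (LINT s|lborel. unit_window (y + c * s))"
      using lborel_integral_real_affine[OF c, of unit_window y] by simp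
    then show ?thesis using c by (simp add: field_simps)
  qed
  have "(LINT x|lborel. unit_window (\<zeta> x) * f x)
     = (LINT x|lborel. unit_window (\<xi> x) * (LINT s|lborel. unit_window (\<zeta> (x + s *\<^sub>R e)) * f (x + s *\<^sub>R e)))"
    by (rule integral_lines) (use \<xi> int in \<open>auto\<close>)
  also have "\<dots> = (LINT x|lborel. (1 / \<bar>c\<bar>) * (unit_window (\<xi> x) * f x))"
    by (intro Bochner_Integration.integral_cong refl) (simp add: \<zeta> f w[simplified])
  also have "\<dots> = (1 / \<bar>c\<bar>) * (LINT x|lborel. unit_window (\<xi> x) * f x)"
    by (rule Bochner_Integration.integral_mult_right_zero)
  finally show ?thesis using c by simp
qed

lemma integrable_bounded_support:
  fixes h :: "'a::euclidean_space \<Rightarrow> real"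
  assumes "h \<in> borel_measurable borel" "\<And>x. \<bar>h x\<bar> \<le> B" "\<And>x. h x \<noteq> 0 \<Longrightarrow> norm x \<le> R"
  shows "integrable lborel h"
proof (rule Bochner_Integration.integrable_bound)
  show "integrable lborel (\<lambda>x. B * indicator (cball (0::'a) R) x)"
    by (intro integrable_mult_right integrable_real_indicator)
      (use emeasure_bounded_finite[OF bounded_cball, of "0::'a" R] in auto)
  have "\<bar>h x\<bar> \<le> \<bar>B * indicator (cball (0::'a) R) x\<bar>" for x
    using assms(2)[of x] assms(3)[of x] by (auto split: split_indicator simp: dist_norm)
  then show "AE x in lborel. norm (h x) \<le> norm (B * indicator (cball (0::'a) R) x)" by simp
qed (use assms in simp)

text \<open>
Here \<open>f\<close> lives on the hyperplane \<open>a \<bullet> x = b\<close>. On the left it is extended constantly along \<open>e\<close>, on the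
right along the unit normal. The window in \<open>a \<bullet> x - b\<close> is first replaced by the window in the distance \<open>T\<close>,
which accounts for the factor, and then a shear parallel to the hyperplane moves \<open>e\<close> into normal position.
\<close>

lemma oblique_cylinder:
  fixes a e :: "'a::euclidean_space" and b :: real and f :: "'a \<Rightarrow> real"
  assumes [measurable]: "f \<in> borel_measurable borel"
    and f: "\<And>x. \<bar>f x\<bar> \<le> B" "\<And>x. f x \<noteq> 0 \<Longrightarrow> norm x \<le> R"
    and e: "a \<bullet> e = 1"
  defines "T \<equiv> \<lambda>x. (a \<bullet> x - b) / norm a"
  shows "(LINT x|lborel. unit_window (a \<bullet> x - b) * f (x - (a \<bullet> x - b) *\<^sub>R e))
    = (1 / norm a) * (LINT x|lborel. unit_window (T x) * f (x - T x *\<^sub>R (a /\<^sub>R norm a)))" (is "?lhs = ?rhs")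
proof -
  define c where "c = 1 / norm a"
  have a: "a \<noteq> 0" using e by auto
  then have c: "c > 0" by (simp add: c_def)
  have T: "T x = c * (a \<bullet> x - b)" for x by (simp add: T_def c_def)
  have aa: "a \<bullet> a = norm a * norm a" by (metis power2_eq_square power2_norm_eq_inner)
  have [measurable]: "T \<in> borel_measurable borel" unfolding T_def by measurable
  define v where "v = a /\<^sub>R norm a - norm a *\<^sub>R e"
  have av: "a \<bullet> v = 0" using a by (simp add: v_def inner_diff_right e aa)
  have "c * ?lhs = c * (LINT x|lborel. unit_window (T x) * f (x - (a \<bullet> x - b) *\<^sub>R e)) * c"
  proof -
    have 1: "(a \<bullet> (x + s *\<^sub>R e) - b) = (a \<bullet> x - b) + s" for x s
      by (simp add: inner_add_right e)
    have "integrable lborel (\<lambda>x. unit_window (T x) * f (x - (a \<bullet> x - b) *\<^sub>R e))"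
    proof (rule integrable_bounded_support[where B=B and R="R + norm a * norm e"])
      fix x
      show "\<bar>unit_window (T x) * f (x - (a \<bullet> x - b) *\<^sub>R e)\<bar> \<le> B"
        using f(1)[of x] f(1)[of "x - (a \<bullet> x - b) *\<^sub>R e"] by (auto split: split_indicator)
      assume "unit_window (T x) * f (x - (a \<bullet> x - b) *\<^sub>R e) \<noteq> 0"
      then have T1: "\<bar>T x\<bar> \<le> 1" and *: "norm (x - (a \<bullet> x - b) *\<^sub>R e) \<le> R"
        using f(2) by (auto split: split_indicator_asm)
      have "\<bar>a \<bullet> x - b\<bar> \<le> norm a" using T1 a by (simp add: T_def divide_simps)
      then have "norm ((a \<bullet> x - b) *\<^sub>R e) \<le> norm a * norm e"
        by (simp add: mult_right_mono)
      then show "norm x \<le> R + norm a * norm e" using *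
        by (smt (verit) norm_triangle_sub)
    qed measurable
    then have "\<bar>c\<bar> * (LINT x|lborel. unit_window (T x) * f (x - (a \<bullet> x - b) *\<^sub>R e)) = ?lhs"
      by (intro integral_window[where e=e]) (use c in \<open>auto simp: e T inner_add_right algebra_simps\<close>)
    then show ?thesis using c by simp
  qed
  moreover have "(LINT x|lborel. unit_window (T x) * f (x - (a \<bullet> x - b) *\<^sub>R e))
     = (LINT x|lborel. unit_window (T x) * f (x - T x *\<^sub>R (a /\<^sub>R norm a)))"
  proof -
    have Tv: "T (x + s *\<^sub>R v) = T x" for x s by (simp add: T inner_add_right av)
    have "(LINT x|lborel. unit_window (T x) * f (x - T x *\<^sub>R (a /\<^sub>R norm a)))
      = (LINT x|lborel. unit_window (T (x + T x *\<^sub>R v)) * f (x + T x *\<^sub>R v - T (x + T x *\<^sub>R v) *\<^sub>R (a /\<^sub>R norm a)))"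
      by (rule integral_shear[symmetric, where \<sigma>=T and v=v and f="\<lambda>x. unit_window (T x) * f (x - T x *\<^sub>R (a /\<^sub>R norm a))"]) (use Tv in auto)
    also have "\<dots> = (LINT x|lborel. unit_window (T x) * f (x - (a \<bullet> x - b) *\<^sub>R e))"
    proof (intro Bochner_Integration.integral_cong refl)
      fix x
      have "T x * norm a = a \<bullet> x - b" using a by (simp add: T_def)
      then have "x + T x *\<^sub>R v - T x *\<^sub>R (a /\<^sub>R norm a) = x - (a \<bullet> x - b) *\<^sub>R e"
        by (simp add: v_def scaleR_right_diff_distrib flip: \<open>T x * norm a = a \<bullet> x - b\<close>)
      then show "unit_window (T (x + T x *\<^sub>R v)) * f (x + T x *\<^sub>R v - T (x + T x *\<^sub>R v) *\<^sub>R (a /\<^sub>R norm a))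
        = unit_window (T x) * f (x - (a \<bullet> x - b) *\<^sub>R e)" by (simp only: Tv)
    qed
    finally show ?thesis by simp
  qed
  ultimately have "c * ?lhs = c * ?rhs" by (simp add: c_def)
  then show ?thesis using c mult_cancel_left[of c ?lhs ?rhs] by linarith
qed

section \<open>Simplices and the divergence theorem\<close>

lemma closest_point_hyperplane:
  fixes a :: "'a::euclidean_space"
  assumes "a \<noteq> 0"
  shows "closest_point {x. a \<bullet> x = b} z = z - ((a \<bullet> z - b) / norm a) *\<^sub>R (a /\<^sub>R norm a)"
    and "infdist z {x. a \<bullet> x = b} = \<bar>(a \<bullet> z - b) / norm a\<bar>"
proof -
  define y where "y = z - ((a \<bullet> z - b) / norm a) *\<^sub>R (a /\<^sub>R norm a)"
  have aa: "a \<bullet> a = norm a * norm a" by (metis power2_eq_square power2_norm_eq_inner)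
  have y: "a \<bullet> y = b" using assms by (simp add: y_def inner_diff_right aa)
  have d: "dist z y = \<bar>(a \<bullet> z - b) / norm a\<bar>" using assms by (simp add: y_def dist_norm divide_inverse abs_mult)
  have "dist z y \<le> dist z x" if "a \<bullet> x = b" for x
  proof -
    have "\<bar>a \<bullet> z - b\<bar> = \<bar>a \<bullet> (z - x)\<bar>" using that by (simp add: inner_diff_right)
    also have "\<dots> \<le> norm a * dist z x" by (simp add: dist_norm Cauchy_Schwarz_ineq2)
    finally show ?thesis using assms by (simp add: d divide_simps mult.commute)
  qed
  then show *: "closest_point {x. a \<bullet> x = b} z = z - ((a \<bullet> z - b) / norm a) *\<^sub>R (a /\<^sub>R norm a)"
    unfolding y_def[symmetric]
    by (intro closest_point_unique[symmetric]) (use y in \<open>auto simp: convex_hyperplane closed_hyperplane\<close>)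
  show "infdist z {x. a \<bullet> x = b} = \<bar>(a \<bullet> z - b) / norm a\<bar>"
    using y d assms unfolding infdist_eq_setdist
    by (subst setdist_closest_point) (auto simp: closed_hyperplane * y_def[symmetric] abs_mult divide_inverse)
qed

lemma integral_face_measure:
  fixes F :: "(real^'n) set" and a :: "real^'n" and b :: real and g :: "real^'n \<Rightarrow> real"
  assumes F: "compact F" "affine hull F = {x. a \<bullet> x = b}" and a: "a \<noteq> 0"
    and [measurable]: "g \<in> borel_measurable borel"
  defines "T \<equiv> \<lambda>x. (a \<bullet> x - b) / norm a"
  shows "(LINT x|face_measure F. g x)
    = (LINT x|lborel. unit_window (T x) * (indicator F (x - T x *\<^sub>R (a /\<^sub>R norm a)) * g (x - T x *\<^sub>R (a /\<^sub>R norm a))))"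
    and "finite_measure (face_measure F)"
    and "AE x in face_measure F. x \<in> F"
    and "sets borel \<subseteq> sets (face_measure F)"
proof -
  have [measurable]: "F \<in> sets borel" using F(1) by (simp add: borel_compact)
  let ?\<pi> = "\<lambda>x. x - T x *\<^sub>R (a /\<^sub>R norm a)"
  have [measurable]: "T \<in> borel_measurable borel" unfolding T_def by measurable
  have cp: "closest_point (affine hull F) = ?\<pi>" "infdist z (affine hull F) = \<bar>T z\<bar>" for z
    using closest_point_hyperplane[OF a, where b=b] F(2) by (auto simp: T_def)
  define C where "C = {z. ?\<pi> z \<in> F \<and> \<bar>T z\<bar> \<le> 1/2}"
  have fm: "face_measure F = completion (distr (lebesgue_on C) borel ?\<pi>)"
    unfolding face_measure_def cp C_def ..
  have C[measurable]: "C \<in> sets borel" unfolding C_def by measurable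
  then have Cl: "C \<in> sets lebesgue" by simp
  obtain R where R: "\<And>x. x \<in> F \<Longrightarrow> norm x \<le> R"
    using compact_imp_bounded[OF F(1)] by (auto simp: bounded_iff)
  have "C \<subseteq> cball 0 (R + 1)"
  proof
    fix x assume "x \<in> C"
    then have "norm (?\<pi> x) \<le> R" "\<bar>T x\<bar> \<le> 1/2" using R by (auto simp: C_def)
    moreover have "norm (T x *\<^sub>R (a /\<^sub>R norm a)) = \<bar>T x\<bar>" using a by (simp add: abs_mult)
    ultimately have "norm x \<le> R + 1" by (smt (verit) norm_triangle_sub field_sum_of_halves)
    then show "x \<in> cball 0 (R+1)" by simp
  qed
  then have "bounded C" by (meson bounded_cball bounded_subset)
  then have "C \<in> lmeasurable" using Cl by (simp add: bounded_set_imp_lmeasurable)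
  then interpret L: finite_measure "lebesgue_on C" by (rule finite_measure_lebesgue_on)
  have \<pi>: "?\<pi> \<in> lebesgue_on C \<rightarrow>\<^sub>M borel"
    by (intro measurable_restrict_space1 measurable_completion) measurable
  show "finite_measure (face_measure F)"
    unfolding fm using finite_measure.emeasure_finite[OF L.finite_measure_distr[OF \<pi>]]
    by (intro finite_measureI) (simp add: main_part_sets)
  have "AE x in distr (lebesgue_on C) borel ?\<pi>. x \<in> F"
    using \<pi> by (subst AE_distr_iff) (auto simp: C_def)
  then show "AE x in face_measure F. x \<in> F" unfolding fm by (rule AE_completion)
  show "sets borel \<subseteq> sets (face_measure F)" unfolding fm by auto
  have "(LINT x|face_measure F. g x) = (LINT x|distr (lebesgue_on C) borel ?\<pi>. g x)"
    unfolding fm by (rule integral_completion) simp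
  also have "\<dots> = (LINT x|lebesgue_on C. g (?\<pi> x))"
    using \<pi> by (rule integral_distr) simp
  also have "\<dots> = (LINT x|lebesgue. indicator C x *\<^sub>R g (?\<pi> x))"
    using Cl by (subst integral_restrict_space) (auto simp: set_lebesgue_integral_def)
  also have "\<dots> = (LINT x|lborel. indicator C x *\<^sub>R g (?\<pi> x))"
    by (rule integral_completion) measurable
  also have "\<dots> = (LINT x|lborel. unit_window (T x) * (indicator F (?\<pi> x) * g (?\<pi> x)))"
    by (intro Bochner_Integration.integral_cong) (auto simp: C_def abs_le_iff split: split_indicator)
  finally show "(LINT x|face_measure F. g x) = (LINT x|lborel. unit_window (T x) * (indicator F (?\<pi> x) * g (?\<pi> x)))" .
qed

text \<open>
The two sides of the divergence theorem meet in this formula: integrals over lines parallel to an edge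
produce oblique cylinders over facets, and surface measure is defined by straight ones.
\<close>

lemma face_integral_oblique:
  fixes F :: "(real^'n) set" and a :: "real^'n" and b :: real and g :: "real^'n \<Rightarrow> real"
  assumes F: "compact F" "affine hull F = {x. a \<bullet> x = b}"
    and g: "continuous_on UNIV g" and e: "a \<bullet> e = 1"
  shows "(LINT x|lborel. unit_window (a \<bullet> x - b) *
            (indicator F (x - (a \<bullet> x - b) *\<^sub>R e) * g (x - (a \<bullet> x - b) *\<^sub>R e)))
    = (LINT x|face_measure F. g x) / norm a"
proof -
  have a: "a \<noteq> 0" using e by auto
  have [measurable]: "g \<in> borel_measurable borel" using g by (rule borel_measurable_continuous_onI)
  have [measurable]: "F \<in> sets borel" using F(1) by (simp add: borel_compact)
  obtain R where R: "\<And>x. x \<in> F \<Longrightarrow> norm x \<le> R"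
    using compact_imp_bounded[OF F(1)] by (auto simp: bounded_iff)
  have "compact (g ` F)" using F(1) g continuous_on_subset compact_continuous_image by blast
  then obtain B where B: "\<And>x. x \<in> F \<Longrightarrow> \<bar>g x\<bar> \<le> B"
    unfolding bounded_iff by (metis compact_imp_bounded bounded_iff imageI real_norm_def)
  have "(LINT x|lborel. unit_window (a \<bullet> x - b) *
            (\<lambda>x. indicator F x * g x) (x - (a \<bullet> x - b) *\<^sub>R e))
    = 1 / norm a * (LINT x|lborel. unit_window ((a \<bullet> x - b) / norm a) *
         (\<lambda>x. indicator F x * g x) (x - ((a \<bullet> x - b) / norm a) *\<^sub>R (a /\<^sub>R norm a)))"
  proof (rule oblique_cylinder[where B="max B 0" and R=R])
    show "\<bar>indicator F x * g x\<bar> \<le> max B 0" for x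
      using B[of x] by (auto split: split_indicator)
    show "norm x \<le> R" if "indicator F x * g x \<noteq> 0" for x
      using R that by (auto split: split_indicator_asm)
  qed (use e in \<open>measurable\<close>)
  then show ?thesis
    by (simp add: integral_face_measure(1)[OF F a])
qed

text \<open>
A full-dimensional simplex with vertex set \<open>V\<close> together with its barycentric coordinates
\<open>x \<mapsto> a v \<bullet> x - b v\<close>. Their gradients \<open>a v\<close> are inner normals of the facets, with length the inverse of the
height over the facet.
\<close>

locale simplex_coords =
  fixes K V :: "(real^'n) set" and a :: "real^'n \<Rightarrow> real^'n" and b :: "real^'n \<Rightarrow> real"
  assumes ind: "\<not> affine_dependent V" and card_V: "card V = Suc CARD('n)"
    and K_hull: "K = convex hull V"
    and vertex: "\<And>v w. v \<in> V \<Longrightarrow> w \<in> V \<Longrightarrow> a v \<bullet> w - b v = (if v = w then 1 else 0)"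
begin

definition lam :: "real^'n \<Rightarrow> real^'n \<Rightarrow> real" where "lam v x = a v \<bullet> x - b v"

definition face :: "real^'n \<Rightarrow> (real^'n) set" where "face v = convex hull (V - {v})"

lemma fin: "finite V" using ind by (rule aff_independent_finite)

lemma lam_comb:
  assumes "sum c V = 1" "v \<in> V"
  shows "lam v (\<Sum>w\<in>V. c w *\<^sub>R w) = c v"
proof -
  have "lam v (\<Sum>w\<in>V. c w *\<^sub>R w) = (\<Sum>w\<in>V. c w * (a v \<bullet> w)) - b v * (\<Sum>w\<in>V. c w)"
    using assms by (simp add: lam_def inner_sum_right)
  also have "\<dots> = (\<Sum>w\<in>V. c w * (a v \<bullet> w - b v))"
    by (simp add: sum_distrib_left right_diff_distrib sum_subtractf mult.commute)
  also have "\<dots> = (\<Sum>w\<in>V. if w = v then c w else 0)"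
    using assms(2) by (intro sum.cong) (auto simp: vertex)
  finally show ?thesis using fin assms(2) by simp
qed

lemma lam_repr: "(\<Sum>v\<in>V. lam v x) = 1" "(\<Sum>v\<in>V. lam v x *\<^sub>R v) = x"
proof -
  have "x \<in> affine hull V"
    using affine_independent_span_eq[OF ind] card_V by simp
  then obtain c where c: "sum c V = 1" "(\<Sum>v\<in>V. c v *\<^sub>R v) = x"
    by (auto simp: affine_hull_finite[OF fin])
  have "lam v x = c v" if "v \<in> V" for v using lam_comb[OF c(1) that] c(2) by simp
  then show "(\<Sum>v\<in>V. lam v x) = 1" "(\<Sum>v\<in>V. lam v x *\<^sub>R v) = x" using c by simp_all
qed

lemma K_iff: "x \<in> K \<longleftrightarrow> (\<forall>v\<in>V. 0 \<le> lam v x)"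
proof
  assume "x \<in> K"
  then obtain c where "\<forall>v\<in>V. 0 \<le> c v" "sum c V = 1" "(\<Sum>v\<in>V. c v *\<^sub>R v) = x"
    by (auto simp: K_hull convex_hull_finite[OF fin])
  then show "\<forall>v\<in>V. 0 \<le> lam v x" using lam_comb by auto
next
  assume "\<forall>v\<in>V. 0 \<le> lam v x"
  then show "x \<in> K" using lam_repr[of x] by (auto simp: K_hull convex_hull_finite[OF fin])
qed

lemma lam_vertex: "v \<in> V \<Longrightarrow> w \<in> V \<Longrightarrow> lam v w = (if v = w then 1 else 0)"
  by (simp add: lam_def vertex)

lemma face_iff:
  assumes "v \<in> V"
  shows "x \<in> face v \<longleftrightarrow> x \<in> K \<and> lam v x = 0"
proof
  assume "x \<in> face v"
  then obtain c where c: "\<forall>w\<in>V-{v}. 0 \<le> c w" "sum c (V-{v}) = 1" "(\<Sum>w\<in>V-{v}. c w *\<^sub>R w) = x"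
    using fin by (auto simp: face_def convex_hull_finite)
  let ?c = "\<lambda>w. if w = v then 0 else c w"
  have "sum ?c V = 1" "(\<Sum>w\<in>V. ?c w *\<^sub>R w) = x"
    using c fin assms by (simp_all add: sum.remove[of V v])
  from lam_comb[OF this(1) assms] this(2) have "lam v x = 0" by simp
  moreover have "face v \<subseteq> K" unfolding face_def K_hull by (rule hull_mono) auto
  ultimately show "x \<in> K \<and> lam v x = 0" using \<open>x \<in> face v\<close> by auto
next
  assume x: "x \<in> K \<and> lam v x = 0"
  then have "(\<Sum>w\<in>V-{v}. lam w x) = 1" "(\<Sum>w\<in>V-{v}. lam w x *\<^sub>R w) = x"
    using lam_repr[of x] fin assms by (simp_all add: sum.remove[of V v])
  then show "x \<in> face v"
    using x fin by (auto simp: face_def convex_hull_finite K_iff intro!: exI[of _ "\<lambda>w. lam w x"])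
qed

lemma affine_hull_face:
  assumes "v \<in> V"
  shows "affine hull (face v) = {x. a v \<bullet> x = b v}"
proof -
  have "x \<in> affine hull (V - {v}) \<longleftrightarrow> lam v x = 0" for x
  proof
    assume "x \<in> affine hull (V - {v})"
    then obtain c where c: "sum c (V-{v}) = 1" "(\<Sum>w\<in>V-{v}. c w *\<^sub>R w) = x"
      using fin by (auto simp: affine_hull_finite)
    let ?c = "\<lambda>w. if w = v then 0 else c w"
    have "sum ?c V = 1" "(\<Sum>w\<in>V. ?c w *\<^sub>R w) = x"
      using c fin assms by (simp_all add: sum.remove[of V v])
    from lam_comb[OF this(1) assms] this(2) show "lam v x = 0" by simp
  next
    assume x: "lam v x = 0"
    then have "(\<Sum>w\<in>V-{v}. lam w x) = 1" "(\<Sum>w\<in>V-{v}. lam w x *\<^sub>R w) = x"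
      using lam_repr[of x] fin assms by (simp_all add: sum.remove[of V v])
    then show "x \<in> affine hull (V - {v})"
      using x fin by (auto simp: affine_hull_finite intro!: exI[of _ "\<lambda>w. lam w x"])
  qed
  then show ?thesis by (auto simp: face_def affine_hull_convex_hull lam_def)
qed

lemma compact_K: "compact K" and compact_face: "compact (face v)"
  using fin by (auto simp: K_hull face_def finite_imp_compact_convex_hull)

lemma facets: "{F. F facet_of K} = face ` V"
proof -
  have "face v \<noteq> {}" if "v \<in> V" for v
  proof -
    have "card (V - {v}) = CARD('n)" using that card_V fin by simp
    then have "V - {v} \<noteq> {}" using fin by (metis card.empty zero_less_card_finite less_irrefl)
    then show ?thesis by (simp add: face_def)
  qed
  then show ?thesis
    unfolding K_hull facet_of_convex_hull_affine_independent[OF ind]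
    by (auto simp: face_def image_iff)
qed

lemma inj_face: "inj_on face V"
proof
  fix v w assume vw: "v \<in> V" "w \<in> V" "face v = face w"
  show "v = w"
  proof (rule ccontr)
    assume "v \<noteq> w"
    then have "w \<in> face v" using vw(1,2) by (auto simp: face_iff K_iff lam_vertex)
    then show False using vw by (auto simp: face_iff lam_vertex)
  qed
qed

lemma ex_other: assumes "v \<in> V" obtains w where "w \<in> V" "w \<noteq> v"
proof -
  have "card (V - {v}) = CARD('n)" using assms card_V fin by simp
  then have "V - {v} \<noteq> {}" using fin by (metis card.empty zero_less_card_finite less_irrefl)
  then show ?thesis using that by auto
qed

text \<open>
Along an edge only the coordinates of its two ends change, at rates 1 and -1.
\<close>

lemma gradient_edge: "v \<in> V \<Longrightarrow> w \<in> V \<Longrightarrow> v' \<in> V \<Longrightarrow>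
    a v \<bullet> (w - v') = (if v = w then 1 else 0) - (if v = v' then 1 else 0)"
  using vertex[of v w] vertex[of v v'] by (simp add: inner_diff_right split: if_splits)

lemma a_nz: assumes "v \<in> V" shows "a v \<noteq> 0"
proof -
  obtain w where "w \<in> V" "w \<noteq> v" using ex_other[OF assms] .
  then show ?thesis using gradient_edge[of v v w] assms by auto
qed

lemma gradient_sum: "(\<Sum>v\<in>V. a v \<bullet> e) = 0" "(\<Sum>v\<in>V. (a v \<bullet> e) *\<^sub>R v) = e"
proof -
  have l: "lam v e - lam v 0 = a v \<bullet> e" for v by (simp add: lam_def)
  show "(\<Sum>v\<in>V. a v \<bullet> e) = 0"
    using lam_repr(1)[of e] lam_repr(1)[of 0] by (simp flip: l add: sum_subtractf)
  show "(\<Sum>v\<in>V. (a v \<bullet> e) *\<^sub>R v) = e"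
    using lam_repr(2)[of e] lam_repr(2)[of 0] by (simp flip: l add: sum_subtractf scaleR_left_diff_distrib)
qed

text \<open>
The affine function \<open>n \<bullet> x - \<beta>\<close> vanishes at all vertices but \<open>v\<close>, hence is a multiple of the
barycentric coordinate of \<open>v\<close>; its gradient is \<open>n\<close>.
\<close>

lemma parallel_gradient:
  assumes v: "v \<in> V" and eq: "\<And>x. x \<in> V - {v} \<Longrightarrow> n \<bullet> x = \<beta>"
  shows "n = (n \<bullet> v - \<beta>) *\<^sub>R a v"
proof -
  have "n \<bullet> e = ((n \<bullet> v - \<beta>) *\<^sub>R a v) \<bullet> e" for e
  proof -
    have "n \<bullet> e = n \<bullet> (\<Sum>x\<in>V. (a x \<bullet> e) *\<^sub>R x)" by (simp add: gradient_sum)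
    also have "\<dots> = (\<Sum>x\<in>V. (a x \<bullet> e) * (n \<bullet> x))" by (simp add: inner_sum_right)
    also have "\<dots> = (\<Sum>x\<in>V. (a x \<bullet> e) * \<beta> + (if x = v then (a x \<bullet> e) * (n \<bullet> v - \<beta>) else 0))"
      using eq by (intro sum.cong) (auto simp: algebra_simps)
    also have "\<dots> = (\<Sum>x\<in>V. a x \<bullet> e) * \<beta> + (a v \<bullet> e) * (n \<bullet> v - \<beta>)"
      using fin v by (simp add: sum.distrib sum_distrib_right)
    finally show ?thesis by (simp add: gradient_sum)
  qed
  then show ?thesis by (metis inner_commute vector_eq_rdot)
qed

lemma outward_normal_face:
  assumes v: "v \<in> V"
  shows "outward_normal K (face v) = - (a v /\<^sub>R norm (a v))"
  unfolding outward_normal_def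
proof (rule the_equality)
  let ?n = "- (a v /\<^sub>R norm (a v))"
  note [simp] = a_nz[OF v]
  have "?n \<bullet> y \<le> ?n \<bullet> x" if "x \<in> face v" "y \<in> K" for x y
  proof -
    have "lam v x = 0" "0 \<le> lam v y" using that v by (auto simp: face_iff K_iff)
    then have "a v \<bullet> x \<le> a v \<bullet> y" by (simp add: lam_def)
    then show ?thesis by (simp add: divide_right_mono)
  qed
  then show "norm ?n = 1 \<and> (\<forall>x\<in>face v. \<forall>y\<in>K. ?n \<bullet> y \<le> ?n \<bullet> x)" by simp
  fix n assume n: "norm n = 1 \<and> (\<forall>x\<in>face v. \<forall>y\<in>K. n \<bullet> y \<le> n \<bullet> x)"
  obtain w where w: "w \<in> V" "w \<noteq> v" using ex_other[OF v] .
  have inF: "x \<in> V \<Longrightarrow> x \<noteq> v \<Longrightarrow> x \<in> face v" for x by (auto simp: face_def hull_inc)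
  have inK: "x \<in> V \<Longrightarrow> x \<in> K" for x by (auto simp: K_hull hull_inc)
  \<comment> \<open>all vertices of the facet maximise the functional \<open>n\<close> on the simplex\<close>
  have eq: "n \<bullet> x = n \<bullet> w" if "x \<in> V - {v}" for x
  proof (rule antisym)
    show "n \<bullet> x \<le> n \<bullet> w" using n inF[OF w] inK[of x] that by blast
    show "n \<bullet> w \<le> n \<bullet> x" using n inF[of x] inK[OF w(1)] that by blast
  qed
  define c where "c = n \<bullet> w - n \<bullet> v"
  have c: "c \<ge> 0" using n inF[OF w] inK[OF v] by (simp add: c_def)
  have nc: "n = - c *\<^sub>R a v" using parallel_gradient[OF v eq] by (simp add: c_def)
  then have "c * norm (a v) = 1" using n c by simp
  then have "c = 1 / norm (a v)" by (simp add: field_simps)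
  then show "n = ?n" using nc by (simp add: inverse_eq_divide)
qed

text \<open>
A line parallel to the edge from \<open>w\<close> to \<open>v\<close> meets the simplex, if at all, in a segment which starts on the facet
opposite to \<open>v\<close> and ends on the facet opposite to \<open>w\<close>. The fundamental theorem of calculus on the lines, integrated
over the slab of \<open>lam v\<close>, leaves two oblique cylinders.
\<close>

lemma gauss_edge:
  fixes g :: "real^'n \<Rightarrow> real" and g' :: "real^'n \<Rightarrow> real^'n \<Rightarrow> real"
  assumes g: "\<And>x. (g has_derivative g' x) (at x)"
    and g': "\<And>e. continuous_on UNIV (\<lambda>x. g' x e)"
    and v: "v \<in> V" and w: "w \<in> V" and vw: "v \<noteq> w"
  shows "(LINT x|lebesgue_on K. g' x (v - w))
    = (LINT x|face_measure (face w). g x) / norm (a w) - (LINT x|face_measure (face v). g x) / norm (a v)"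
proof -
  define e where "e = v - w"
  have cg: "continuous_on UNIV g"
    by (meson g continuous_at_imp_continuous_on has_derivative_continuous)
  have [measurable]: "g \<in> borel_measurable borel" using cg by (rule borel_measurable_continuous_onI)
  have [measurable]: "(\<lambda>x. g' x e) \<in> borel_measurable borel" using g' by (rule borel_measurable_continuous_onI)
  have Km[measurable]: "K \<in> sets borel" using compact_K by (simp add: borel_compact)
  have fm[measurable]: "face u \<in> sets borel" for u using compact_face by (simp add: borel_compact)
  have [measurable]: "lam u \<in> borel_measurable borel" for u unfolding lam_def[abs_def] by measurable
  have lam_e: "lam u (x + s *\<^sub>R e) = lam u x + ((if u = v then 1 else 0) - (if u = w then 1 else 0)) * s"
    if "u \<in> V" for u x s
    using gradient_edge[OF that v w] by (simp add: lam_def inner_add_right e_def mult.commute)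
  define P where "P x \<longleftrightarrow> (\<forall>u\<in>V - {v,w}. 0 \<le> lam u x) \<and> 0 \<le> lam v x + lam w x" for x
  define pv where "pv x = x - lam v x *\<^sub>R e" for x
  define pw where "pw x = x + lam w x *\<^sub>R e" for x
  \<comment> \<open>the segment cut out by the simplex on the line through \<open>x\<close>; \<open>P\<close> is constant along the line\<close>
  have K_line: "x + s *\<^sub>R e \<in> K \<longleftrightarrow> P x \<and> - lam v x \<le> s \<and> s \<le> lam w x" for x s
  proof -
    have "x + s *\<^sub>R e \<in> K \<longleftrightarrow> (\<forall>u\<in>V - {v,w}. 0 \<le> lam u (x + s *\<^sub>R e)) \<and> 0 \<le> lam v (x + s *\<^sub>R e) \<and> 0 \<le> lam w (x + s *\<^sub>R e)"
      using v w by (auto simp: K_iff)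
    also have "\<dots> \<longleftrightarrow> P x \<and> - lam v x \<le> s \<and> s \<le> lam w x"
      using v w vw by (auto simp: lam_e P_def)
    finally show ?thesis .
  qed
  have pv: "pv x \<in> face v \<longleftrightarrow> P x" for x
    using K_line[of x "- lam v x"] v w vw lam_e[of v x "- lam v x"]
    by (auto simp: pv_def face_iff P_def)
  have pw: "pw x \<in> face w \<longleftrightarrow> P x" for x
    using K_line[of x "lam w x"] v w vw lam_e[of w x "lam w x"]
    by (auto simp: pw_def face_iff P_def)
  have pv_e: "pv (x + s *\<^sub>R e) = pv x" "pw (x + s *\<^sub>R e) = pw x" for x s
    using v w vw by (simp_all add: pv_def pw_def lam_e algebra_simps)
  have [measurable]: "pv \<in> borel_measurable borel" "pw \<in> borel_measurable borel"
    unfolding pv_def[abs_def] pw_def[abs_def] by measurable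
  obtain R where R: "\<And>x. x \<in> K \<Longrightarrow> norm x \<le> R"
    using compact_imp_bounded[OF compact_K] by (auto simp: bounded_iff)
  have "compact (g ` K)" using compact_K cg continuous_on_subset compact_continuous_image by blast
  then obtain B where B: "\<And>x. x \<in> K \<Longrightarrow> \<bar>g x\<bar> \<le> B"
    unfolding bounded_iff by (metis compact_imp_bounded bounded_iff imageI real_norm_def)
  have "compact ((\<lambda>x. g' x e) ` K)" using compact_K g' continuous_on_subset compact_continuous_image by blast
  then obtain B' where B': "\<And>x. x \<in> K \<Longrightarrow> \<bar>g' x e\<bar> \<le> B'"
    unfolding bounded_iff by (metis compact_imp_bounded bounded_iff imageI real_norm_def)
  have faceK: "face u \<subseteq> K" for u unfolding face_def K_hull by (rule hull_mono) auto
  let ?Gv = "\<lambda>x. indicator (face v) (pv x) * g (pv x)"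
  let ?Gw = "\<lambda>x. indicator (face w) (pw x) * g (pw x)"
  have int: "integrable lborel (\<lambda>x. unit_window (lam u x) * ?Gv x)" (is ?thesis1)
    "integrable lborel (\<lambda>x. unit_window (lam u x) * ?Gw x)" (is ?thesis2) if u: "u \<in> {v,w}" for u
  proof -
    have bd: "norm x \<le> R + 2 * norm e" if "\<bar>lam u x\<bar> \<le> 1/2" "P x" for x
    proof -
      have "(\<Sum>u\<in>V - {v,w}. lam u x) + (lam v x + lam w x) = (\<Sum>u\<in>V. lam u x)"
        using sum.subset_diff[of "{v,w}" V "\<lambda>u. lam u x"] fin v w vw by simp
      moreover have "0 \<le> (\<Sum>u\<in>V - {v,w}. lam u x)"
        using that(2) by (intro sum_nonneg) (auto simp: P_def)
      ultimately have "0 \<le> lam v x + lam w x" "lam v x + lam w x \<le> 1"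
        using lam_repr(1)[of x] that(2) by (auto simp: P_def)
      then have "\<bar>lam v x\<bar> \<le> 2" using u that(1) by auto
      then have "norm (lam v x *\<^sub>R e) \<le> 2 * norm e" by (simp add: mult_right_mono)
      moreover have "norm (pv x) \<le> R" using R faceK pv that(2) by blast
      ultimately show ?thesis unfolding pv_def by (smt (verit) norm_triangle_sub)
    qed
    show ?thesis1
    proof (rule integrable_bounded_support[where B="max B 0" and R="R + 2 * norm e"])
      show "\<bar>unit_window (lam u x) * ?Gv x\<bar> \<le> max B 0" for x
        using B[of "pv x"] faceK[of v] by (auto split: split_indicator)
      show "norm x \<le> R + 2 * norm e" if "unit_window (lam u x) * ?Gv x \<noteq> 0" for x
        using that by (intro bd) (auto simp: pv split: split_indicator_asm)
    qed measurable
    show ?thesis2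
    proof (rule integrable_bounded_support[where B="max B 0" and R="R + 2 * norm e"])
      show "\<bar>unit_window (lam u x) * ?Gw x\<bar> \<le> max B 0" for x
        using B[of "pw x"] faceK[of w] by (auto split: split_indicator)
      show "norm x \<le> R + 2 * norm e" if "unit_window (lam u x) * ?Gw x \<noteq> 0" for x
        using that by (intro bd) (auto simp: pw split: split_indicator_asm)
    qed measurable
  qed
  have FTC: "(LINT s|lborel. indicator K (x + s *\<^sub>R e) * g' (x + s *\<^sub>R e) e) = ?Gw x - ?Gv x" for x
  proof (cases "P x")
    case True
    have le: "- lam v x \<le> lam w x" using True by (simp add: P_def)
    have "(LINT s|lborel. indicator K (x + s *\<^sub>R e) * g' (x + s *\<^sub>R e) e)
        = (LINT s|lborel. indicator {- lam v x..lam w x} s *\<^sub>R g' (x + s *\<^sub>R e) e)"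
      using True K_line by (intro Bochner_Integration.integral_cong) (auto split: split_indicator)
    also have "\<dots> = g (x + lam w x *\<^sub>R e) - g (x + (- lam v x) *\<^sub>R e)"
    proof (rule integral_FTC_atLeastAtMost[OF le])
      fix s
      have "((\<lambda>s. x + s *\<^sub>R e) has_derivative (\<lambda>s. s *\<^sub>R e)) (at s within {- lam v x..lam w x})"
        by (auto intro!: derivative_eq_intros)
      from has_derivative_compose[OF this g]
      show "((\<lambda>s. g (x + s *\<^sub>R e)) has_vector_derivative g' (x + s *\<^sub>R e) e) (at s within {- lam v x..lam w x})"
        using g[THEN has_derivative_bounded_linear, THEN bounded_linear.linear, THEN linear_cmul, of "x + s *\<^sub>R e" _ e]
        by (simp add: has_vector_derivative_def)
    next
      show "continuous_on {- lam v x..lam w x} (\<lambda>s. g' (x + s *\<^sub>R e) e)"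
        by (rule continuous_on_compose2[OF g'[of e]]) (auto intro!: continuous_intros)
    qed
    finally show ?thesis using True pv pw by (simp add: pv_def pw_def)
  next
    case False
    then show ?thesis using K_line by (simp add: pv pw indicator_def)
  qed
  have "(LINT x|lebesgue_on K. g' x e) = (LINT x|lebesgue. indicator K x *\<^sub>R g' x e)"
    by (subst integral_restrict_space) (auto simp: set_lebesgue_integral_def)
  also have "\<dots> = (LINT x|lborel. indicator K x * g' x e)"
    by (subst integral_completion) auto
  also have "\<dots> = (LINT x|lborel. unit_window (lam v x) * (LINT s|lborel. indicator K (x + s *\<^sub>R e) * g' (x + s *\<^sub>R e) e))"
  proof (rule integral_lines)
    show "integrable lborel (\<lambda>x. indicator K x * g' x e)"
    proof (rule integrable_bounded_support[where B="max B' 0" and R=R])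
      show "\<bar>indicator K x * g' x e\<bar> \<le> max B' 0" for x
        using B'[of x] by (auto split: split_indicator)
      show "norm x \<le> R" if "indicator K x * g' x e \<noteq> 0" for x
        using R that by (auto split: split_indicator_asm)
    qed measurable
  qed (use lam_e[OF v] vw in auto)
  also have "\<dots> = (LINT x|lborel. unit_window (lam v x) * ?Gw x) - (LINT x|lborel. unit_window (lam v x) * ?Gv x)"
    unfolding FTC using int[of v] by (simp add: right_diff_distrib)
  \<comment> \<open>the integrand is constant along \<open>e\<close>, so the slab may be moved to the facet opposite to \<open>w\<close>\<close>
  also have "(LINT x|lborel. unit_window (lam v x) * ?Gw x) = (LINT x|lborel. unit_window (lam w x) * ?Gw x)"
  proof -
    have "\<bar>-1\<bar> * (LINT x|lborel. unit_window (lam w x) * ?Gw x) = (LINT x|lborel. unit_window (lam v x) * ?Gw x)"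
      by (rule integral_window[where e=e]) (use int[of w] lam_e[OF v] lam_e[OF w] vw pv_e in auto)
    then show ?thesis by simp
  qed
  also have "\<dots> = (LINT x|face_measure (face w). g x) / norm (a w)"
  proof -
    have "a w \<bullet> (- e) = 1" using gradient_edge[OF w v w] vw by (simp add: e_def inner_diff_right)
    from face_integral_oblique[OF compact_face affine_hull_face[OF w] cg this]
    have "(LINT x|lborel. unit_window (lam w x) * (indicator (face w) (pw x) * g (pw x)))
       = (LINT x|face_measure (face w). g x) / norm (- a w)"
      by (simp add: lam_def pw_def)
    then show ?thesis by simp
  qed
  also have "(LINT x|lborel. unit_window (lam v x) * ?Gv x) = (LINT x|face_measure (face v). g x) / norm (a v)"
  proof -
    have "a v \<bullet> e = 1" using gradient_edge[OF v v w] vw by (simp add: e_def)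
    from face_integral_oblique[OF compact_face affine_hull_face[OF v] cg this]
    show ?thesis by (simp add: lam_def pv_def)
  qed
  finally show ?thesis by (simp add: e_def)
qed

lemma integrable_on_K:
  assumes "continuous_on UNIV (f :: _ \<Rightarrow> real)"
  shows "integrable (lebesgue_on K) f"
proof -
  have K: "K \<in> sets borel" using compact_K by (simp add: borel_compact)
  have "integrable lborel (\<lambda>x. indicator K x *\<^sub>R f x)"
    using assms continuous_on_subset by (intro borel_integrable_compact compact_K) blast
  then have "integrable lebesgue (\<lambda>x. indicator K x *\<^sub>R f x)"
    by (subst integrable_completion) (use K borel_measurable_continuous_onI[OF assms] in measurable)
  then show ?thesis using K by (simp add: integrable_restrict_space)
qed

text \<open>
With \<open>I v\<close> the integral of \<open>g\<close> over the facet opposite to \<open>v\<close>, divided by the length of \<open>a v\<close>, the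
edge formula reads \<open>\<integral> D\<^bsub>v - w\<^esub> g = I w - I v\<close>. A general direction is
\<open>e = \<Sum> (a v \<bullet> e) (v - w)\<close> for a fixed vertex \<open>w\<close>, where the coefficients sum to 0; so \<open>I w\<close> drops out, and what
remains are the components of the outward normals.
\<close>

theorem gauss:
  fixes g :: "real^'n \<Rightarrow> real" and g' :: "real^'n \<Rightarrow> real^'n \<Rightarrow> real"
  assumes g: "\<And>x. (g has_derivative g' x) (at x)"
    and g': "\<And>e. continuous_on UNIV (\<lambda>x. g' x e)"
  shows "(LINT x|lebesgue_on K. g' x e)
    = (\<Sum>F\<in>{F. F facet_of K}. (outward_normal K F \<bullet> e) * (LINT x|face_measure F. g x))"
proof -
  define I where "I v = (LINT x|face_measure (face v). g x) / norm (a v)" for v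
  obtain w where w: "w \<in> V" using card_V fin by fastforce
  have lin: "linear (g' x)" for x
    using g has_derivative_linear by blast
  have ee: "e = (\<Sum>v\<in>V. (a v \<bullet> e) *\<^sub>R (v - w))"
    using gradient_sum[of e] by (simp add: scaleR_right_diff_distrib sum_subtractf flip: scaleR_sum_left)
  have "(LINT x|lebesgue_on K. g' x e) = (LINT x|lebesgue_on K. (\<Sum>v\<in>V. (a v \<bullet> e) * g' x (v - w)))"
    by (subst ee) (simp add: linear_sum[OF lin] linear_cmul[OF lin])
  also have "\<dots> = (\<Sum>v\<in>V. (a v \<bullet> e) * (LINT x|lebesgue_on K. g' x (v - w)))"
    by (subst Bochner_Integration.integral_sum) (auto intro!: integrable_on_K g' continuous_intros)
  also have "\<dots> = (\<Sum>v\<in>V. (a v \<bullet> e) * (I w - I v))"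
  proof (rule sum.cong[OF refl])
    fix v assume v: "v \<in> V"
    show "(a v \<bullet> e) * (LINT x|lebesgue_on K. g' x (v - w)) = (a v \<bullet> e) * (I w - I v)"
    proof (cases "v = w")
      case True
      then show ?thesis by (simp add: linear_0[OF lin])
    next
      case False
      then show ?thesis using gauss_edge[OF g g' v w False] by (simp add: I_def)
    qed
  qed
  also have "\<dots> = (\<Sum>v\<in>V. a v \<bullet> e) * I w - (\<Sum>v\<in>V. (a v \<bullet> e) * I v)"
    by (simp add: right_diff_distrib sum_subtractf sum_distrib_right)
  also have "\<dots> = (\<Sum>v\<in>V. (outward_normal K (face v) \<bullet> e) * (LINT x|face_measure (face v). g x))"
    by (simp add: gradient_sum outward_normal_face I_def sum_negf field_simps)
  also have "\<dots> = (\<Sum>F\<in>{F. F facet_of K}. (outward_normal K F \<bullet> e) * (LINT x|face_measure F. g x))"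
    by (simp add: facets sum.reindex[OF inj_face])
  finally show ?thesis .
qed

end

lemma simplex_coords_exists:
  fixes K :: "(real^'n) set"
  assumes "int CARD('n) simplex K"
  obtains V a b where "simplex_coords K V a b"
proof -
  obtain V where V: "\<not> affine_dependent V" "card V = Suc CARD('n)" "K = convex hull V"
    using assms by (auto simp: simplex_def)
  have fin: "finite V" using V(1) by (rule aff_independent_finite)
  have "\<exists>a b. \<forall>w\<in>V. a \<bullet> w - b = (if v = w then 1 else 0)" if v: "v \<in> V" for v
  proof -
    have "\<not> affine_dependent (V - {v})" by (simp add: V(1) affine_independent_Diff)
    then have "aff_dim (V - {v}) = int DIM(real^'n) - 1"
      using aff_dim_affine_independent[of "V - {v}"] V(2) v fin by simp
    then obtain a b where ab: "affine hull (V - {v}) = {x. a \<bullet> x = b}"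
      using aff_dim_eq_hyperplane[of "V - {v}"] by auto
    have "v \<notin> affine hull (V - {v})" using V(1) v by (auto simp: affine_dependent_def)
    then have nz: "a \<bullet> v - b \<noteq> 0" using ab by simp
    have "a \<bullet> w = b" if "w \<in> V" "w \<noteq> v" for w
    proof -
      have "w \<in> affine hull (V - {v})" using that by (simp add: hull_inc)
      then show ?thesis using ab by simp
    qed
    then have "\<forall>w\<in>V. (a /\<^sub>R (a \<bullet> v - b)) \<bullet> w - b / (a \<bullet> v - b) = (if v = w then 1 else 0)"
      using nz by (auto simp: divide_simps)
    then show ?thesis by blast
  qed
  then obtain a b where "\<And>v w. v \<in> V \<Longrightarrow> w \<in> V \<Longrightarrow> a v \<bullet> w - b v = (if v = w then 1 else 0)"
    by metis
  then have "simplex_coords K V a b" using V by unfold_locales auto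
  then show ?thesis by (rule that)
qed

section \<open>Faces shared by mesh elements\<close>

context simplex_coords
begin

lemma in_interior: 
  assumes "\<And>v. v \<in> V \<Longrightarrow> 0 < lam v x"
  shows "x \<in> interior K"
proof -
  have "open (\<Inter>v\<in>V. {x. 0 < lam v x})"
    using fin unfolding lam_def by (intro open_INT ballI open_Collect_less continuous_intros) auto
  moreover have "(\<Inter>v\<in>V. {x. 0 < lam v x}) \<subseteq> K" by (auto simp: K_iff less_imp_le)
  ultimately show ?thesis using assms by (auto simp: interior_def)
qed

text \<open>
The centre of a facet depends on the vertices of the facet only. This lets two simplices with a common facet
be compared at the same point.
\<close>

definition face_center :: "real^'n \<Rightarrow> real^'n" where
  "face_center v = (\<Sum>w\<in>V - {v}. (1 / real CARD('n)) *\<^sub>R w)"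

lemma lam_face_center:
  assumes "v \<in> V" "w \<in> V"
  shows "lam w (face_center v) = (if w = v then 0 else 1 / real CARD('n))"
proof -
  let ?c = "\<lambda>w. if w = v then 0 else 1 / real CARD('n)"
  have "sum ?c V = 1" using assms(1) fin card_V by (simp add: sum.remove[of V v])
  moreover have "(\<Sum>w\<in>V. ?c w *\<^sub>R w) = face_center v"
    using assms(1) fin by (simp add: face_center_def sum.remove[of V v])
  ultimately show ?thesis using lam_comb[OF _ assms(2), of ?c] by simp
qed

lemma inward_interior:
  assumes v: "v \<in> V"
  shows "eventually (\<lambda>d. face_center v - d *\<^sub>R outward_normal K (face v) \<in> interior K) (at_right 0)"
proof -
  let ?p = "\<lambda>d. face_center v - d *\<^sub>R outward_normal K (face v)"
  have "eventually (\<lambda>d. 0 < lam w (?p d)) (at_right 0)" if w: "w \<in> V" for w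
  proof (cases "w = v")
    case True
    have "lam v (?p d) = d * norm (a v)" for d
    proof -
      have "a v \<bullet> outward_normal K (face v) = - norm (a v)"
        using a_nz[OF v] by (simp add: outward_normal_face[OF v] power2_norm_eq_inner[symmetric] power2_eq_square)
      then have "lam v (?p d) = lam v (face_center v) + d * norm (a v)"
        by (simp add: lam_def inner_diff_right)
      then show ?thesis using lam_face_center[OF v v] by simp
    qed
    then show ?thesis using True a_nz[OF v] eventually_at_right_less[of "0::real"]
      by (auto elim: eventually_mono)
  next
    case False
    have "((\<lambda>d. lam w (?p d)) \<longlongrightarrow> lam w (?p 0)) (at_right 0)"
      unfolding lam_def by (intro tendsto_intros)
    moreover have "0 < lam w (?p 0)" using lam_face_center[OF v w] False by simp
    ultimately show ?thesis by (rule order_tendstoD)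
  qed
  then have "eventually (\<lambda>d. \<forall>w\<in>V. 0 < lam w (?p d)) (at_right 0)"
    by (simp add: eventually_ball_finite fin)
  then show ?thesis by eventually_elim (simp add: in_interior)
qed

lemma interior_nonempty: "interior K \<noteq> {}"
proof -
  obtain v where "v \<in> V" using card_V fin by fastforce
  from eventually_happens[OF inward_interior[OF this]] show ?thesis by auto
qed

lemma convex_K: "convex K" by (simp add: K_hull)

lemma face_vertices: "V - {v} = {x. x extreme_point_of face v}"
  unfolding face_def using ind
  by (auto simp: extreme_point_of_convex_hull_affine_independent affine_independent_Diff)

end

text \<open>
Both normals are orthogonal to the common facet, hence equal up to sign; if they are equal, both
simplices contain the points just inside the centre of the facet.
\<close>

lemma common_facet:
  assumes "simplex_coords K V a b" "simplex_coords K' V' a' b'"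
    and F: "F facet_of K" "F facet_of K'"
  shows "(outward_normal K' F = outward_normal K F \<and> interior K \<inter> interior K' \<noteq> {})
     \<or> outward_normal K' F = - outward_normal K F"
proof -
  interpret A: simplex_coords K V a b by fact
  interpret B: simplex_coords K' V' a' b' by fact
  obtain v where v: "v \<in> V" "F = A.face v" using A.facets F by blast
  obtain v' where v': "v' \<in> V'" "F = B.face v'" using B.facets F by blast
  have V: "V' - {v'} = V - {v}" using A.face_vertices[of v] B.face_vertices[of v'] v v' by simp
  define n n' where "n = outward_normal K F" and "n' = outward_normal K' F"
  have nn: "norm n = 1" "norm n' = 1"
    using A.outward_normal_face[OF v(1)] B.outward_normal_face[OF v'(1)] v v' A.a_nz B.a_nz
    by (simp_all add: n_def n'_def)
  have "n' \<bullet> x = - (b' v' / norm (a' v'))" if "x \<in> V - {v}" for x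
  proof -
    have "x \<in> V'" "x \<noteq> v'" using that V by auto
    then have "a' v' \<bullet> x = b' v'" using B.vertex[OF v'(1), of x] by auto
    moreover have "n' = - (a' v' /\<^sub>R norm (a' v'))"
      using B.outward_normal_face[OF v'(1)] v'(2) by (simp add: n'_def)
    ultimately show ?thesis by (simp add: divide_inverse mult.commute)
  qed
  from A.parallel_gradient[OF v(1) this] obtain c where c: "n' = c *\<^sub>R a v" by blast
  have n: "n = - (a v /\<^sub>R norm (a v))"
    using A.outward_normal_face[OF v(1)] v by (simp add: n_def)
  have "n' = (- c * norm (a v)) *\<^sub>R n" using A.a_nz[OF v(1)] by (simp add: c n)
  then obtain d where d: "n' = d *\<^sub>R n" by blast
  then have "\<bar>d\<bar> = 1" using nn by simp
  then have "d = 1 \<or> d = - 1" by linarith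
  then have "n' = n \<or> n' = - n" using d by auto
  moreover have "interior K \<inter> interior K' \<noteq> {}" if "n' = n"
  proof -
    have "A.face_center v = B.face_center v'" by (simp add: A.face_center_def B.face_center_def V)
    then have "eventually (\<lambda>d. A.face_center v - d *\<^sub>R n \<in> interior K \<and> A.face_center v - d *\<^sub>R n \<in> interior K') (at_right 0)"
      using A.inward_interior[OF v(1)] B.inward_interior[OF v'(1)] v v' that
      by (simp add: n_def n'_def eventually_conj)
    from eventually_happens[OF this] show ?thesis by auto
  qed
  ultimately show ?thesis by (auto simp: n_def n'_def)
qed

text \<open>
A Lipschitz domain lies on one side of its boundary, so closure adds no interior points. This is what
places the interiors of the elements, which by assumption cover only the closure of the domain, inside the
domain itself, where the wavespeed is controlled.
\<close>

lemma interior_closure_lipschitz: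
  fixes \<Omega> :: "(real^'n) set"
  assumes "lipschitz_domain \<Omega>"
  shows "interior (closure \<Omega>) \<subseteq> \<Omega>"
proof
  fix z assume z: "z \<in> interior (closure \<Omega>)"
  show "z \<in> \<Omega>"
  proof (rule ccontr)
    assume nz: "z \<notin> \<Omega>"
    have "open \<Omega>" using assms by (simp add: lipschitz_domain_def)
    then have "z \<in> frontier \<Omega>"
      using z nz interior_subset[of "closure \<Omega>"] by (auto simp: frontier_def interior_open)
    then obtain e r L \<gamma> where e: "norm e = 1" "r > 0" "L-lipschitz_on {y. y \<bullet> e = 0} \<gamma>"
      and g: "\<And>x. x \<in> ball z r \<Longrightarrow> x \<in> \<Omega> \<longleftrightarrow> \<gamma> (x - (x \<bullet> e) *\<^sub>R e) < x \<bullet> e"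
      using assms unfolding lipschitz_domain_def by metis
    have ee: "e \<bullet> e = 1" using e(1) by (simp add: norm_eq_1)
    have "continuous_on UNIV (\<lambda>x. \<gamma> (x - (x \<bullet> e) *\<^sub>R e))"
      by (rule continuous_on_compose2[OF lipschitz_on_continuous_on[OF e(3)]])
        (auto intro!: continuous_intros simp: inner_diff_left ee)
    then have "open {x. x \<bullet> e < \<gamma> (x - (x \<bullet> e) *\<^sub>R e)}"
      by (intro open_Collect_less continuous_intros) auto
    then have U: "open (ball z r \<inter> {x. x \<bullet> e < \<gamma> (x - (x \<bullet> e) *\<^sub>R e)})" (is "open ?U") by auto
    have "?U \<inter> \<Omega> = {}" using g by force
    then have disj: "?U \<inter> closure \<Omega> = {}" using U by (simp add: open_Int_closure_eq_empty)
    have "\<gamma> (z - (z \<bullet> e) *\<^sub>R e) \<ge> z \<bullet> e" using g[of z] nz e(2) by simp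
    then have inU: "z - d *\<^sub>R e \<in> ?U" if "0 < d" "d < r" for d
      using that e(1) by (auto simp: inner_diff_left ee dist_norm algebra_simps)
    obtain s where s: "s > 0" "ball z s \<subseteq> closure \<Omega>" using z by (auto simp: mem_interior)
    define d where "d = min r s / 2"
    have d: "0 < d" "d < r" "d < s" using e(2) s(1) by (auto simp: d_def)
    then have "z - d *\<^sub>R e \<in> ball z s" using e(1) by (simp add: dist_norm)
    then show False using inU[OF d(1,2)] disj s(2) by blast
  qed
qed

locale dg_mesh =
  fixes \<Omega> :: "(real^'n) set" and \<T> :: "(real^'n) set set"
  assumes lip: "lipschitz_domain \<Omega>" and conf: "conforming_mesh \<Omega> \<T>"
begin

lemma finite_mesh: "finite \<T>"
  using conf by (simp add: conforming_mesh_def triangulation_def)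

lemma coords: assumes "K \<in> \<T>" obtains V a b where "simplex_coords K V a b"
proof -
  have "int CARD('n) simplex K" using conf assms by (simp add: conforming_mesh_def)
  from simplex_coords_exists[OF this] show ?thesis using that .
qed

lemma interior_subset_domain: "K \<in> \<T> \<Longrightarrow> interior K \<subseteq> \<Omega>"
  using conf interior_closure_lipschitz[OF lip] interior_mono[of K "closure \<Omega>"]
  by (fastforce simp: conforming_mesh_def)

text \<open>
Conformity gives this: a face of a simplex that meets the interior is the whole simplex.
\<close>

lemma interior_disjoint:
  assumes "K \<in> \<T>" "K' \<in> \<T>" "K \<noteq> K'"
  shows "interior K \<inter> interior K' = {}"
proof (rule ccontr)
  assume *: "interior K \<inter> interior K' \<noteq> {}"
  have "(K \<inter> K') face_of K" "(K' \<inter> K) face_of K'"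
    using conf assms by (auto simp: conforming_mesh_def triangulation_def)
  then have "K \<inter> K' = K" "K' \<inter> K = K'"
    using face_of_disjoint_interior * interior_subset by blast+
  then show False using assms(3) by blast
qed

lemma normals_opposite:
  assumes "K \<in> \<T>" "K' \<in> \<T>" "K \<noteq> K'" "F facet_of K" "F facet_of K'"
  shows "outward_normal K' F = - outward_normal K F"
proof -
  obtain V a b where A: "simplex_coords K V a b" using coords[OF assms(1)] .
  obtain V' a' b' where B: "simplex_coords K' V' a' b'" using coords[OF assms(2)] .
  show ?thesis using common_facet[OF A B assms(4,5)] interior_disjoint[OF assms(1-3)] by simp
qed

lemma norm_outward_normal:
  assumes "K \<in> \<T>" "F facet_of K"
  shows "norm (outward_normal K F) = 1"
proof -
  obtain V a b where "simplex_coords K V a b" using coords[OF assms(1)] .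
  then interpret simplex_coords K V a b .
  obtain v where "v \<in> V" "F = face v" using facets assms(2) by blast
  then show ?thesis using outward_normal_face a_nz by simp
qed

lemma neighbour_eq:
  assumes "K \<in> \<T>" "K' \<in> \<T>" "K' \<noteq> K" "F facet_of K" "F facet_of K'"
  shows "neighbour \<T> K F = K'"
  unfolding neighbour_def
proof (rule the_equality)
  fix L assume L: "L \<in> \<T> \<and> L \<noteq> K \<and> F facet_of L"
  show "L = K'"
  proof (rule ccontr)
    assume "L \<noteq> K'"
    then have "outward_normal L F = - outward_normal K' F" "outward_normal L F = - outward_normal K F"
      "outward_normal K' F = - outward_normal K F"
      using normals_opposite[of K' L F] normals_opposite[of K L F] normals_opposite[of K K' F] L assms by auto
    then have "outward_normal K F + outward_normal K F = 0" by (simp add: eq_neg_iff_add_eq_0)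
    then have "2 *\<^sub>R outward_normal K F = 0" by (simp only: scaleR_2)
    then have "outward_normal K F = 0" by simp
    then show False using norm_outward_normal[OF assms(1,4)] by simp
  qed
qed (use assms in auto)

lemma neighbour_symmetric:
  assumes "K \<in> \<T>" "F facet_of K" "shared_face \<T> K F"
  defines "K' \<equiv> neighbour \<T> K F"
  shows "K' \<in> \<T>" "F facet_of K'" "shared_face \<T> K' F" "neighbour \<T> K' F = K"
    "outward_normal K' F = - outward_normal K F"
proof -
  obtain L where L: "L \<in> \<T>" "L \<noteq> K" "F facet_of L" using assms(3) by (auto simp: shared_face_def)
  then have "K' = L" unfolding K'_def using neighbour_eq assms(1,2) by blast
  then show K': "K' \<in> \<T>" "F facet_of K'" using L by auto
  show "shared_face \<T> K' F" using \<open>K' = L\<close> L assms(1,2) by (auto simp: shared_face_def)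
  show "neighbour \<T> K' F = K"
    using \<open>K' = L\<close> L assms(1,2) neighbour_eq[of L K F] by simp
  show "outward_normal K' F = - outward_normal K F"
    using \<open>K' = L\<close> L assms(1,2) normals_opposite[of K L F] by simp
qed

lemma finite_facets: "K \<in> \<T> \<Longrightarrow> finite {F. F facet_of K}"
proof -
  assume "K \<in> \<T>"
  then obtain V a b where "simplex_coords K V a b" using coords by blast
  then interpret simplex_coords K V a b .
  show ?thesis by (simp add: facets fin)
qed

text \<open>
Passing to the neighbour is an involution on the pairs of an element and a shared facet of it, and the sum
is invariant under it and changes its sign.
\<close>

lemma sum_over_faces_cancel:
  fixes \<Phi> :: "(real^'n) set \<Rightarrow> (real^'n) set \<Rightarrow> real"
  assumes shared: "\<And>K F. K \<in> \<T> \<Longrightarrow> F facet_of K \<Longrightarrow> shared_face \<T> K F \<Longrightarrow> \<Phi> (neighbour \<T> K F) F = - \<Phi> K F"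
    and bdry: "\<And>K F. K \<in> \<T> \<Longrightarrow> F facet_of K \<Longrightarrow> \<not> shared_face \<T> K F \<Longrightarrow> \<Phi> K F = 0"
  shows "(\<Sum>K\<in>\<T>. \<Sum>F\<in>{F. F facet_of K}. \<Phi> K F) = 0"
proof -
  define P where "P = Sigma \<T> (\<lambda>K. {F. F facet_of K})"
  define \<iota> where "\<iota> = (\<lambda>(K,F). if shared_face \<T> K F then (neighbour \<T> K F, F) else (K, F))"
  have \<iota>: "\<iota> x \<in> P" "\<iota> (\<iota> x) = x" "case_prod \<Phi> (\<iota> x) = - case_prod \<Phi> x" if "x \<in> P" for x
  proof -
    obtain K F where x: "x = (K, F)" "K \<in> \<T>" "F facet_of K" using \<open>x \<in> P\<close> by (auto simp: P_def)
    show "\<iota> x \<in> P" "\<iota> (\<iota> x) = x" "case_prod \<Phi> (\<iota> x) = - case_prod \<Phi> x"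
      using x neighbour_symmetric[OF x(2,3)] shared[OF x(2,3)] bdry[OF x(2,3)]
      by (cases "shared_face \<T> K F"; simp add: P_def \<iota>_def)+
  qed
  have "(\<Sum>x\<in>P. case_prod \<Phi> x) = (\<Sum>x\<in>P. case_prod \<Phi> (\<iota> x))"
    by (rule sum.reindex_bij_witness[where i=\<iota> and j=\<iota>]) (use \<iota> in auto)
  also have "\<dots> = - (\<Sum>x\<in>P. case_prod \<Phi> x)"
    using \<iota>(3) by (simp add: sum_negf)
  finally have "(\<Sum>x\<in>P. case_prod \<Phi> x) = 0" by simp
  then show ?thesis
    unfolding P_def using finite_mesh finite_facets by (subst sum.Sigma) auto
qed

lemma face_measure_facts:
  assumes "K \<in> \<T>" "F facet_of K"
  shows "finite_measure (face_measure F)" "AE x in face_measure F. x \<in> F"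
    "sets borel \<subseteq> sets (face_measure F)" "compact F" "space (face_measure F) = UNIV"
proof -
  obtain V a b where "simplex_coords K V a b" using coords[OF assms(1)] .
  then interpret simplex_coords K V a b .
  obtain v where v: "v \<in> V" "F = face v" using facets assms(2) by blast
  show "compact F" using v compact_face by simp
  show "finite_measure (face_measure F)" "AE x in face_measure F. x \<in> F"
    "sets borel \<subseteq> sets (face_measure F)"
    unfolding v(2)
    using integral_face_measure(2,3,4)[OF compact_face affine_hull_face[OF v(1)] a_nz[OF v(1)], of "\<lambda>_. 0"]
    by auto
  show "space (face_measure F) = UNIV" by (simp add: face_measure_def)
qed

lemma face_integrable:
  assumes K: "K \<in> \<T>" "F facet_of K" and \<tau>: "\<tau> \<in> borel_measurable (face_measure F)"
    and B: "\<And>x. x \<in> F \<Longrightarrow> \<bar>\<tau> x\<bar> \<le> B" and f: "continuous_on UNIV (f :: _ \<Rightarrow> real)"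
  shows "integrable (face_measure F) (\<lambda>x. \<tau> x * f x)"
proof -
  note fm = face_measure_facts[OF K]
  interpret finite_measure "face_measure F" by (rule fm)
  have "f \<in> borel_measurable borel" using f by (rule borel_measurable_continuous_onI)
  then have fm': "f \<in> borel_measurable (face_measure F)"
    using fm(3,5) by (auto simp: measurable_def)
  have "compact (f ` F)" using fm(4) f continuous_on_subset compact_continuous_image by blast
  then obtain B' where B': "\<And>x. x \<in> F \<Longrightarrow> \<bar>f x\<bar> \<le> B'"
    unfolding bounded_iff by (metis compact_imp_bounded bounded_iff imageI real_norm_def)
  have "AE x in face_measure F. norm (\<tau> x * f x) \<le> B * B'"
    using fm(2)
  proof eventually_elim
    case (elim x)
    then have "\<bar>\<tau> x\<bar> * \<bar>f x\<bar> \<le> B * B'"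
      using B[of x] B'[of x] by (intro mult_mono) auto
    then show ?case by (simp add: abs_mult)
  qed
  then show ?thesis using \<tau> fm' by (intro integrable_const_bound) auto
qed

end

section \<open>Finite-dimensional spaces of functions and polynomials\<close>

definition fun_span :: "'a set \<Rightarrow> ('a \<Rightarrow> 'x \<Rightarrow> real) \<Rightarrow> ('x \<Rightarrow> real) set" where
  "fun_span A \<phi> = {f. \<exists>c. \<forall>x. f x = (\<Sum>a\<in>A. c a * \<phi> a x)}"

definition linear_form :: "('x \<Rightarrow> real) set \<Rightarrow> (('x \<Rightarrow> real) \<Rightarrow> real) \<Rightarrow> bool" where
  "linear_form W L \<longleftrightarrow> (\<forall>f\<in>W. \<forall>g\<in>W. \<forall>c. L (\<lambda>x. f x + c * g x) = L f + c * L g)"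

lemma linear_formD:
  "linear_form W L \<Longrightarrow> f \<in> W \<Longrightarrow> g \<in> W \<Longrightarrow> L (\<lambda>x. f x + c * g x) = L f + c * L g"
  by (simp add: linear_form_def)

lemma fun_spanI: "(\<And>x. f x = (\<Sum>a\<in>A. c a * \<phi> a x)) \<Longrightarrow> f \<in> fun_span A \<phi>"
  by (auto simp: fun_span_def)

lemma fun_span_zero: "(\<lambda>x. 0) \<in> fun_span A \<phi>"
  unfolding fun_span_def by (auto intro!: exI[of _ "\<lambda>_. 0"])

lemma fun_span_add:
  assumes "f \<in> fun_span A \<phi>" "g \<in> fun_span A \<phi>"
  shows "(\<lambda>x. f x + c * g x) \<in> fun_span A \<phi>"
proof -
  obtain a b where "\<And>x. f x = (\<Sum>i\<in>A. a i * \<phi> i x)" "\<And>x. g x = (\<Sum>i\<in>A. b i * \<phi> i x)"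
    using assms by (auto simp: fun_span_def)
  then show ?thesis
    unfolding fun_span_def
    by (auto intro!: exI[of _ "\<lambda>i. a i + c * b i"] simp: sum_distrib_left sum.distrib algebra_simps)
qed

lemma fun_span_sum:
  assumes "finite I" "\<And>i. i \<in> I \<Longrightarrow> l i \<in> fun_span A \<phi>"
  shows "(\<lambda>x. \<Sum>i\<in>I. c i * l i x) \<in> fun_span A \<phi>"
  using assms
proof (induction I rule: finite_induct)
  case (insert i I)
  then show ?case
    using fun_span_add[of "\<lambda>x. \<Sum>i\<in>I. c i * l i x" A \<phi> "l i" "c i"] by (simp add: add.commute)
qed (simp add: fun_span_zero)

lemma linear_form_zero: "linear_form (fun_span A \<phi>) L \<Longrightarrow> L (\<lambda>x. 0) = 0"
proof -
  assume "linear_form (fun_span A \<phi>) L"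
  from linear_formD[OF this fun_span_zero fun_span_zero, where c=1] show ?thesis by simp
qed

lemma linear_form_sum:
  assumes "linear_form (fun_span A \<phi>) L" "finite I" "\<And>i. i \<in> I \<Longrightarrow> l i \<in> fun_span A \<phi>"
  shows "L (\<lambda>x. \<Sum>i\<in>I. c i * l i x) = (\<Sum>i\<in>I. c i * L (l i))"
  using assms(2,3)
proof (induction I rule: finite_induct)
  case empty
  then show ?case using linear_form_zero[OF assms(1)] by simp
next
  case (insert i I)
  have "L (\<lambda>x. (\<Sum>i\<in>I. c i * l i x) + c i * l i x) = L (\<lambda>x. \<Sum>i\<in>I. c i * l i x) + c i * L (l i)"
    by (rule linear_formD[OF assms(1) fun_span_sum]) (use insert in auto)
  with insert show ?case by (simp add: add.commute)
qed

text \<open>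
In the induction step, the part of the new generator that is invisible to the functionals chosen so far is either 0,
or it is seen by some further functional, which is then added to the basis.
\<close>

lemma dual_basis:
  assumes "finite A"
    and "\<And>j. j \<in> J \<Longrightarrow> linear_form (fun_span A \<phi>) (ev j)"
    and "\<And>f. f \<in> fun_span A \<phi> \<Longrightarrow> (\<And>j. j \<in> J \<Longrightarrow> ev j f = 0) \<Longrightarrow> f = (\<lambda>x. 0)"
  shows "\<exists>I l. finite I \<and> I \<subseteq> J \<and> (\<forall>i\<in>I. l i \<in> fun_span A \<phi>)
    \<and> (\<forall>i\<in>I. \<forall>j\<in>I. ev i (l j) = (if i = j then 1 else 0))
    \<and> (\<forall>f\<in>fun_span A \<phi>. f = (\<lambda>x. \<Sum>i\<in>I. ev i f * l i x))"
  using assms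
proof (induction A rule: finite_induct)
  case empty
  have "f = (\<lambda>x. 0)" if "f \<in> fun_span {} \<phi>" for f using that by (auto simp: fun_span_def)
  then show ?case by (intro exI[of _ "{}"] exI[of _ "\<lambda>_ _. 0"]) simp
next
  case (insert a A)
  let ?W = "fun_span A \<phi>" and ?W' = "fun_span (insert a A) \<phi>"
  have split: "\<exists>g\<in>?W. \<exists>c. f = (\<lambda>x. g x + c * \<phi> a x)" if f: "f \<in> ?W'" for f
  proof -
    obtain c where "\<And>x. f x = (\<Sum>i\<in>insert a A. c i * \<phi> i x)" using f by (auto simp: fun_span_def)
    then have "f = (\<lambda>x. (\<Sum>i\<in>A. c i * \<phi> i x) + c a * \<phi> a x)"
      using insert.hyps by (auto simp: add.commute)
    moreover have "(\<lambda>x. \<Sum>i\<in>A. c i * \<phi> i x) \<in> ?W" by (auto simp: fun_span_def)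
    ultimately show ?thesis
      by (intro bexI[of _ "\<lambda>x. \<Sum>i\<in>A. c i * \<phi> i x"] exI[of _ "c a"])
  qed
  have sub: "?W \<subseteq> ?W'"
  proof
    fix f assume "f \<in> ?W"
    then obtain c where c: "\<And>x. f x = (\<Sum>i\<in>A. c i * \<phi> i x)" by (auto simp: fun_span_def)
    have "f x = (\<Sum>i\<in>insert a A. (if i = a then 0 else c i) * \<phi> i x)" for x
    proof -
      have "(\<Sum>i\<in>A. (if i = a then 0 else c i) * \<phi> i x) = (\<Sum>i\<in>A. c i * \<phi> i x)"
        using insert.hyps by (intro sum.cong) auto
      then show ?thesis using insert.hyps c by simp
    qed
    then show "f \<in> ?W'" by (rule fun_spanI)
  qed
  have phi: "\<phi> a \<in> ?W'"
  proof -
    have "\<phi> a x = (\<Sum>i\<in>insert a A. (if i = a then 1 else 0) * \<phi> i x)" for x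
    proof -
      have "(\<Sum>i\<in>A. (if i = a then 1 else 0) * \<phi> i x) = 0"
        using insert.hyps by (intro sum.neutral) auto
      then show ?thesis using insert.hyps by simp
    qed
    then show ?thesis by (rule fun_spanI)
  qed
  have lin: "linear_form ?W' (ev j)" if "j \<in> J" for j using insert.prems(1) that .
  obtain I l where I: "finite I" "I \<subseteq> J" and l: "\<And>i. i \<in> I \<Longrightarrow> l i \<in> ?W"
    and dual: "\<And>i j. i \<in> I \<Longrightarrow> j \<in> I \<Longrightarrow> ev i (l j) = (if i = j then 1 else 0)"
    and repr: "\<And>f. f \<in> ?W \<Longrightarrow> f = (\<lambda>x. \<Sum>i\<in>I. ev i f * l i x)"
  proof -
    have linW: "linear_form ?W (ev j)" if "j \<in> J" for j
      unfolding linear_form_def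
    proof (intro ballI allI)
      fix f g c assume "f \<in> ?W" "g \<in> ?W"
      then show "ev j (\<lambda>x. f x + c * g x) = ev j f + c * ev j g"
        by (intro linear_formD[OF lin[OF that]]) (use sub in auto)
    qed
    have sep: "f = (\<lambda>x. 0)" if "f \<in> ?W" "\<And>j. j \<in> J \<Longrightarrow> ev j f = 0" for f
      by (rule insert.prems(2)) (use that sub in auto)
    have "\<exists>I l. finite I \<and> I \<subseteq> J \<and> (\<forall>i\<in>I. l i \<in> ?W)
      \<and> (\<forall>i\<in>I. \<forall>j\<in>I. ev i (l j) = (if i = j then 1 else 0))
      \<and> (\<forall>f\<in>?W. f = (\<lambda>x. \<Sum>i\<in>I. ev i f * l i x))"
    proof (rule insert.IH)
      show "linear_form ?W (ev j)" if "j \<in> J" for j using that by (rule linW)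
      show "f = (\<lambda>x. 0)" if "f \<in> ?W" "\<And>j. j \<in> J \<Longrightarrow> ev j f = 0" for f using that by (rule sep)
    qed
    then obtain I l where H: "finite I \<and> I \<subseteq> J \<and> (\<forall>i\<in>I. l i \<in> ?W)
      \<and> (\<forall>i\<in>I. \<forall>j\<in>I. ev i (l j) = (if i = j then 1 else 0))
      \<and> (\<forall>f\<in>?W. f = (\<lambda>x. \<Sum>i\<in>I. ev i f * l i x))" by (elim exE)
    show ?thesis
    proof (rule that[of I l])
      show "finite I" "I \<subseteq> J" using H by simp_all
      show "l i \<in> ?W" if "i \<in> I" for i using H that by simp
      show "ev i (l j) = (if i = j then 1 else 0)" if "i \<in> I" "j \<in> I" for i j using H that by simp
      show "f = (\<lambda>x. \<Sum>i\<in>I. ev i f * l i x)" if "f \<in> ?W" for f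
        using conjunct2[OF conjunct2[OF conjunct2[OF conjunct2[OF H]]]] that by (rule bspec)
    qed
  qed
  have l': "\<And>i. i \<in> I \<Longrightarrow> l i \<in> ?W'" using l sub by auto
  define q where "q = (\<lambda>x. \<Sum>i\<in>I. ev i (\<phi> a) * l i x)"
  have q: "q \<in> ?W'" unfolding q_def by (rule fun_span_sum) (use I l' in auto)
  have ev_q: "ev j q = (\<Sum>i\<in>I. ev i (\<phi> a) * ev j (l i))" if "j \<in> J" for j
    unfolding q_def by (rule linear_form_sum[OF lin[OF that]]) (use I l' in auto)
  define r where "r = (\<lambda>x. \<phi> a x + (-1) * q x)"
  have r: "r \<in> ?W'" unfolding r_def by (rule fun_span_add[OF phi q])
  have ev_r: "ev j r = ev j (\<phi> a) - ev j q" if "j \<in> J" for j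
    using linear_formD[OF lin[OF that] phi q, of "-1"] by (simp add: r_def)
  have ev_r0: "ev j r = 0" if "j \<in> I" for j
  proof -
    have jJ: "j \<in> J" using that I by auto
    have "ev j q = (\<Sum>i\<in>I. if i = j then ev i (\<phi> a) else 0)"
      unfolding ev_q[OF jJ] using that dual[OF that] by (intro sum.cong) auto
    then show ?thesis using that I ev_r[of j] by auto
  qed
  show ?case
  proof (cases "r = (\<lambda>x. 0)")
    case True
    then have phi_q: "\<phi> a = q" by (auto simp: r_def fun_eq_iff)
    have "f = (\<lambda>x. \<Sum>i\<in>I. ev i f * l i x)" if f: "f \<in> ?W'" for f
    proof -
      obtain g c where g: "g \<in> ?W" "f = (\<lambda>x. g x + c * \<phi> a x)" using split[OF f] by blast
      have "ev i f = ev i g + c * ev i (\<phi> a)" if "i \<in> I" for i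
        unfolding g(2) by (rule linear_formD[OF lin]) (use that I g(1) sub phi in auto)
      then have "(\<Sum>i\<in>I. ev i f * l i x) = (\<Sum>i\<in>I. ev i g * l i x) + c * q x" for x
        by (simp add: q_def sum.distrib sum_distrib_left algebra_simps)
      then show ?thesis using repr[OF g(1)] g(2) phi_q by metis
    qed
    then show ?thesis using I l' dual by (intro exI[of _ I] exI[of _ l] conjI ballI)
  next
    case False
    then obtain k where k: "k \<in> J" "ev k r \<noteq> 0" using insert.prems(2)[OF r] by blast
    then have kI: "k \<notin> I" using ev_r0 by blast
    define lk where "lk = (\<lambda>x. r x / ev k r)"
    have lk: "lk \<in> ?W'"
      using fun_span_add[OF fun_span_zero r, of "1 / ev k r"] by (simp add: lk_def)
    have ev_lk: "ev j lk = ev j r / ev k r" if "j \<in> J" for j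
    proof -
      show ?thesis
        using linear_formD[OF lin[OF that] fun_span_zero r, of "1 / ev k r"] linear_form_zero[OF lin[OF that]]
        by (simp add: lk_def)
    qed
    \<comment> \<open>the old dual vectors are corrected so that the new functional vanishes on them\<close>
  define l2 where "l2 = (\<lambda>i. if i = k then lk else (\<lambda>x. l i x + (- ev k (l i)) * lk x))"
    have l2: "l2 i \<in> ?W'" if "i \<in> insert k I" for i
    proof (cases "i = k")
      case False
      then show ?thesis using that fun_span_add[OF l' lk, of i "- ev k (l i)"] by (simp add: l2_def)
    qed (simp add: l2_def lk)
    have ev_l2: "ev j (l2 i) = ev j (l i) - ev k (l i) * ev j lk" if "i \<in> I" "j \<in> J" for i j
    proof -
      have "ev j (\<lambda>x. l i x + (- ev k (l i)) * lk x) = ev j (l i) + (- ev k (l i)) * ev j lk"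
        by (rule linear_formD[OF lin[OF that(2)] l'[OF that(1)] lk])
      then show ?thesis using that kI by (auto simp: l2_def)
    qed
    have dual2: "ev i (l2 j) = (if i = j then 1 else 0)" if "i \<in> insert k I" "j \<in> insert k I" for i j
    proof -
      have iJ: "i \<in> J" using that I k by auto
      have 1: "ev i lk = (if i = k then 1 else 0)"
        using ev_lk[OF iJ] that(1) ev_r0 k by auto
      show ?thesis
      proof (cases "j = k")
        case True
        then show ?thesis using 1 by (simp add: l2_def)
      next
        case False
        then have "j \<in> I" using that by auto
        then show ?thesis using ev_l2[OF _ iJ] 1 dual that(1) kI by auto
      qed
    qed
    have "f = (\<lambda>x. \<Sum>i\<in>insert k I. ev i f * l2 i x)" if f: "f \<in> ?W'" for f
    proof -
      obtain g c where g: "g \<in> ?W" "f = (\<lambda>x. g x + c * \<phi> a x)" using split[OF f] by blast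
      have ev_f: "ev i f = ev i g + c * ev i (\<phi> a)" if "i \<in> J" for i
        unfolding g(2) by (rule linear_formD[OF lin[OF that]]) (use g(1) sub phi in auto)
      have ev_g: "ev k g = (\<Sum>i\<in>I. ev i g * ev k (l i))"
      proof -
        have "ev k g = ev k (\<lambda>x. \<Sum>i\<in>I. ev i g * l i x)"
          by (rule arg_cong[OF repr[OF g(1)]])
        also have "\<dots> = (\<Sum>i\<in>I. ev i g * ev k (l i))"
          by (rule linear_form_sum[OF lin[OF k(1)] I(1)]) (rule l')
        finally show ?thesis .
      qed
      have sum2: "(\<Sum>i\<in>I. t i * l2 i x) = (\<Sum>i\<in>I. t i * l i x) - (\<Sum>i\<in>I. t i * ev k (l i)) * lk x" for t x
      proof -
        have "(\<Sum>i\<in>I. t i * l2 i x) = (\<Sum>i\<in>I. t i * l i x - t i * ev k (l i) * lk x)"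
          using kI by (intro sum.cong) (auto simp: l2_def algebra_simps)
        then show ?thesis by (simp add: sum_subtractf sum_distrib_right)
      qed
      have "(\<Sum>i\<in>insert k I. ev i f * l2 i x) = f x" for x
      proof -
        have "(\<Sum>i\<in>insert k I. ev i f * l2 i x) = ev k f * lk x + (\<Sum>i\<in>I. ev i f * l2 i x)"
          using I(1) kI by (simp add: l2_def)
        also have "(\<Sum>i\<in>I. ev i f * l2 i x) = (\<Sum>i\<in>I. ev i g * l2 i x) + c * (\<Sum>i\<in>I. ev i (\<phi> a) * l2 i x)"
          using I(2) by (simp add: sum_distrib_left flip: sum.distrib)
            (intro sum.cong, auto simp: ev_f subset_iff algebra_simps)
        also have "(\<Sum>i\<in>I. ev i g * l2 i x) = g x - ev k g * lk x"
          unfolding sum2 using fun_cong[OF repr[OF g(1)], of x] ev_g by simp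
        also have "(\<Sum>i\<in>I. ev i (\<phi> a) * l2 i x) = q x - ev k q * lk x"
          unfolding sum2 ev_q[OF k(1)] by (simp add: q_def)
        finally have "(\<Sum>i\<in>insert k I. ev i f * l2 i x)
            = g x + c * (q x + (ev k (\<phi> a) - ev k q) * lk x)"
          by (simp add: ev_f[OF k(1)] algebra_simps)
        also have "(ev k (\<phi> a) - ev k q) * lk x = r x" using k(2) by (simp add: lk_def ev_r[OF k(1)])
        also have "q x + r x = \<phi> a x" by (simp add: r_def)
        finally show ?thesis using g(2) by simp
      qed
      then show ?thesis by auto
    qed
    moreover have "finite (insert k I)" "insert k I \<subseteq> J" using I k by auto
    ultimately show ?thesis using l2 dual2
      by (intro exI[of _ "insert k I"] exI[of _ l2] conjI ballI)
  qed
qed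

text \<open>
By definiteness the functionals \<open>B _ v\<close> separate points. If \<open>l\<close> is dual to the chosen \<open>i \<in> I\<close>, then the \<open>i\<close>
themselves span the space, so it is enough to prescribe \<open>B g i = L i\<close>, which \<open>\<Sum> L i * l i\<close> does.
\<close>

lemma riesz:
  assumes fin: "finite A" and W: "W = fun_span A \<phi>"
    and lin: "\<And>v. v \<in> W \<Longrightarrow> linear_form W (\<lambda>f. B f v)"
    and sym: "\<And>f g. f \<in> W \<Longrightarrow> g \<in> W \<Longrightarrow> B f g = B g f"
    and def: "\<And>f. f \<in> W \<Longrightarrow> B f f = 0 \<Longrightarrow> f = (\<lambda>x. 0)"
    and L: "linear_form W L"
  shows "\<exists>g\<in>W. \<forall>v\<in>W. B g v = L v"
proof -
  have "\<exists>I l. finite I \<and> I \<subseteq> W \<and> (\<forall>i\<in>I. l i \<in> fun_span A \<phi>)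
    \<and> (\<forall>i\<in>I. \<forall>j\<in>I. B (l j) i = (if i = j then 1 else 0))
    \<and> (\<forall>f\<in>fun_span A \<phi>. f = (\<lambda>x. \<Sum>i\<in>I. B f i * l i x))"
  proof (rule dual_basis[OF fin, where J=W and ev="\<lambda>v f. B f v"])
    show "linear_form (fun_span A \<phi>) (\<lambda>f. B f v)" if "v \<in> W" for v using lin[OF that] W by simp
    show "f = (\<lambda>x. 0)" if "f \<in> fun_span A \<phi>" "\<And>v. v \<in> W \<Longrightarrow> B f v = 0" for f
      using def[of f] that W by simp
  qed
  then obtain I l where H: "finite I \<and> I \<subseteq> W \<and> (\<forall>i\<in>I. l i \<in> fun_span A \<phi>)
    \<and> (\<forall>i\<in>I. \<forall>j\<in>I. B (l j) i = (if i = j then 1 else 0))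
    \<and> (\<forall>f\<in>fun_span A \<phi>. f = (\<lambda>x. \<Sum>i\<in>I. B f i * l i x))" by (elim exE)
  have I: "finite I" "I \<subseteq> W" using H by simp_all
  have l: "l i \<in> W" if "i \<in> I" for i using H that W by simp
  have dual: "B (l j) i = (if i = j then 1 else 0)" if "i \<in> I" "j \<in> I" for i j using H that by simp
  have repr: "f = (\<lambda>x. \<Sum>i\<in>I. B f i * l i x)" if "f \<in> W" for f
    using conjunct2[OF conjunct2[OF conjunct2[OF conjunct2[OF H]]]] that W by (metis (no_types))
  note sum_in = fun_span_sum[OF I(1), where A=A and \<phi>=\<phi>, folded W]
  note lin_sum = linear_form_sum[OF _ I(1), where A=A and \<phi>=\<phi>, folded W]
  have repr2: "v = (\<lambda>x. \<Sum>i\<in>I. B v (l i) * i x)" if v: "v \<in> W" for v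
  proof -
    define q where "q = (\<lambda>x. \<Sum>i\<in>I. B v (l i) * i x)"
    have q: "q \<in> W" unfolding q_def by (rule sum_in) (use I in auto)
    define r where "r = (\<lambda>x. v x + (-1) * q x)"
    have r: "r \<in> W" unfolding r_def W by (rule fun_span_add) (use v q W in auto)
    have "B r (l j) = 0" if j: "j \<in> I" for j
    proof -
      have "B q (l j) = (\<Sum>i\<in>I. B v (l i) * B i (l j))"
        unfolding q_def by (rule lin_sum[OF lin]) (use I l j in auto)
      also have "\<dots> = (\<Sum>i\<in>I. if i = j then B v (l i) else 0)"
      proof (rule sum.cong[OF refl])
        fix i assume i: "i \<in> I"
        then have "B i (l j) = B (l j) i" using I l j by (intro sym) auto
        then show "B v (l i) * B i (l j) = (if i = j then B v (l i) else 0)"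
          using dual[OF i j] by simp
      qed
      finally have "B q (l j) = B v (l j)" using I j by simp
      moreover have "B r (l j) = B v (l j) + (-1) * B q (l j)"
        unfolding r_def by (rule linear_formD[OF lin[OF l[OF j]] v q])
      ultimately show ?thesis by simp
    qed
    then have "B (l j) r = 0" if "j \<in> I" for j using that sym l r by metis
    then have "B (\<lambda>x. \<Sum>i\<in>I. B r i * l i x) r = 0"
      by (subst lin_sum[OF lin]) (use r l in auto)
    then have "B r r = 0" using repr[OF r] by simp
    then have "r = (\<lambda>x. 0)" using def r by blast
    then show ?thesis by (auto simp: r_def q_def fun_eq_iff)
  qed
  define g where "g = (\<lambda>x. \<Sum>i\<in>I. L i * l i x)"
  have g: "g \<in> W" unfolding g_def by (rule sum_in) (use l in auto)
  moreover have "B g v = L v" if v: "v \<in> W" for v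
  proof -
    have "B g v = (\<Sum>i\<in>I. L i * B (l i) v)"
      unfolding g_def by (rule lin_sum[OF lin[OF v]]) (use l in auto)
    also have "\<dots> = (\<Sum>i\<in>I. B v (l i) * L i)"
      using sym l v by (intro sum.cong) auto
    also have "\<dots> = L (\<lambda>x. \<Sum>i\<in>I. B v (l i) * i x)"
      by (rule lin_sum[OF L, symmetric]) (use I in auto)
    finally show ?thesis using repr2[OF v] by simp
  qed
  ultimately show ?thesis by blast
qed

lemma finite_multi_indices: "finite {\<alpha>::'n::finite \<Rightarrow> nat. (\<Sum>i\<in>UNIV. \<alpha> i) \<le> N}"
proof (rule finite_subset)
  show "{\<alpha>::'n \<Rightarrow> nat. (\<Sum>i\<in>UNIV. \<alpha> i) \<le> N} \<subseteq> PiE UNIV (\<lambda>_. {..N})"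
  proof (clarsimp simp: PiE_def)
    fix \<alpha> :: "'n \<Rightarrow> nat" and i
    have "\<alpha> i \<le> (\<Sum>i\<in>UNIV. \<alpha> i)" by (rule member_le_sum) auto
    also assume "(\<Sum>i\<in>UNIV. \<alpha> i) \<le> N"
    finally show "\<alpha> i \<le> N" .
  qed
  show "finite (PiE (UNIV::'n set) (\<lambda>_. {..N}))" by (rule finite_PiE) auto
qed

lemma polys_fun_span:
  "polys N = fun_span {\<alpha>::'n::finite \<Rightarrow> nat. (\<Sum>i\<in>UNIV. \<alpha> i) \<le> N} (\<lambda>\<alpha> (x::real^'n). \<Prod>i\<in>UNIV. (x $ i) ^ \<alpha> i)"
  unfolding polys_def fun_span_def ..

lemma polys_add: "f \<in> polys N \<Longrightarrow> g \<in> polys N \<Longrightarrow> (\<lambda>x. f x + c * g x) \<in> polys N"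
  unfolding polys_fun_span by (rule fun_span_add)

lemma polys_zero: "(\<lambda>x. 0) \<in> polys N"
  unfolding polys_fun_span by (rule fun_span_zero)

lemma polys_polynomial:
  assumes "f \<in> polys N"
  shows "real_polynomial_function f"
proof -
  obtain c where f: "f = (\<lambda>x. \<Sum>\<alpha>\<in>{\<alpha>. (\<Sum>i\<in>UNIV. \<alpha> i) \<le> N}. c \<alpha> * (\<Prod>i\<in>UNIV. (x $ i) ^ \<alpha> i))"
    using assms by (auto simp: polys_def)
  show ?thesis unfolding f
    by (intro real_polynomial_function_sum real_polynomial_function.intros(2,4)
        real_polynomial_function_prod real_polynomial_function_power real_polynomial_function.intros(1)
        bounded_linear_vec_nth finite_multi_indices finite)
qed

lemma polynomial_C1:
  assumes "real_polynomial_function (f :: 'a::euclidean_space \<Rightarrow> real)"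
  shows "\<exists>f'. (\<forall>x. (f has_derivative f' x) (at x)) \<and> (\<forall>e. continuous_on UNIV (\<lambda>x. f' x e))"
  using assms
proof (induction f rule: real_polynomial_function.induct)
  case (linear f)
  then show ?case
    by (intro exI[of _ "\<lambda>x. f"]) (auto intro: bounded_linear.has_derivative)
next
  case (const c)
  then show ?case by (intro exI[of _ "\<lambda>x h. 0"]) auto
next
  case (add f g)
  then obtain f' g' where "\<forall>x. (f has_derivative f' x) (at x)" "\<forall>e. continuous_on UNIV (\<lambda>x. f' x e)"
    "\<forall>x. (g has_derivative g' x) (at x)" "\<forall>e. continuous_on UNIV (\<lambda>x. g' x e)" by blast
  then show ?case
    by (intro exI[of _ "\<lambda>x h. f' x h + g' x h"]) (auto intro!: has_derivative_add continuous_intros)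
next
  case (mult f g)
  then obtain f' g' where *: "\<forall>x. (f has_derivative f' x) (at x)" "\<forall>e. continuous_on UNIV (\<lambda>x. f' x e)"
    "\<forall>x. (g has_derivative g' x) (at x)" "\<forall>e. continuous_on UNIV (\<lambda>x. g' x e)" by blast
  have "continuous_on UNIV f" "continuous_on UNIV g"
    using * by (meson continuous_at_imp_continuous_on has_derivative_continuous)+
  then show ?case using *
    by (intro exI[of _ "\<lambda>x h. f x * g' x h + f' x h * g x"])
      (auto intro!: has_derivative_mult continuous_intros)
qed

lemma polys_C1:
  assumes "f \<in> polys N"
  shows "(f has_derivative frechet_derivative f (at x)) (at x)"
    and "continuous_on UNIV (\<lambda>x. frechet_derivative f (at x) e)"
    and "continuous_on UNIV f"
proof -
  obtain f' where f': "\<And>x. (f has_derivative f' x) (at x)" "\<And>e. continuous_on UNIV (\<lambda>x. f' x e)"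
    using polynomial_C1[OF polys_polynomial[OF assms]] by blast
  then have "frechet_derivative f (at x) = f' x" for x using frechet_derivative_at by metis
  then show "(f has_derivative frechet_derivative f (at x)) (at x)"
    "continuous_on UNIV (\<lambda>x. frechet_derivative f (at x) e)" using f' by auto
  show "continuous_on UNIV f"
    using f'(1) by (meson continuous_at_imp_continuous_on has_derivative_continuous)
qed

text \<open>
On each line through a point of the open set the function is a polynomial in one variable with infinitely many zeros.
Hence a polynomial is determined by its values on an element, which makes \<open>Tinv\<close>, a definite
description on the whole space, well defined.
\<close>

lemma polynomial_zero_on_open:
  fixes f :: "real^'n \<Rightarrow> real"
  assumes f: "f \<in> polys N" and U: "open U" "U \<noteq> {}" and z: "\<And>x. x \<in> U \<Longrightarrow> f x = 0"
  shows "f = (\<lambda>x. 0)"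
proof
  fix y
  obtain x0 where x0: "x0 \<in> U" using U by blast
  let ?c = "\<lambda>s::real. x0 + s *\<^sub>R (y - x0)"
  have "real_polynomial_function (f \<circ> ?c)"
    by (intro real_polynomial_function_compose polys_polynomial[OF f] polynomial_function_add
        polynomial_function_const polynomial_function_bounded_linear)
      (rule bounded_linear_scaleR_left)
  then obtain a n where a: "f \<circ> ?c = (\<lambda>s. \<Sum>i\<le>n. a i * s ^ i)"
    using real_polynomial_function_iff_sum by blast
  have "((\<lambda>s. ?c s) \<longlongrightarrow> ?c 0) (at_right 0)" by (intro tendsto_intros)
  then have "eventually (\<lambda>s. ?c s \<in> U) (at_right 0)"
    using x0 U(1) by (auto dest: topological_tendstoD)
  then obtain d where d: "d > 0" "\<And>s. 0 < s \<Longrightarrow> s < d \<Longrightarrow> ?c s \<in> U"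
    by (auto simp: eventually_at_right_field)
  then have "{0<..<d} \<subseteq> {s. (\<Sum>i\<le>n. a i * s ^ i) = 0}"
    using z fun_cong[OF a] by (force simp: o_def)
  moreover have "infinite {0<..<d}" using d(1) by simp
  ultimately have "infinite {s. (\<Sum>i\<le>n. a i * s ^ i) = 0}" using finite_subset by blast
  then have "\<forall>i\<le>n. a i = 0" using polyfun_finite_roots[where n=n and c=a] by blast
  then have "(f \<circ> ?c) 1 = 0" using a by simp
  then show "f y = 0" by simp
qed

section \<open>The weight-adjusted mass form on an element\<close>

definition sym_bilinear :: "('x \<Rightarrow> real) set \<Rightarrow> (('x \<Rightarrow> real) \<Rightarrow> ('x \<Rightarrow> real) \<Rightarrow> real) \<Rightarrow> bool" where
  "sym_bilinear W Q \<longleftrightarrow> (\<forall>f\<in>W. \<forall>g\<in>W. Q f g = Q g f) \<and> (\<forall>g\<in>W. linear_form W (\<lambda>f. Q f g))"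

lemma sym_bilinear_sym: "sym_bilinear W Q \<Longrightarrow> f \<in> W \<Longrightarrow> g \<in> W \<Longrightarrow> Q f g = Q g f"
  by (simp add: sym_bilinear_def)

lemma sym_bilinear_linear: "sym_bilinear W Q \<Longrightarrow> g \<in> W \<Longrightarrow> linear_form W (\<lambda>f. Q f g)"
  by (simp add: sym_bilinear_def)

lemma sym_bilinear_square:
  assumes Q: "sym_bilinear (polys N) Q" and f: "f \<in> polys N" and g: "g \<in> polys N"
  shows "Q (\<lambda>x. f x + t * g x) (\<lambda>x. f x + t * g x) = Q f f + 2 * t * Q f g + t\<^sup>2 * Q g g"
proof -
  let ?h = "\<lambda>x. f x + t * g x"
  have h: "?h \<in> polys N" by (rule polys_add[OF f g])
  have *: "Q ?h k = Q f k + t * Q g k" if "k \<in> polys N" for k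
    by (rule linear_formD[OF sym_bilinear_linear[OF Q that] f g])
  show ?thesis
    using *[OF h] *[OF f] *[OF g] sym_bilinear_sym[OF Q f g] sym_bilinear_sym[OF Q h f] sym_bilinear_sym[OF Q h g]
    by (simp add: algebra_simps power2_eq_square)
qed

lemma dual_basis_bilinear:
  assumes Q: "sym_bilinear (fun_span A \<phi>) Q" and I: "finite I" and l: "\<And>i. i \<in> I \<Longrightarrow> l i \<in> fun_span A \<phi>"
  shows "Q (\<lambda>x. \<Sum>i\<in>I. c i * l i x) (\<lambda>x. \<Sum>j\<in>I. d j * l j x) = (\<Sum>i\<in>I. \<Sum>j\<in>I. c i * d j * Q (l i) (l j))"
proof -
  have in_span: "(\<lambda>x. \<Sum>j\<in>I. d j * l j x) \<in> fun_span A \<phi>" for d by (rule fun_span_sum[OF I l])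
  have lin: "Q (\<lambda>x. \<Sum>i\<in>I. c i * l i x) k = (\<Sum>i\<in>I. c i * Q (l i) k)" if "k \<in> fun_span A \<phi>" for c k
    by (rule linear_form_sum[OF sym_bilinear_linear[OF Q that] I l])
  have "Q (l i) (\<lambda>x. \<Sum>j\<in>I. d j * l j x) = (\<Sum>j\<in>I. d j * Q (l i) (l j))" if i: "i \<in> I" for i
  proof -
    have "Q (l i) (\<lambda>x. \<Sum>j\<in>I. d j * l j x) = Q (\<lambda>x. \<Sum>j\<in>I. d j * l j x) (l i)"
      by (rule sym_bilinear_sym[OF Q l[OF i] in_span])
    also have "\<dots> = (\<Sum>j\<in>I. d j * Q (l j) (l i))" by (rule lin[OF l[OF i]])
    also have "\<dots> = (\<Sum>j\<in>I. d j * Q (l i) (l j))"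
      by (intro sum.cong refl arg_cong2[where f="(*)"] sym_bilinear_sym[OF Q] l i)
    finally show ?thesis .
  qed
  then show ?thesis unfolding lin[OF in_span]
    by (intro sum.cong) (simp_all add: sum_distrib_left mult.assoc)
qed

definition mass :: "(real^'n) set \<Rightarrow> (real^'n \<Rightarrow> real) \<Rightarrow> (real^'n \<Rightarrow> real) \<Rightarrow> real" where
  "mass K f g = (LINT x|lebesgue_on K. f x * g x)"

definition tmass :: "nat \<Rightarrow> (real^'n) set \<Rightarrow> (real^'n \<Rightarrow> real) \<Rightarrow> (real^'n \<Rightarrow> real) \<Rightarrow> (real^'n \<Rightarrow> real) \<Rightarrow> real" where
  "tmass N K \<omega> f g = mass K (Tinv N K \<omega> f) g"

context simplex_coords
begin

lemma K_borel: "K \<in> sets borel" using compact_K by (simp add: borel_compact)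

lemma K_lebesgue: "K \<in> sets lebesgue" using K_borel by simp

lemma K_frontier_null: "K - interior K \<in> null_sets lebesgue"
proof -
  have "K - interior K \<subseteq> frontier K" using closure_subset[of K] by (auto simp: frontier_def)
  then have "negligible (K - interior K)"
    using negligible_convex_frontier[OF convex_K] negligible_subset by blast
  then show ?thesis by (simp add: negligible_iff_null_sets)
qed

lemma AE_K_interior: "AE x in lebesgue_on K. x \<in> interior K"
proof -
  have "AE x in lebesgue. x \<notin> K - interior K" by (rule AE_not_in[OF K_frontier_null])
  then show ?thesis using K_lebesgue by (auto simp: AE_restrict_space_iff)
qed

text \<open>
The zero set is closed, so it contains every open set almost all of whose points it contains.
\<close>

lemma polys_eq_0:
  assumes "f \<in> polys N" "AE x in lebesgue_on K. f x = 0"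
  shows "f = (\<lambda>x. 0)"
proof (rule polynomial_zero_on_open[OF assms(1) open_interior interior_nonempty])
  fix x assume x: "x \<in> interior K"
  have "closed {x. f x = 0}"
    by (intro closed_Collect_eq polys_C1(3)[OF assms(1)] continuous_intros)
  moreover have "AE x\<in>interior K in lebesgue. x \<in> {x. f x = 0}"
    using assms(2) K_lebesgue interior_subset[of K] by (auto simp: AE_restrict_space_iff)
  ultimately show "f x = 0"
    using mem_closed_if_AE_lebesgue_open[OF open_interior _ _ x] by blast
qed

lemma integrable_mult_polys:
  assumes "f \<in> polys N" "g \<in> polys M"
  shows "integrable (lebesgue_on K) (\<lambda>x. f x * g x)"
  by (intro integrable_on_K continuous_on_mult polys_C1(3)[OF assms(1)] polys_C1(3)[OF assms(2)])

lemma polys_eq_0_square: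
  assumes f: "f \<in> polys N" and "(LINT x|lebesgue_on K. f x * f x) = 0"
  shows "f = (\<lambda>x. 0)"
proof (rule polys_eq_0[OF f])
  have "AE x in lebesgue_on K. f x * f x = 0"
    using assms integrable_mult_polys[OF f f] by (subst (asm) integral_nonneg_eq_0_iff_AE) auto
  then show "AE x in lebesgue_on K. f x = 0" by auto
qed

lemma polys_eq_0_on_K:
  assumes f: "f \<in> polys N" and "\<And>x. x \<in> K \<Longrightarrow> f x = 0"
  shows "f = (\<lambda>x. 0)"
  by (rule polynomial_zero_on_open[OF assms(1) open_interior interior_nonempty])
    (use assms(2) interior_subset in blast)

lemma mass_bilinear: "sym_bilinear (polys N) (mass K)"
  unfolding sym_bilinear_def linear_form_def
proof (intro conjI ballI allI)
  fix f g h :: "real^'n \<Rightarrow> real" and c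
  show "mass K f g = mass K g f" by (simp add: mass_def mult.commute)
  assume "g \<in> polys N" "f \<in> polys N" "h \<in> polys N"
  then show "mass K (\<lambda>x. f x + c * h x) g = mass K f g + c * mass K h g"
    using integrable_mult_polys[of f N g N] integrable_mult_polys[of h N g N]
    by (simp add: mass_def distrib_right mult.assoc)
qed

text \<open>
Interpolation at finitely many points \<open>I\<close> of the element writes \<open>q s\<close> as \<open>\<Sum> q s i * l i\<close>. So the pointwise derivative
agrees on the element with a polynomial \<open>d\<close>, and \<open>Q (q s) (q s)\<close> is a finite double sum of products of
differentiable functions of time.
\<close>

lemma time_derivative:
  assumes q: "\<And>s. s \<in> J \<Longrightarrow> q s \<in> polys N"
    and dq: "\<And>x. x \<in> K \<Longrightarrow> ((\<lambda>s. q s x) has_vector_derivative dq x) (at t within J)"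
    and t: "t \<in> J" "at t within J \<noteq> bot"
  shows "\<exists>d\<in>polys N. (\<forall>x\<in>K. d x = dq x) \<and>
    (\<forall>Q. sym_bilinear (polys N) Q \<longrightarrow>
       ((\<lambda>s. Q (q s) (q s)) has_real_derivative 2 * Q d (q t)) (at t within J))"
proof -
  let ?A = "{\<alpha>::'n \<Rightarrow> nat. (\<Sum>i\<in>UNIV. \<alpha> i) \<le> N}"
  let ?\<phi> = "\<lambda>\<alpha> (x::real^'n). \<Prod>i\<in>UNIV. (x $ i) ^ \<alpha> i"
  note span = polys_fun_span[where N=N and 'n='n]
  have "\<exists>I l. finite I \<and> I \<subseteq> K \<and> (\<forall>i\<in>I. l i \<in> fun_span ?A ?\<phi>)
    \<and> (\<forall>i\<in>I. \<forall>j\<in>I. l j i = (if i = j then 1 else 0))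
    \<and> (\<forall>f\<in>fun_span ?A ?\<phi>. f = (\<lambda>x. \<Sum>i\<in>I. f i * l i x))"
  proof (rule dual_basis[OF finite_multi_indices, where J=K and ev="\<lambda>x f. f x"])
    show "linear_form (fun_span ?A ?\<phi>) (\<lambda>f. f x)" for x by (simp add: linear_form_def)
    show "f = (\<lambda>x. 0)" if "f \<in> fun_span ?A ?\<phi>" "\<And>x. x \<in> K \<Longrightarrow> f x = 0" for f
      using that polys_eq_0_on_K[of f N] by (simp add: span)
  qed
  then obtain I l where H: "finite I \<and> I \<subseteq> K \<and> (\<forall>i\<in>I. l i \<in> fun_span ?A ?\<phi>)
    \<and> (\<forall>i\<in>I. \<forall>j\<in>I. l j i = (if i = j then 1 else 0))
    \<and> (\<forall>f\<in>fun_span ?A ?\<phi>. f = (\<lambda>x. \<Sum>i\<in>I. f i * l i x))" by (elim exE)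
  have I: "finite I" "I \<subseteq> K" using H by simp_all
  have l: "l i \<in> polys N" if "i \<in> I" for i using H that by (simp add: span)
  have repr: "f = (\<lambda>x. \<Sum>i\<in>I. f i * l i x)" if "f \<in> polys N" for f
    using conjunct2[OF conjunct2[OF conjunct2[OF conjunct2[OF H]]]] that[unfolded span] by (rule bspec)
  define d where "d = (\<lambda>x. \<Sum>i\<in>I. dq i * l i x)"
  have d: "d \<in> polys N" unfolding d_def span by (rule fun_span_sum[OF I(1)]) (use l span in auto)
  have dq': "((\<lambda>s. q s i) has_real_derivative dq i) (at t within J)" if "i \<in> I" for i
    using dq[of i] that I(2) by (auto simp: has_real_derivative_iff_has_vector_derivative)
  have d_eq: "d x = dq x" if x: "x \<in> K" for x
  proof -
    have "((\<lambda>s. \<Sum>i\<in>I. q s i * l i x) has_real_derivative (\<Sum>i\<in>I. dq i * l i x)) (at t within J)"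
      by (intro DERIV_sum DERIV_cmult_right dq')
    note D = this
    have E: "q s x = (\<Sum>i\<in>I. q s i * l i x)" if "s \<in> J" for s
      by (rule fun_cong[OF repr[OF q[OF that]]])
    have "((\<lambda>s. q s x) has_vector_derivative (\<Sum>i\<in>I. dq i * l i x)) (at t within J)"
      by (rule has_vector_derivative_transform[OF t(1) _ D[unfolded has_real_derivative_iff_has_vector_derivative]])
        (rule E)
    then show ?thesis
      using vector_derivative_unique_within[OF t(2)] dq[OF x] by (auto simp: d_def)
  qed
  have "((\<lambda>s. Q (q s) (q s)) has_real_derivative 2 * Q d (q t)) (at t within J)"
    if Q: "sym_bilinear (polys N) Q" for Q
  proof -
    note Q' = Q[unfolded span]
    have expand: "Q f g = (\<Sum>i\<in>I. \<Sum>j\<in>I. f i * g j * Q (l i) (l j))" if "f \<in> polys N" "g \<in> polys N" for f g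
    proof -
      have "Q f g = Q (\<lambda>x. \<Sum>i\<in>I. f i * l i x) (\<lambda>x. \<Sum>i\<in>I. g i * l i x)"
        by (rule arg_cong2[where f=Q, OF repr[OF that(1)] repr[OF that(2)]])
      also have "\<dots> = (\<Sum>i\<in>I. \<Sum>j\<in>I. f i * g j * Q (l i) (l j))"
        by (rule dual_basis_bilinear[OF Q' I(1)]) (use l span in auto)
      finally show ?thesis .
    qed
    have "((\<lambda>s. \<Sum>i\<in>I. \<Sum>j\<in>I. q s i * q s j * Q (l i) (l j)) has_real_derivative
       (\<Sum>i\<in>I. \<Sum>j\<in>I. (dq i * q t j + dq j * q t i) * Q (l i) (l j))) (at t within J)"
      by (intro DERIV_sum DERIV_cmult_right DERIV_mult dq')
    note D = this
    have E: "Q (q s) (q s) = (\<Sum>i\<in>I. \<Sum>j\<in>I. q s i * q s j * Q (l i) (l j))" if "s \<in> J" for s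
      by (rule expand[OF q[OF that] q[OF that]])
    have "((\<lambda>s. Q (q s) (q s)) has_real_derivative
       (\<Sum>i\<in>I. \<Sum>j\<in>I. (dq i * q t j + dq j * q t i) * Q (l i) (l j))) (at t within J)"
      unfolding has_real_derivative_iff_has_vector_derivative
      by (rule has_vector_derivative_transform[OF t(1) _ D[unfolded has_real_derivative_iff_has_vector_derivative]])
        (rule E)
    moreover have "(\<Sum>i\<in>I. \<Sum>j\<in>I. (dq i * q t j + dq j * q t i) * Q (l i) (l j)) = Q d (q t) + Q (q t) d"
    proof -
      have "d i = dq i" if "i \<in> I" for i using that d_eq I by auto
      then show ?thesis
        unfolding expand[OF d q[OF t(1)]] expand[OF q[OF t(1)] d]
        by (simp add: sum.distrib[symmetric] algebra_simps)
    qed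
    ultimately show ?thesis using sym_bilinear_sym[OF Q d q[OF t(1)]] by simp
  qed
  then show ?thesis by (intro bexI[OF _ d] conjI ballI allI impI d_eq)
qed

text \<open>
The time derivative in the scheme is constrained only at points of the element; this allows it to be replaced by the
polynomial that extends it.
\<close>

lemma Tinv_cong:
  assumes "\<And>x. x \<in> K \<Longrightarrow> f x = g x"
  shows "Tinv N K \<omega> f = Tinv N K \<omega> g"
proof -
  have "(LINT x|lebesgue_on K. f x * v x) = (LINT x|lebesgue_on K. g x * v x)" for v
    by (intro Bochner_Integration.integral_cong) (auto simp: assms)
  then show ?thesis by (simp add: Tinv_def)
qed

end

locale weighted_element = simplex_coords K V a b
  for K V :: "(real^'n) set" and a :: "real^'n \<Rightarrow> real^'n" and b :: "real^'n \<Rightarrow> real" +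
  fixes N :: nat and \<omega> :: "real^'n \<Rightarrow> real" and lo hi :: real
  assumes \<omega>_meas: "\<omega> \<in> borel_measurable (lebesgue_on K)" and lo: "0 < lo"
    and \<omega>_bounds: "AE x in lebesgue_on K. lo \<le> \<omega> x \<and> \<omega> x \<le> hi"
begin

lemma integrable_weighted:
  assumes h: "continuous_on UNIV h"
  shows "integrable (lebesgue_on K) (\<lambda>x. \<omega> x * h x)"
proof (rule Bochner_Integration.integrable_bound)
  have hi: "integrable (lebesgue_on K) h" by (rule integrable_on_K[OF h])
  then show "integrable (lebesgue_on K) (\<lambda>x. hi * h x)" by simp
  show "(\<lambda>x. \<omega> x * h x) \<in> borel_measurable (lebesgue_on K)" using \<omega>_meas hi by measurable
  show "AE x in lebesgue_on K. norm (\<omega> x * h x) \<le> norm (hi * h x)"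
    using \<omega>_bounds
  proof eventually_elim
    case (elim x)
    then show ?case using lo by (auto simp: abs_mult intro!: mult_right_mono)
  qed
qed

definition wmass :: "(real^'n \<Rightarrow> real) \<Rightarrow> (real^'n \<Rightarrow> real) \<Rightarrow> real" where
  "wmass f g = (LINT x|lebesgue_on K. \<omega> x * f x * g x)"

lemma integrable_wmass:
  assumes "f \<in> polys N" "g \<in> polys N"
  shows "integrable (lebesgue_on K) (\<lambda>x. \<omega> x * f x * g x)"
  using integrable_weighted[OF continuous_on_mult[OF polys_C1(3)[OF assms(1)] polys_C1(3)[OF assms(2)]]]
  by (simp add: mult.assoc)

lemma wmass_bilinear: "sym_bilinear (polys N) wmass"
  unfolding sym_bilinear_def linear_form_def
proof (intro conjI ballI allI)
  fix f g h :: "real^'n \<Rightarrow> real" and c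
  show "wmass f g = wmass g f" by (simp add: wmass_def mult.commute mult.left_commute)
  assume g: "g \<in> polys N" "f \<in> polys N" "h \<in> polys N"
  have "wmass (\<lambda>x. f x + c * h x) g = (LINT x|lebesgue_on K. \<omega> x * f x * g x + c * (\<omega> x * h x * g x))"
    unfolding wmass_def by (intro Bochner_Integration.integral_cong) (auto simp: algebra_simps)
  also have "\<dots> = wmass f g + c * wmass h g"
    using integrable_wmass[OF g(2,1)] integrable_wmass[OF g(3,1)] by (simp add: wmass_def)
  finally show "wmass (\<lambda>x. f x + c * h x) g = wmass f g + c * wmass h g" .
qed

lemma wmass_bounds:
  assumes f: "f \<in> polys N"
  shows "lo * mass K f f \<le> wmass f f" "wmass f f \<le> hi * mass K f f"
proof -
  note int = integrable_wmass[OF f f] integrable_mult_polys[OF f f]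
  have "(LINT x|lebesgue_on K. lo * (f x * f x)) \<le> (LINT x|lebesgue_on K. \<omega> x * f x * f x)"
  proof (rule integral_mono_AE)
    show "AE x in lebesgue_on K. lo * (f x * f x) \<le> \<omega> x * f x * f x"
      using \<omega>_bounds by eventually_elim (simp add: mult.assoc mult_right_mono)
  qed (use int in simp_all)
  then show "lo * mass K f f \<le> wmass f f" by (simp add: mass_def wmass_def)
  have "(LINT x|lebesgue_on K. \<omega> x * f x * f x) \<le> (LINT x|lebesgue_on K. hi * (f x * f x))"
  proof (rule integral_mono_AE)
    show "AE x in lebesgue_on K. \<omega> x * f x * f x \<le> hi * (f x * f x)"
      using \<omega>_bounds by eventually_elim (simp add: mult.assoc mult_right_mono)
  qed (use int in simp_all)
  then show "wmass f f \<le> hi * mass K f f" by (simp add: mass_def wmass_def)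
qed

lemma mass_nonneg: "0 \<le> mass K f f"
  unfolding mass_def by (rule integral_nonneg_AE) simp

lemma wmass_definite:
  assumes f: "f \<in> polys N" and 0: "wmass f f = 0"
  shows "f = (\<lambda>x. 0)"
proof -
  have "lo * mass K f f \<le> 0" using wmass_bounds(1)[OF f] 0 by simp
  then have "mass K f f = 0" using mass_nonneg[of f] lo by (simp add: mult_le_0_iff)
  then show ?thesis using polys_eq_0_square[OF f] by (simp add: mass_def)
qed

lemma Tinv_unique:
  assumes g: "g \<in> polys N" "\<And>v. v \<in> polys N \<Longrightarrow> wmass g v = L v"
    and h: "h \<in> polys N" "\<And>v. v \<in> polys N \<Longrightarrow> wmass h v = L v"
  shows "g = h"
proof -
  let ?d = "\<lambda>x. g x + (-1) * h x"
  have d: "?d \<in> polys N" by (rule polys_add[OF g(1) h(1)])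
  have "wmass ?d ?d = wmass g ?d + (-1) * wmass h ?d"
    by (rule linear_formD[OF sym_bilinear_linear[OF wmass_bilinear d] g(1) h(1)])
  then have "wmass ?d ?d = 0" using g(2)[OF d] h(2)[OF d] by simp
  then have "?d = (\<lambda>x. 0)" by (rule wmass_definite[OF d])
  then show ?thesis by (auto simp: fun_eq_iff)
qed

lemma Tinv_props:
  assumes f: "f \<in> polys N"
  shows "Tinv N K \<omega> f \<in> polys N" "\<And>v. v \<in> polys N \<Longrightarrow> wmass (Tinv N K \<omega> f) v = mass K f v"
proof -
  have "\<exists>g\<in>polys N. \<forall>v\<in>polys N. wmass g v = mass K f v"
  proof (rule riesz[OF finite_multi_indices polys_fun_span])
    show "linear_form (polys N) (\<lambda>g. wmass g v)" if "v \<in> polys N" for v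
      by (rule sym_bilinear_linear[OF wmass_bilinear that])
    show "wmass g h = wmass h g" if "g \<in> polys N" "h \<in> polys N" for g h
      by (rule sym_bilinear_sym[OF wmass_bilinear that])
    show "g = (\<lambda>x. 0)" if "g \<in> polys N" "wmass g g = 0" for g by (rule wmass_definite[OF that])
    have "mass K f = (\<lambda>v. mass K v f)" by (auto simp: mass_def mult.commute)
    then show "linear_form (polys N) (mass K f)" using sym_bilinear_linear[OF mass_bilinear f] by simp
  qed
  then obtain g where g: "g \<in> polys N" "\<And>v. v \<in> polys N \<Longrightarrow> wmass g v = mass K f v" by blast
  have "Tinv N K \<omega> f = g"
    unfolding Tinv_def
  proof (rule the_equality)
    show "g \<in> polys N \<and> (\<forall>v\<in>polys N. (LINT x|lebesgue_on K. \<omega> x * g x * v x) = (LINT x|lebesgue_on K. f x * v x))"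
      using g by (simp add: wmass_def mass_def)
    fix h assume "h \<in> polys N \<and> (\<forall>v\<in>polys N. (LINT x|lebesgue_on K. \<omega> x * h x * v x) = (LINT x|lebesgue_on K. f x * v x))"
    then show "h = g" using g by (intro Tinv_unique[of h "mass K f" g]) (auto simp: wmass_def mass_def)
  qed
  then show "Tinv N K \<omega> f \<in> polys N" "\<And>v. v \<in> polys N \<Longrightarrow> wmass (Tinv N K \<omega> f) v = mass K f v"
    using g by simp_all
qed

text \<open>
The source of the symmetry and of the positivity of the form: it is the weighted inner product of the
images under \<open>Tinv\<close>.
\<close>

lemma tmass_wmass:
  assumes "f \<in> polys N" "g \<in> polys N"
  shows "tmass N K \<omega> f g = wmass (Tinv N K \<omega> g) (Tinv N K \<omega> f)"
proof -
  have "tmass N K \<omega> f g = mass K g (Tinv N K \<omega> f)" by (simp add: tmass_def mass_def mult.commute)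
  then show ?thesis using Tinv_props assms by simp
qed

lemma tmass_bilinear: "sym_bilinear (polys N) (tmass N K \<omega>)"
  unfolding sym_bilinear_def linear_form_def
proof (intro conjI ballI allI)
  show sym: "tmass N K \<omega> f g = tmass N K \<omega> g f" if "f \<in> polys N" "g \<in> polys N" for f g
    unfolding tmass_wmass[OF that] tmass_wmass[OF that(2,1)]
    by (intro sym_bilinear_sym[OF wmass_bilinear] Tinv_props that)
  fix f g h :: "real^'n \<Rightarrow> real" and c
  assume g: "g \<in> polys N" and f: "f \<in> polys N" and h: "h \<in> polys N"
  have fh: "(\<lambda>x. f x + c * h x) \<in> polys N" by (rule polys_add[OF f h])
  have "tmass N K \<omega> (\<lambda>x. f x + c * h x) g = tmass N K \<omega> g (\<lambda>x. f x + c * h x)" by (rule sym[OF fh g])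
  also have "\<dots> = mass K (\<lambda>x. f x + c * h x) (Tinv N K \<omega> g)" by (simp add: tmass_def mass_def mult.commute)
  also have "\<dots> = mass K f (Tinv N K \<omega> g) + c * mass K h (Tinv N K \<omega> g)"
    by (rule linear_formD[OF sym_bilinear_linear[OF mass_bilinear Tinv_props(1)[OF g]] f h])
  also have "\<dots> = tmass N K \<omega> g f + c * tmass N K \<omega> g h" by (simp add: tmass_def mass_def mult.commute)
  finally show "tmass N K \<omega> (\<lambda>x. f x + c * h x) g = tmass N K \<omega> f g + c * tmass N K \<omega> h g"
    using sym f g h by simp
qed

text \<open>
With \<open>g = Tinv f\<close> one has \<open>\<integral> \<omega> g\<^sup>2 = \<integral> g f\<close> and \<open>\<integral> \<omega> g f = \<integral> f\<^sup>2\<close>. The upper bound is the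
nonnegativity of \<open>\<integral> (g - f/lo)\<^sup>2\<close> together with \<open>lo \<integral> g\<^sup>2 \<le> \<integral> \<omega> g\<^sup>2\<close>; the lower bound is that of
\<open>\<integral> \<omega> (g - f/hi)\<^sup>2\<close> together with \<open>\<integral> \<omega> f\<^sup>2 \<le> hi \<integral> f\<^sup>2\<close>.
\<close>

lemma tmass_bounds:
  assumes f: "f \<in> polys N"
  shows "mass K f f / hi \<le> tmass N K \<omega> f f" "tmass N K \<omega> f f \<le> mass K f f / lo"
proof -
  let ?g = "Tinv N K \<omega> f"
  note g = Tinv_props[OF f]
  \<comment> \<open>the bounds hold almost everywhere on the element, which is not a null set\<close>
  have hi: "lo \<le> hi"
  proof -
    have "\<not> (AE x in lebesgue_on K. False)"
    proof
      assume "AE x in lebesgue_on K. False"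
      then have "AE x in lebesgue_on K. (1::real) = 0" by (auto elim: eventually_mono)
      moreover have "(\<lambda>x::real^'n. 1::real) \<in> polys 0"
      proof -
        have "{\<alpha>::'n \<Rightarrow> nat. (\<Sum>i\<in>UNIV. \<alpha> i) \<le> 0} = {\<lambda>_. 0}" by auto
        then show ?thesis unfolding polys_def by (auto intro!: exI[of _ "\<lambda>_. 1"])
      qed
      ultimately have "(\<lambda>x::real^'n. 1::real) = (\<lambda>x. 0)" by (intro polys_eq_0)
      then show False by (simp add: fun_eq_iff)
    qed
    moreover have "AE x in lebesgue_on K. lo \<le> hi" using \<omega>_bounds by eventually_elim simp
    ultimately show ?thesis by (cases "lo \<le> hi") auto
  qed
  have t: "tmass N K \<omega> f f = wmass ?g ?g" by (rule tmass_wmass[OF f f])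
  have gf: "wmass ?g f = mass K f f" by (rule g(2)[OF f])
  have mgf: "mass K ?g f = tmass N K \<omega> f f" by (simp add: tmass_def)
  have "0 \<le> mass K (\<lambda>x. ?g x + (- 1 / lo) * f x) (\<lambda>x. ?g x + (- 1 / lo) * f x)" by (rule mass_nonneg)
  also have "\<dots> = mass K ?g ?g + 2 * (- 1 / lo) * tmass N K \<omega> f f + (- 1 / lo)\<^sup>2 * mass K f f"
    by (simp only: sym_bilinear_square[OF mass_bilinear g(1) f] mgf)
  also have "mass K ?g ?g \<le> tmass N K \<omega> f f / lo" using wmass_bounds(1)[OF g(1)] t lo by (simp add: field_simps)
  finally have "tmass N K \<omega> f f / lo \<le> mass K f f / lo / lo" by (simp add: power2_eq_square)
  then show "tmass N K \<omega> f f \<le> mass K f f / lo" using lo by (simp add: field_simps)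
  have "0 \<le> lo * mass K (\<lambda>x. ?g x + (- 1 / hi) * f x) (\<lambda>x. ?g x + (- 1 / hi) * f x)"
    using mass_nonneg lo by simp
  also have "\<dots> \<le> wmass (\<lambda>x. ?g x + (- 1 / hi) * f x) (\<lambda>x. ?g x + (- 1 / hi) * f x)"
    by (rule wmass_bounds(1)[OF polys_add[OF g(1) f]])
  also have "\<dots> = tmass N K \<omega> f f + 2 * (- 1 / hi) * mass K f f + (- 1 / hi)\<^sup>2 * wmass f f"
    by (simp only: sym_bilinear_square[OF wmass_bilinear g(1) f] t gf)
  also have "(- 1 / hi)\<^sup>2 * wmass f f \<le> (- 1 / hi)\<^sup>2 * (hi * mass K f f)"
    by (intro mult_left_mono wmass_bounds(2)[OF f]) simp
  finally show "mass K f f / hi \<le> tmass N K \<omega> f f" using lo hi by (simp add: power2_eq_square)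
qed

end

section \<open>Fluxes and norms on the mesh\<close>

lemma vpolys_component: "v \<in> vpolys N \<Longrightarrow> (\<lambda>x. v x $ i) \<in> polys N"
  by (simp add: vpolys_def)

lemma vpolys_add: "u \<in> vpolys N \<Longrightarrow> v \<in> vpolys N \<Longrightarrow> (\<lambda>x. u x + c *\<^sub>R v x) \<in> vpolys N"
  by (auto simp: vpolys_def intro: polys_add)

lemma continuous_vpolys: "v \<in> vpolys N \<Longrightarrow> continuous_on UNIV v"
  using continuous_on_vec_lambda[of UNIV "\<lambda>i x. v x $ i", OF polys_C1(3)[OF vpolys_component]]
  by (simp add: vec_lambda_eta)

lemma gradient_inner:
  fixes v :: "real^'n"
  shows "gradient p x \<bullet> v = (\<Sum>i\<in>UNIV. frechet_derivative p (at x) (axis i 1) * v $ i)"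
  by (simp add: gradient_def inner_vec_def)

lemma divergence_vpolys:
  fixes v :: "real^'n \<Rightarrow> real^'n"
  assumes "v \<in> vpolys N"
  shows "divergence v x = (\<Sum>i\<in>UNIV. frechet_derivative (\<lambda>x. v x $ i) (at x) (axis i 1))"
proof -
  let ?D = "\<lambda>h. \<chi> i. frechet_derivative (\<lambda>x. v x $ i) (at x) h"
  have "(v has_derivative ?D) (at x)"
    unfolding has_derivative_componentwise_within[of v]
  proof
    fix b :: "real^'n" assume "b \<in> Basis"
    then obtain i where b: "b = axis i 1" by (auto simp: Basis_vec_def)
    show "((\<lambda>x. v x \<bullet> b) has_derivative (\<lambda>h. ?D h \<bullet> b)) (at x)"
      using polys_C1(1)[OF vpolys_component[OF assms], of i x] by (simp add: b inner_axis)
  qed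
  then have "frechet_derivative v (at x) = ?D" by (metis frechet_derivative_at)
  then show ?thesis by (simp add: divergence_def)
qed

context dg_mesh
begin

lemma face_integrable_cont:
  assumes K: "K \<in> \<T>" "F facet_of K" and f: "continuous_on UNIV (f :: _ \<Rightarrow> real)"
  shows "integrable (face_measure F) f"
  using face_integrable[OF K _ _ f, of "\<lambda>_. 1" 1] by simp

text \<open>
The divergence theorem for \<open>p v\<close>, applied to each component of \<open>v\<close> in its coordinate direction.
\<close>

lemma gauss_product:
  assumes K: "K \<in> \<T>" and p: "p \<in> polys N" and v: "v \<in> vpolys N"
  shows "(LINT x|lebesgue_on K. gradient p x \<bullet> v x) + (LINT x|lebesgue_on K. divergence v x * p x)
    = boundary_integral K (\<lambda>F x. p x * (v x \<bullet> outward_normal K F))"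
proof -
  obtain V a b where "simplex_coords K V a b" using coords[OF K] .
  then interpret simplex_coords K V a b .
  note pc = polys_C1[OF p] and vc = polys_C1[OF vpolys_component[OF v]]
  let ?dp = "\<lambda>i x. frechet_derivative p (at x) (axis i 1)"
  let ?dv = "\<lambda>i x. frechet_derivative (\<lambda>x. v x $ i) (at x) (axis i 1)"
  have int1: "integrable (lebesgue_on K) (\<lambda>x. ?dp i x * v x $ i)"
    and int2: "integrable (lebesgue_on K) (\<lambda>x. ?dv i x * p x)" for i
    by (intro integrable_on_K continuous_on_mult pc vc)+
  have face: "(LINT x|lebesgue_on K. ?dp i x * v x $ i + ?dv i x * p x)
     = (\<Sum>F\<in>{F. F facet_of K}. outward_normal K F $ i * (LINT x|face_measure F. p x * v x $ i))" for i
  proof -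
    have D: "((\<lambda>x. p x * v x $ i) has_derivative
        (\<lambda>h. p x * frechet_derivative (\<lambda>x. v x $ i) (at x) h + frechet_derivative p (at x) h * v x $ i)) (at x)" for x
      by (rule has_derivative_mult[OF pc(1) vc(1)])
    have "(LINT x|lebesgue_on K. p x * ?dv i x + ?dp i x * v x $ i)
      = (\<Sum>F\<in>{F. F facet_of K}. (outward_normal K F \<bullet> axis i 1) * (LINT x|face_measure F. p x * v x $ i))"
      by (rule gauss[OF D]) (intro continuous_on_add continuous_on_mult pc vc)
    then show ?thesis by (simp add: inner_axis algebra_simps)
  qed
  have "(LINT x|lebesgue_on K. gradient p x \<bullet> v x) + (LINT x|lebesgue_on K. divergence v x * p x)
    = (\<Sum>i\<in>UNIV. LINT x|lebesgue_on K. ?dp i x * v x $ i + ?dv i x * p x)"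
    by (simp add: gradient_inner divergence_vpolys[OF v] sum_distrib_right Bochner_Integration.integral_sum
        int1 int2 sum.distrib)
  also have "\<dots> = (\<Sum>F\<in>{F. F facet_of K}. \<Sum>i\<in>UNIV. outward_normal K F $ i * (LINT x|face_measure F. p x * v x $ i))"
    unfolding face by (rule sum.swap)
  also have "\<dots> = (\<Sum>F\<in>{F. F facet_of K}. LINT x|face_measure F. p x * (v x \<bullet> outward_normal K F))"
  proof (rule sum.cong[OF refl])
    fix F assume "F \<in> {F. F facet_of K}"
    then have F: "F facet_of K" by simp
    have "integrable (face_measure F) (\<lambda>x. p x * v x $ i)" for i
      by (intro face_integrable_cont[OF K F] continuous_on_mult pc vc)
    then have "(\<Sum>i\<in>UNIV. outward_normal K F $ i * (LINT x|face_measure F. p x * v x $ i))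
      = (LINT x|face_measure F. (\<Sum>i\<in>UNIV. outward_normal K F $ i * (p x * v x $ i)))"
      by (simp add: Bochner_Integration.integral_sum)
    also have "\<dots> = (LINT x|face_measure F. p x * (v x \<bullet> outward_normal K F))"
      by (intro Bochner_Integration.integral_cong refl) (simp add: inner_vec_def sum_distrib_left algebra_simps)
    finally show "(\<Sum>i\<in>UNIV. outward_normal K F $ i * (LINT x|face_measure F. p x * v x $ i))
      = (LINT x|face_measure F. p x * (v x \<bullet> outward_normal K F))" .
  qed
  finally show ?thesis by (simp add: boundary_integral_def)
qed

lemma continuous_traces:
  assumes "K \<in> \<T>" "F facet_of K" "p \<in> broken_polys \<T> N" "u \<in> broken_vpolys \<T> N"
  shows "continuous_on UNIV (p K)" "continuous_on UNIV (\<lambda>x. u K x \<bullet> outward_normal K F)"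
    "continuous_on UNIV (jump \<T> p K F)" "continuous_on UNIV (normal_jump \<T> u K F)"
proof -
  have c: "continuous_on UNIV (p L)" "continuous_on UNIV (u L)" if "L \<in> \<T>" for L
  proof -
    have "p L \<in> polys N" "u L \<in> vpolys N"
      using that assms(3,4) by (auto simp: broken_polys_def broken_vpolys_def)
    then show "continuous_on UNIV (p L)" "continuous_on UNIV (u L)"
      using polys_C1(3)[of "p L" N] continuous_vpolys[of "u L" N] by simp_all
  qed
  show "continuous_on UNIV (p K)" by (rule c(1)[OF assms(1)])
  show "continuous_on UNIV (\<lambda>x. u K x \<bullet> outward_normal K F)"
    by (intro continuous_intros c(2)[OF assms(1)])
  show "continuous_on UNIV (jump \<T> p K F)"
    unfolding jump_def[abs_def] ext_trace_def
    by (cases "shared_face \<T> K F") (auto intro!: continuous_intros c assms(1) neighbour_symmetric(1)[OF assms(1,2)])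
  show "continuous_on UNIV (normal_jump \<T> u K F)"
    unfolding normal_jump_def[abs_def] ext_normal_trace_def
    by (cases "shared_face \<T> K F") (auto intro!: continuous_intros c assms(1) neighbour_symmetric(1)[OF assms(1,2)])
qed

lemma penalty_face:
  assumes "penalty \<T> \<tau>" "K \<in> \<T>" "F facet_of K"
  shows "\<tau> F \<in> borel_measurable (face_measure F)" "\<exists>B. \<forall>x\<in>F. \<bar>\<tau> F x\<bar> \<le> B" "\<And>x. x \<in> F \<Longrightarrow> 0 \<le> \<tau> F x"
proof -
  have F: "F \<in> mesh_faces \<T>" using assms(2,3) by (auto simp: mesh_faces_def)
  then show "\<tau> F \<in> borel_measurable (face_measure F)" using assms(1) by (simp add: penalty_def)
  obtain B where "\<forall>x\<in>F. 0 \<le> \<tau> F x \<and> \<tau> F x \<le> B" using assms(1) F unfolding penalty_def by blast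
  then show "\<exists>B. \<forall>x\<in>F. \<bar>\<tau> F x\<bar> \<le> B" "\<And>x. x \<in> F \<Longrightarrow> 0 \<le> \<tau> F x" by auto
qed

lemma penalty_integrable:
  assumes "penalty \<T> \<tau>" "K \<in> \<T>" "F facet_of K" "continuous_on UNIV (f :: _ \<Rightarrow> real)"
  shows "integrable (face_measure F) (\<lambda>x. \<tau> F x * f x)"
  using penalty_face[OF assms(1-3)] face_integrable[OF assms(2,3) _ _ assms(4)] by blast

text \<open>
The integrand on one facet of one element of the difference between the two sides of the energy balance.
\<close>

definition flux_residual where
  "flux_residual \<tau>p \<tau>u p u K F x =
     - 2 * (p K x * (u K x \<bullet> outward_normal K F))
     + 2 * (1/2 * (\<tau>p F x * jump \<T> p K F x - normal_jump \<T> u K F x) * p K x)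
     + 2 * (1/2 * (\<tau>u F x * normal_jump \<T> u K F x - jump \<T> p K F x) * (u K x \<bullet> outward_normal K F))
     + 1/2 * (\<tau>p F x * (jump \<T> p K F x)\<^sup>2 + \<tau>u F x * (normal_jump \<T> u K F x)\<^sup>2)"

text \<open>
With traces \<open>p\<^sup>-, p\<^sup>+\<close> and normal components \<open>u\<^sup>-, u\<^sup>+\<close>, both with respect to the normal of \<open>K\<close>, the residual is
\<open>\<tau>p ((p\<^sup>+)\<^sup>2 - (p\<^sup>-)\<^sup>2) / 2 + \<tau>u ((u\<^sup>+)\<^sup>2 - (u\<^sup>-)\<^sup>2) / 2 - u\<^sup>+ p\<^sup>- - p\<^sup>+ u\<^sup>-\<close>. From the neighbour's side the
pressures are exchanged, and the normal components are exchanged and negated.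
\<close>

lemma flux_residual_neighbour:
  assumes "K \<in> \<T>" "F facet_of K" "shared_face \<T> K F"
  shows "flux_residual \<tau>p \<tau>u p u (neighbour \<T> K F) F x = - flux_residual \<tau>p \<tau>u p u K F x"
proof -
  let ?L = "neighbour \<T> K F" and ?n = "outward_normal K F"
  note nb = neighbour_symmetric[OF assms]
  have j: "jump \<T> p K F x = p ?L x - p K x" "jump \<T> p ?L F x = p K x - p ?L x"
    "normal_jump \<T> u K F x = u ?L x \<bullet> ?n - u K x \<bullet> ?n"
    "normal_jump \<T> u ?L F x = - (u K x \<bullet> ?n) + u ?L x \<bullet> ?n"
    using assms(3) nb by (simp_all add: jump_def ext_trace_def normal_jump_def ext_normal_trace_def inner_commute)
  then show ?thesis
    unfolding flux_residual_def nb(5) j by (simp add: algebra_simps power2_eq_square)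
qed

text \<open>
On the boundary the jump of \<open>p\<close> is \<open>-2 p\<close> and the normal jump of \<open>u\<close> is 0.
\<close>

lemma flux_residual_boundary:
  assumes "\<not> shared_face \<T> K F"
  shows "flux_residual \<tau>p \<tau>u p u K F x = 0"
  using assms
  by (simp add: flux_residual_def jump_def ext_trace_def normal_jump_def ext_normal_trace_def power2_eq_square algebra_simps)

lemma flux_balance:
  assumes p: "p \<in> broken_polys \<T> N" and u: "u \<in> broken_vpolys \<T> N"
    and \<tau>: "penalty \<T> \<tau>p" "penalty \<T> \<tau>u"
  shows "(\<Sum>K\<in>\<T>. 2 *
      (- boundary_integral K (\<lambda>F x. p K x * (u K x \<bullet> outward_normal K F))
       + boundary_integral K (\<lambda>F x. 1/2 * (\<tau>p F x * jump \<T> p K F x - normal_jump \<T> u K F x) * p K x)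
       + boundary_integral K (\<lambda>F x. 1/2 * (\<tau>u F x * normal_jump \<T> u K F x - jump \<T> p K F x)
            * (u K x \<bullet> outward_normal K F))))
    = - (\<Sum>K\<in>\<T>. 1/2 * boundary_integral K (\<lambda>F x.
            \<tau>p F x * (jump \<T> p K F x)\<^sup>2 + \<tau>u F x * (normal_jump \<T> u K F x)\<^sup>2))" (is "?L = - ?R")
proof -
  let ?A = "\<lambda>K F x. p K x * (u K x \<bullet> outward_normal K F)"
  let ?B = "\<lambda>K F x. 1/2 * (\<tau>p F x * jump \<T> p K F x - normal_jump \<T> u K F x) * p K x"
  let ?C = "\<lambda>K F x. 1/2 * (\<tau>u F x * normal_jump \<T> u K F x - jump \<T> p K F x) * (u K x \<bullet> outward_normal K F)"
  let ?D = "\<lambda>K F x. \<tau>p F x * (jump \<T> p K F x)\<^sup>2 + \<tau>u F x * (normal_jump \<T> u K F x)\<^sup>2"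
  have face: "- 2 * (LINT x|face_measure F. ?A K F x) + 2 * (LINT x|face_measure F. ?B K F x)
      + 2 * (LINT x|face_measure F. ?C K F x) + 1/2 * (LINT x|face_measure F. ?D K F x)
      = (LINT x|face_measure F. flux_residual \<tau>p \<tau>u p u K F x)"
    if K: "K \<in> \<T>" "F facet_of K" for K F
  proof -
    note c = continuous_traces[OF K p u]
    have A: "integrable (face_measure F) (?A K F)"
      by (intro face_integrable_cont[OF K] continuous_on_mult c)
    have "integrable (face_measure F) (\<lambda>x. \<tau>p F x * (1/2 * jump \<T> p K F x * p K x) - 1/2 * normal_jump \<T> u K F x * p K x)"
      by (intro Bochner_Integration.integrable_diff penalty_integrable[OF \<tau>(1) K] face_integrable_cont[OF K]
          continuous_on_mult continuous_on_const c)
    then have B: "integrable (face_measure F) (?B K F)" by (simp add: algebra_simps)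
    have "integrable (face_measure F) (\<lambda>x. \<tau>u F x * (1/2 * normal_jump \<T> u K F x * (u K x \<bullet> outward_normal K F))
        - 1/2 * jump \<T> p K F x * (u K x \<bullet> outward_normal K F))"
      by (intro Bochner_Integration.integrable_diff penalty_integrable[OF \<tau>(2) K] face_integrable_cont[OF K]
          continuous_on_mult continuous_on_const c)
    then have C: "integrable (face_measure F) (?C K F)" by (simp add: algebra_simps)
    have D: "integrable (face_measure F) (?D K F)"
      by (intro Bochner_Integration.integrable_add penalty_integrable[OF \<tau>(1) K] penalty_integrable[OF \<tau>(2) K]
          continuous_on_power c)
    show ?thesis unfolding flux_residual_def
      by (simp only: Bochner_Integration.integral_add Bochner_Integration.integral_mult_right_zero
          Bochner_Integration.integrable_add Bochner_Integration.integrable_mult_right A B C D)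
  qed
  have elem: "2 * (- boundary_integral K (?A K) + boundary_integral K (?B K) + boundary_integral K (?C K))
      + 1/2 * boundary_integral K (?D K)
      = (\<Sum>F\<in>{F. F facet_of K}. LINT x|face_measure F. flux_residual \<tau>p \<tau>u p u K F x)" if "K \<in> \<T>" for K
  proof -
    have "(\<Sum>F\<in>{F. F facet_of K}. LINT x|face_measure F. flux_residual \<tau>p \<tau>u p u K F x)
      = (\<Sum>F\<in>{F. F facet_of K}. - 2 * (LINT x|face_measure F. ?A K F x) + 2 * (LINT x|face_measure F. ?B K F x)
      + 2 * (LINT x|face_measure F. ?C K F x) + 1/2 * (LINT x|face_measure F. ?D K F x))"
      using face[OF that] by (intro sum.cong) simp_all
    then show ?thesis
      by (simp only: boundary_integral_def sum.distrib sum_distrib_left[symmetric]) (simp add: algebra_simps)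
  qed
  have "?L + ?R = (\<Sum>K\<in>\<T>. \<Sum>F\<in>{F. F facet_of K}. LINT x|face_measure F. flux_residual \<tau>p \<tau>u p u K F x)"
    unfolding sum.distrib[symmetric] by (rule sum.cong[OF refl]) (rule elem)
  also have "\<dots> = 0"
    by (rule sum_over_faces_cancel) (simp_all add: flux_residual_neighbour flux_residual_boundary)
  finally show ?thesis by simp
qed

lemma dissipation_nonneg:
  assumes \<tau>: "penalty \<T> \<tau>p" "penalty \<T> \<tau>u" and K: "K \<in> \<T>"
  shows "0 \<le> boundary_integral K (\<lambda>F x.
            \<tau>p F x * (jump \<T> p K F x)\<^sup>2 + \<tau>u F x * (normal_jump \<T> u K F x)\<^sup>2)"
  unfolding boundary_integral_def
proof (intro sum_nonneg integral_nonneg_AE)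
  fix F assume "F \<in> {F. F facet_of K}"
  then have F: "F facet_of K" by simp
  show "AE x in face_measure F. 0 \<le> \<tau>p F x * (jump \<T> p K F x)\<^sup>2 + \<tau>u F x * (normal_jump \<T> u K F x)\<^sup>2"
    using face_measure_facts(2)[OF K F]
    by eventually_elim (simp add: penalty_face(3)[OF \<tau>(1) K F] penalty_face(3)[OF \<tau>(2) K F])
qed

text \<open>
At most one summand of the assembled function is nonzero at each point, and the element boundaries are null sets.
\<close>

lemma l2norm_assemble:
  fixes q :: "(real^'n) set \<Rightarrow> real^'n \<Rightarrow> 'b::real_normed_vector"
  assumes q: "\<And>K. K \<in> \<T> \<Longrightarrow> continuous_on UNIV (q K)"
  shows "(l2norm \<Omega> (assemble \<T> q))\<^sup>2 = (\<Sum>K\<in>\<T>. LINT x|lebesgue_on K. (norm (q K x))\<^sup>2)"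
proof -
  have \<Omega>: "\<Omega> \<in> sets lebesgue" using lip by (simp add: lipschitz_domain_def)
  have pointwise: "(norm (assemble \<T> q x))\<^sup>2 = (\<Sum>K\<in>\<T>. indicator (interior K) x * (norm (q K x))\<^sup>2)" for x
  proof (cases "\<exists>L\<in>\<T>. x \<in> interior L")
    case True
    then obtain L where L: "L \<in> \<T>" "x \<in> interior L" by blast
    then have other: "x \<notin> interior K" if "K \<in> \<T> - {L}" for K
      using interior_disjoint[of K L] that by blast
    have "assemble \<T> q x = q L x"
      unfolding assemble_def sum.remove[OF finite_mesh L(1)] using L(2) other
      by (simp add: sum.neutral)
    moreover have "(\<Sum>K\<in>\<T>. indicator (interior K) x * (norm (q K x))\<^sup>2) = (norm (q L x))\<^sup>2"
      unfolding sum.remove[OF finite_mesh L(1)] using L(2) other by (simp add: sum.neutral)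
    ultimately show ?thesis by simp
  next
    case False
    then show ?thesis by (simp add: assemble_def sum.neutral)
  qed
  have elem: "integrable (lebesgue_on \<Omega>) (\<lambda>x. indicator (interior K) x * (norm (q K x))\<^sup>2) \<and>
     (LINT x|lebesgue_on \<Omega>. indicator (interior K) x * (norm (q K x))\<^sup>2) = (LINT x|lebesgue_on K. (norm (q K x))\<^sup>2)"
    if K: "K \<in> \<T>" for K
  proof -
    obtain V a b where "simplex_coords K V a b" using coords[OF K] .
    then interpret simplex_coords K V a b .
    let ?h = "\<lambda>x. (norm (q K x))\<^sup>2"
    have h: "continuous_on UNIV ?h" by (intro continuous_intros q K)
    have int: "integrable lebesgue (\<lambda>x. indicator K x *\<^sub>R ?h x)"
      using integrable_on_K[OF h] K_lebesgue by (simp add: integrable_restrict_space)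
    have meas: "(\<lambda>x. indicator (interior K) x * ?h x) \<in> borel_measurable lebesgue"
      using borel_measurable_continuous_onI[OF h]
      by (intro borel_measurable_times borel_measurable_indicator measurable_completion) auto
    have ae: "AE x in lebesgue. indicator K x *\<^sub>R ?h x = indicator (interior K) x * ?h x"
      using AE_not_in[OF K_frontier_null]
      by eventually_elim (use interior_subset[of K] in \<open>auto split: split_indicator\<close>)
    have int': "integrable lebesgue (\<lambda>x. indicator (interior K) x * ?h x)"
      using integrable_cong_AE[OF _ meas ae] int by auto
    have \<Omega>ind: "indicator \<Omega> x *\<^sub>R (indicator (interior K) x * ?h x) = indicator (interior K) x * ?h x" for x
      using interior_subset_domain[OF K] by (auto split: split_indicator)
    have "(LINT x|lebesgue_on \<Omega>. indicator (interior K) x * ?h x) = (LINT x|lebesgue. indicator (interior K) x * ?h x)"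
      using \<Omega> by (subst integral_restrict_space) (auto simp only: \<Omega>ind)
    also have "\<dots> = (LINT x|lebesgue. indicator K x *\<^sub>R ?h x)"
      using integral_cong_AE[OF _ meas ae] int by auto
    also have "\<dots> = (LINT x|lebesgue_on K. ?h x)"
      using K_lebesgue by (subst integral_restrict_space) auto
    finally show ?thesis
      using int' \<Omega> by (subst integrable_restrict_space) (auto simp only: \<Omega>ind)
  qed
  have "(l2norm \<Omega> (assemble \<T> q))\<^sup>2 = (LINT x|lebesgue_on \<Omega>. (norm (assemble \<T> q x))\<^sup>2)"
    by (simp add: l2norm_def)
  also have "\<dots> = (\<Sum>K\<in>\<T>. LINT x|lebesgue_on \<Omega>. indicator (interior K) x * (norm (q K x))\<^sup>2)"
    unfolding pointwise using elem by (intro Bochner_Integration.integral_sum) blast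
  also have "\<dots> = (\<Sum>K\<in>\<T>. LINT x|lebesgue_on K. (norm (q K x))\<^sup>2)"
    using elem by (intro sum.cong) auto
  finally show ?thesis .
qed

lemma element_weight:
  assumes csq: "csq \<in> borel_measurable (lebesgue_on \<Omega>)" and lo: "0 < lo"
    and bd: "\<And>x. x \<in> \<Omega> \<Longrightarrow> lo \<le> csq x \<and> csq x \<le> hi" and K: "K \<in> \<T>"
  obtains V a b where "weighted_element K V a b csq lo hi"
proof -
  obtain V a b where "simplex_coords K V a b" using coords[OF K] .
  then interpret simplex_coords K V a b .
  have I: "interior K \<subseteq> \<Omega>" by (rule interior_subset_domain[OF K])
  have "csq \<in> borel_measurable (lebesgue_on (interior K))"
    using csq I by (rule measurable_restrict_mono)
  moreover have "K - (K - interior K) = interior K" using interior_subset[of K] by blast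
  moreover have "K - interior K \<in> null_sets (lebesgue_on K)"
    using K_frontier_null K_lebesgue by (simp add: null_sets_restrict_space)
  ultimately have "csq \<in> borel_measurable (lebesgue_on K)"
    using borel_measurable_diff_null[of "K - interior K" K csq] K_lebesgue by simp
  moreover have "AE x in lebesgue_on K. lo \<le> csq x \<and> csq x \<le> hi"
    using AE_K_interior by eventually_elim (use I bd in blast)
  ultimately have "weighted_element K V a b csq lo hi"
    using lo by unfold_locales
  then show ?thesis by (rule that)
qed

end

section \<open>The discrete energy\<close>

text \<open>
The bilinear form whose quadratic form is the energy of one element.
\<close>

definition element_form ::
  "nat \<Rightarrow> (real^'n) set \<Rightarrow> (real^'n \<Rightarrow> real) \<Rightarrow> (real^'n \<Rightarrow> real) \<Rightarrow> (real^'n \<Rightarrow> real^'n)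
    \<Rightarrow> (real^'n \<Rightarrow> real) \<Rightarrow> (real^'n \<Rightarrow> real^'n) \<Rightarrow> real" where
  "element_form N K \<omega> q v q' v' =
     tmass N K \<omega> q q' + (\<Sum>i\<in>UNIV. mass K (\<lambda>x. v x $ i) (\<lambda>x. v' x $ i))"

context weighted_element
begin

lemma integral_inner:
  assumes "u \<in> vpolys N" "v \<in> vpolys N"
  shows "(LINT x|lebesgue_on K. u x \<bullet> v x) = (\<Sum>i\<in>UNIV. mass K (\<lambda>x. u x $ i) (\<lambda>x. v x $ i))"
  using integrable_mult_polys[OF vpolys_component[OF assms(1)] vpolys_component[OF assms(2)]]
  by (simp add: mass_def inner_vec_def Bochner_Integration.integral_sum)

lemma element_energy:
  assumes q: "q \<in> polys N" and v: "v \<in> vpolys N"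
  shows "(LINT x|lebesgue_on K. Tinv N K \<omega> q x * q x + (norm (v x))\<^sup>2) = element_form N K \<omega> q v q v"
proof -
  have int: "integrable (lebesgue_on K) (\<lambda>x. v x \<bullet> v x)"
    by (intro integrable_on_K continuous_on_inner continuous_vpolys[OF v])
  have "(LINT x|lebesgue_on K. Tinv N K \<omega> q x * q x + v x \<bullet> v x)
      = tmass N K \<omega> q q + (LINT x|lebesgue_on K. v x \<bullet> v x)"
    using integrable_mult_polys[OF Tinv_props(1)[OF q] q] int by (simp add: tmass_def mass_def)
  then show ?thesis unfolding power2_norm_eq_inner element_form_def integral_inner[OF v v] .
qed

lemma element_form_square:
  assumes q: "q \<in> polys N" "q' \<in> polys N" and v: "v \<in> vpolys N" "v' \<in> vpolys N"
  shows "element_form N K \<omega> (\<lambda>x. q x + t * q' x) (\<lambda>x. v x + t *\<^sub>R v' x) (\<lambda>x. q x + t * q' x) (\<lambda>x. v x + t *\<^sub>R v' x)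
     = element_form N K \<omega> q v q v + 2 * t * element_form N K \<omega> q v q' v' + t\<^sup>2 * element_form N K \<omega> q' v' q' v'"
proof -
  have "mass K (\<lambda>x. (v x + t *\<^sub>R v' x) $ i) (\<lambda>x. (v x + t *\<^sub>R v' x) $ i)
     = mass K (\<lambda>x. v x $ i) (\<lambda>x. v x $ i) + 2 * t * mass K (\<lambda>x. v x $ i) (\<lambda>x. v' x $ i)
       + t\<^sup>2 * mass K (\<lambda>x. v' x $ i) (\<lambda>x. v' x $ i)" for i
    using sym_bilinear_square[OF mass_bilinear vpolys_component[OF v(1)] vpolys_component[OF v(2)], of i t i]
    by simp
  then show ?thesis
    unfolding element_form_def sym_bilinear_square[OF tmass_bilinear q]
    by (simp add: sum.distrib sum_distrib_left algebra_simps)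
qed

lemma element_form_bounds:
  assumes q: "q \<in> polys N" and v: "v \<in> vpolys N"
  shows "(LINT x|lebesgue_on K. (q x)\<^sup>2) / hi + (LINT x|lebesgue_on K. (norm (v x))\<^sup>2) \<le> element_form N K \<omega> q v q v"
    and "element_form N K \<omega> q v q v \<le> (LINT x|lebesgue_on K. (q x)\<^sup>2) / lo + (LINT x|lebesgue_on K. (norm (v x))\<^sup>2)"
  using tmass_bounds[OF q] integral_inner[OF v v]
  by (simp_all add: element_form_def power2_norm_eq_inner mass_def power2_eq_square[of "q _"])

lemma element_form_nonneg:
  assumes q: "q \<in> polys N" and v: "v \<in> vpolys N"
  shows "0 \<le> element_form N K \<omega> q v q v"
  unfolding element_form_def tmass_wmass[OF q q]
  using order_trans[OF mult_nonneg_nonneg[OF less_imp_le[OF lo] mass_nonneg] wmass_bounds(1)[OF Tinv_props(1)[OF q]]]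
  by (intro add_nonneg_nonneg sum_nonneg mass_nonneg)

text \<open>
If the energy vanishes then so does \<open>Tinv q\<close>, hence \<open>\<integral> q\<^sup>2 = \<integral> \<omega> (Tinv q) q = 0\<close>.
\<close>

lemma element_form_definite:
  assumes q: "q \<in> polys N" and v: "v \<in> vpolys N"
  shows "element_form N K \<omega> q v q v = 0 \<longleftrightarrow> (\<forall>x\<in>K. q x = 0 \<and> v x = 0)"
proof
  assume 0: "element_form N K \<omega> q v q v = 0"
  let ?g = "Tinv N K \<omega> q"
  note g = Tinv_props[OF q]
  have 1: "0 \<le> tmass N K \<omega> q q"
    unfolding tmass_wmass[OF q q]
    by (rule order_trans[OF mult_nonneg_nonneg[OF less_imp_le[OF lo] mass_nonneg] wmass_bounds(1)[OF g(1)]])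
  have 2: "0 \<le> (\<Sum>i\<in>UNIV. mass K (\<lambda>x. v x $ i) (\<lambda>x. v x $ i))"
    by (intro sum_nonneg mass_nonneg)
  have t0: "tmass N K \<omega> q q = 0" and s0: "(\<Sum>i\<in>UNIV. mass K (\<lambda>x. v x $ i) (\<lambda>x. v x $ i)) = 0"
    using 0 1 2 by (simp_all add: element_form_def)
  have "?g = (\<lambda>x. 0)"
    using t0 unfolding tmass_wmass[OF q q] by (rule wmass_definite[OF g(1)])
  then have "mass K q q = 0" using g(2)[OF q] by (simp add: wmass_def)
  then have "q = (\<lambda>x. 0)" using polys_eq_0_square[OF q] by (simp add: mass_def)
  moreover have "(\<lambda>x. v x $ i) = (\<lambda>x. 0)" for i
  proof -
    have "mass K (\<lambda>x. v x $ i) (\<lambda>x. v x $ i) = 0"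
      using s0 by (simp add: sum_nonneg_eq_0_iff mass_nonneg)
    then show ?thesis using polys_eq_0_square[OF vpolys_component[OF v]] by (simp add: mass_def)
  qed
  ultimately show "\<forall>x\<in>K. q x = 0 \<and> v x = 0" by (auto simp: vec_eq_iff fun_eq_iff)
next
  assume 0: "\<forall>x\<in>K. q x = 0 \<and> v x = 0"
  have "(LINT x|lebesgue_on K. Tinv N K \<omega> q x * q x + (norm (v x))\<^sup>2) = (LINT x|lebesgue_on K. 0)"
    using 0 by (intro Bochner_Integration.integral_cong) auto
  then show "element_form N K \<omega> q v q v = 0" by (simp add: element_energy[OF q v])
qed

text \<open>
Symmetry of the forms produces the factor 2. The derivatives \<open>dp\<close> and \<open>du\<close>, which are functions with unknown
values outside the element, are replaced by polynomials for the calculation and restored at the end.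
\<close>

lemma element_energy_derivative:
  assumes p: "\<And>s. s \<in> J \<Longrightarrow> p s \<in> polys N" and u: "\<And>s. s \<in> J \<Longrightarrow> u s \<in> vpolys N"
    and dp: "\<And>x. x \<in> K \<Longrightarrow> ((\<lambda>s. p s x) has_vector_derivative dp x) (at t within J)"
    and du: "\<And>x. x \<in> K \<Longrightarrow> ((\<lambda>s. u s x) has_vector_derivative du x) (at t within J)"
    and t: "t \<in> J" "at t within J \<noteq> bot"
  shows "((\<lambda>s. LINT x|lebesgue_on K. Tinv N K \<omega> (p s) x * p s x + (norm (u s x))\<^sup>2) has_real_derivative
     2 * ((LINT x|lebesgue_on K. Tinv N K \<omega> dp x * p t x) + (LINT x|lebesgue_on K. du x \<bullet> u t x))) (at t within J)"
proof -
  have "\<exists>d\<in>polys N. (\<forall>x\<in>K. d x = dp x) \<and> (\<forall>Q. sym_bilinear (polys N) Q \<longrightarrow>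
      ((\<lambda>s. Q (p s) (p s)) has_real_derivative 2 * Q d (p t)) (at t within J))"
    by (rule time_derivative[OF p dp t])
  then obtain d where d: "d \<in> polys N" "\<forall>x\<in>K. d x = dp x"
    "\<forall>Q. sym_bilinear (polys N) Q \<longrightarrow> ((\<lambda>s. Q (p s) (p s)) has_real_derivative 2 * Q d (p t)) (at t within J)"
    by (elim bexE conjE)
  have comp: "\<exists>e. e \<in> polys N \<and> (\<forall>x\<in>K. e x = du x $ i) \<and>
    ((\<lambda>s. mass K (\<lambda>x. u s x $ i) (\<lambda>x. u s x $ i)) has_real_derivative 2 * mass K e (\<lambda>x. u t x $ i)) (at t within J)" for i
  proof -
    have dui: "((\<lambda>s. u s x $ i) has_vector_derivative du x $ i) (at t within J)" if "x \<in> K" for x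
      by (rule bounded_linear.has_vector_derivative[OF bounded_linear_vec_nth du[OF that]])
    have "\<exists>c\<in>polys N. (\<forall>x\<in>K. c x = du x $ i) \<and> (\<forall>Q. sym_bilinear (polys N) Q \<longrightarrow>
        ((\<lambda>s. Q (\<lambda>x. u s x $ i) (\<lambda>x. u s x $ i)) has_real_derivative 2 * Q c (\<lambda>x. u t x $ i)) (at t within J))"
      by (rule time_derivative[where q="\<lambda>s x. u s x $ i", OF vpolys_component[OF u] dui t])
    then obtain c where c: "c \<in> polys N" "\<forall>x\<in>K. c x = du x $ i"
      "\<forall>Q. sym_bilinear (polys N) Q \<longrightarrow> ((\<lambda>s. Q (\<lambda>x. u s x $ i) (\<lambda>x. u s x $ i)) has_real_derivative
         2 * Q c (\<lambda>x. u t x $ i)) (at t within J)"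
      by (elim bexE conjE)
    from c(3)[THEN spec, THEN mp, OF mass_bilinear] show ?thesis
      by (intro exI[of _ c] conjI c(1,2))
  qed
  have "\<exists>e. \<forall>i. e i \<in> polys N \<and> (\<forall>x\<in>K. e i x = du x $ i) \<and>
    ((\<lambda>s. mass K (\<lambda>x. u s x $ i) (\<lambda>x. u s x $ i)) has_real_derivative 2 * mass K (e i) (\<lambda>x. u t x $ i)) (at t within J)"
    by (intro choice allI comp)
  then obtain e where e: "\<forall>i. e i \<in> polys N \<and> (\<forall>x\<in>K. e i x = du x $ i) \<and>
    ((\<lambda>s. mass K (\<lambda>x. u s x $ i) (\<lambda>x. u s x $ i)) has_real_derivative 2 * mass K (e i) (\<lambda>x. u t x $ i)) (at t within J)"
    by (elim exE)
  have e1: "e i \<in> polys N" and e2: "x \<in> K \<Longrightarrow> e i x = du x $ i" and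
    e3: "((\<lambda>s. mass K (\<lambda>x. u s x $ i) (\<lambda>x. u s x $ i)) has_real_derivative 2 * mass K (e i) (\<lambda>x. u t x $ i)) (at t within J)" for i x
    using e[THEN spec[of _ i]] by simp_all
  note d3 = d(3)[THEN spec, THEN mp, OF tmass_bilinear]
  have "((\<lambda>s. element_form N K \<omega> (p s) (u s) (p s) (u s)) has_real_derivative
     2 * tmass N K \<omega> d (p t) + (\<Sum>i\<in>UNIV. 2 * mass K (e i) (\<lambda>x. u t x $ i))) (at t within J)"
    unfolding element_form_def by (intro DERIV_add DERIV_sum d3 e3)
  note D = this
  have E: "(LINT x|lebesgue_on K. Tinv N K \<omega> (p s) x * p s x + (norm (u s x))\<^sup>2)
      = element_form N K \<omega> (p s) (u s) (p s) (u s)" if "s \<in> J" for s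
    by (rule element_energy[OF p[OF that] u[OF that]])
  have "((\<lambda>s. LINT x|lebesgue_on K. Tinv N K \<omega> (p s) x * p s x + (norm (u s x))\<^sup>2) has_real_derivative
     2 * tmass N K \<omega> d (p t) + (\<Sum>i\<in>UNIV. 2 * mass K (e i) (\<lambda>x. u t x $ i))) (at t within J)"
    unfolding has_real_derivative_iff_has_vector_derivative
    by (rule has_vector_derivative_transform[OF t(1) _ D[unfolded has_real_derivative_iff_has_vector_derivative]])
      (rule E)
  moreover have "(LINT x|lebesgue_on K. Tinv N K \<omega> dp x * p t x) = tmass N K \<omega> d (p t)"
    unfolding tmass_def mass_def using Tinv_cong[of d dp N \<omega>] d(2) by simp
  moreover have "(LINT x|lebesgue_on K. du x \<bullet> u t x) = (\<Sum>i\<in>UNIV. mass K (e i) (\<lambda>x. u t x $ i))"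
  proof -
    have "(\<lambda>x. \<chi> i. e i x) \<in> vpolys N" using e1 by (simp add: vpolys_def)
    from integral_inner[OF this u[OF t(1)]]
    have "(LINT x|lebesgue_on K. (\<chi> i. e i x) \<bullet> u t x) = (\<Sum>i\<in>UNIV. mass K (e i) (\<lambda>x. u t x $ i))" by simp
    moreover have "(LINT x|lebesgue_on K. (\<chi> i. e i x) \<bullet> u t x) = (LINT x|lebesgue_on K. du x \<bullet> u t x)"
      by (intro Bochner_Integration.integral_cong) (auto simp: inner_vec_def e2)
    ultimately show ?thesis by simp
  qed
  ultimately show ?thesis by (simp add: sum_distrib_left algebra_simps)
qed

end

text \<open>
The Cauchy-Schwarz inequality \<open>C\<^sup>2 \<le> A B\<close> from a quadratic polynomial without sign change.
\<close>

lemma sqrt_triangle: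
  fixes A B C :: real
  assumes "\<And>t. 0 \<le> A + 2 * t * C + t\<^sup>2 * B" and B: "0 \<le> B"
  shows "sqrt (A + 2 * C + B) \<le> sqrt A + sqrt B"
proof -
  have A: "0 \<le> A" using assms(1)[of 0] by simp
  have "C \<le> sqrt A * sqrt B"
  proof (cases "B = 0")
    case True
    have "C = 0"
    proof (rule ccontr)
      assume "C \<noteq> 0"
      then show False using assms(1)[of "- (A + 1) / (2 * C)"] True by (simp add: field_simps)
    qed
    then show ?thesis using A B by simp
  next
    case False
    then have "B > 0" using B by simp
    then have "C\<^sup>2 \<le> A * B"
      using assms(1)[of "- C / B"] by (simp add: field_simps power2_eq_square)
    then show ?thesis by (metis real_le_rsqrt real_sqrt_mult)
  qed
  then have "A + 2 * C + B \<le> (sqrt A + sqrt B)\<^sup>2" using A B by (simp add: power2_sum)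
  then show ?thesis using A B by (intro real_le_lsqrt) simp_all
qed

locale weighted_mesh = dg_mesh \<Omega> \<T> for \<Omega> :: "(real^'n) set" and \<T> +
  fixes csq :: "real^'n \<Rightarrow> real" and lo hi :: real
  assumes csq_meas: "csq \<in> borel_measurable (lebesgue_on \<Omega>)" and lo: "0 < lo"
    and csq_bounds: "\<And>x. x \<in> \<Omega> \<Longrightarrow> lo \<le> csq x \<and> csq x \<le> hi"
begin

abbreviation w :: "real^'n \<Rightarrow> real" where "w \<equiv> \<lambda>x. 1 / csq x"

lemma element: assumes "K \<in> \<T>" obtains V a b where "weighted_element K V a b csq lo hi"
  using element_weight[OF csq_meas lo csq_bounds assms] .

definition mesh_form where
  "mesh_form N q v q' v' = (\<Sum>K\<in>\<T>. element_form N K csq (q K) (v K) (q' K) (v' K))"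

lemma energy_form:
  assumes q: "q \<in> broken_polys \<T> N" and v: "v \<in> broken_vpolys \<T> N"
  shows "energy \<T> N w q v = mesh_form N q v q v"
  unfolding energy_def mesh_form_def
proof (rule sum.cong[OF refl])
  fix K assume K: "K \<in> \<T>"
  obtain V a b where "weighted_element K V a b csq lo hi" using element[OF K] .
  then interpret weighted_element K V a b N csq lo hi .
  show "(LINT x|lebesgue_on K. Tinv N K (\<lambda>y. 1 / w y) (q K) x * q K x + (norm (v K x))\<^sup>2)
    = element_form N K csq (q K) (v K) (q K) (v K)"
    using element_energy q v K by (simp add: broken_polys_def broken_vpolys_def)
qed

lemma mesh_form_square:
  assumes q: "q \<in> broken_polys \<T> N" "q' \<in> broken_polys \<T> N" and v: "v \<in> broken_vpolys \<T> N" "v' \<in> broken_vpolys \<T> N"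
  shows "mesh_form N (\<lambda>K x. q K x + t * q' K x) (\<lambda>K x. v K x + t *\<^sub>R v' K x) (\<lambda>K x. q K x + t * q' K x) (\<lambda>K x. v K x + t *\<^sub>R v' K x)
    = mesh_form N q v q v + 2 * t * mesh_form N q v q' v' + t\<^sup>2 * mesh_form N q' v' q' v'"
  unfolding mesh_form_def sum_distrib_left sum.distrib[symmetric]
proof (rule sum.cong[OF refl])
  fix K assume K: "K \<in> \<T>"
  obtain V a b where "weighted_element K V a b csq lo hi" using element[OF K] .
  then interpret weighted_element K V a b N csq lo hi .
  show "element_form N K csq (\<lambda>x. q K x + t * q' K x) (\<lambda>x. v K x + t *\<^sub>R v' K x) (\<lambda>x. q K x + t * q' K x) (\<lambda>x. v K x + t *\<^sub>R v' K x)
    = element_form N K csq (q K) (v K) (q K) (v K) + 2 * t * element_form N K csq (q K) (v K) (q' K) (v' K)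
      + t\<^sup>2 * element_form N K csq (q' K) (v' K) (q' K) (v' K)"
    by (rule element_form_square) (use q v K in \<open>auto simp: broken_polys_def broken_vpolys_def\<close>)
qed

lemma broken_add:
  "q \<in> broken_polys \<T> N \<Longrightarrow> q' \<in> broken_polys \<T> N \<Longrightarrow> (\<lambda>K x. q K x + t * q' K x) \<in> broken_polys \<T> N"
  "v \<in> broken_vpolys \<T> N \<Longrightarrow> v' \<in> broken_vpolys \<T> N \<Longrightarrow> (\<lambda>K x. v K x + t *\<^sub>R v' K x) \<in> broken_vpolys \<T> N"
  by (auto simp: broken_polys_def broken_vpolys_def intro: polys_add vpolys_add)

lemma broken_zero: "(\<lambda>K x. 0) \<in> broken_polys \<T> N" "(\<lambda>K x. 0) \<in> broken_vpolys \<T> N"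
  by (auto simp: broken_polys_def broken_vpolys_def vpolys_def polys_zero)

lemma mesh_form_definite:
  assumes q: "q \<in> broken_polys \<T> N" and v: "v \<in> broken_vpolys \<T> N"
  shows "0 \<le> mesh_form N q v q v"
    and "mesh_form N q v q v = 0 \<longleftrightarrow> (\<forall>K\<in>\<T>. \<forall>x\<in>K. q K x = 0 \<and> v K x = 0)"
proof -
  have el: "0 \<le> element_form N K csq (q K) (v K) (q K) (v K) \<and>
     (element_form N K csq (q K) (v K) (q K) (v K) = 0 \<longleftrightarrow> (\<forall>x\<in>K. q K x = 0 \<and> v K x = 0))"
    if K: "K \<in> \<T>" for K
  proof -
    obtain V a b where "weighted_element K V a b csq lo hi" using element[OF K] .
    then interpret weighted_element K V a b N csq lo hi .
    have "q K \<in> polys N" "v K \<in> vpolys N" using q v K by (auto simp: broken_polys_def broken_vpolys_def)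
    then show ?thesis using element_form_nonneg element_form_definite by blast
  qed
  then show "0 \<le> mesh_form N q v q v" unfolding mesh_form_def by (intro sum_nonneg) blast
  show "mesh_form N q v q v = 0 \<longleftrightarrow> (\<forall>K\<in>\<T>. \<forall>x\<in>K. q K x = 0 \<and> v K x = 0)"
    unfolding mesh_form_def using el by (subst sum_nonneg_eq_0_iff[OF finite_mesh]) auto
qed

lemma energy_norm: "broken_norm \<T> N (\<lambda>q v. sqrt (mesh_form N q v q v))"
  unfolding broken_norm_def
proof (intro ballI conjI allI)
  fix q :: "(real^'n) set \<Rightarrow> real^'n \<Rightarrow> real" and v :: "(real^'n) set \<Rightarrow> real^'n \<Rightarrow> real^'n"
  assume q: "q \<in> broken_polys \<T> N" and v: "v \<in> broken_vpolys \<T> N"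
  show "0 \<le> sqrt (mesh_form N q v q v)" using mesh_form_definite(1)[OF q v] by simp
  show "sqrt (mesh_form N q v q v) = 0 \<longleftrightarrow> (\<forall>K\<in>\<T>. \<forall>x\<in>K. q K x = 0 \<and> v K x = 0)"
    using mesh_form_definite(2)[OF q v] by simp
  {
    fix c :: real
    have z: "mesh_form N (\<lambda>K x. 0) (\<lambda>K x. 0) (\<lambda>K x. 0) (\<lambda>K x. 0) = 0"
      using mesh_form_definite(2)[OF broken_zero] by simp
    \<comment> \<open>the mixed term is read off from the expansions of the squares of \<open>q\<close> and \<open>-q\<close>\<close>
    have "mesh_form N (\<lambda>K x. 0) (\<lambda>K x. 0) q v = 0"
      using mesh_form_square[OF broken_zero(1) q broken_zero(2) v, of 1]
        mesh_form_square[OF broken_zero(1) q broken_zero(2) v, of "-1"]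
        mesh_form_square[OF q q v v, of "-2"] z by simp
    then have "mesh_form N (\<lambda>K x. c * q K x) (\<lambda>K x. c *\<^sub>R v K x) (\<lambda>K x. c * q K x) (\<lambda>K x. c *\<^sub>R v K x)
       = c\<^sup>2 * mesh_form N q v q v"
      using mesh_form_square[OF broken_zero(1) q broken_zero(2) v, of c] z by simp
    then show "sqrt (mesh_form N (\<lambda>K x. c * q K x) (\<lambda>K x. c *\<^sub>R v K x) (\<lambda>K x. c * q K x) (\<lambda>K x. c *\<^sub>R v K x))
       = \<bar>c\<bar> * sqrt (mesh_form N q v q v)"
      by (simp add: real_sqrt_mult)
  }
  fix q' :: "(real^'n) set \<Rightarrow> real^'n \<Rightarrow> real" and v' :: "(real^'n) set \<Rightarrow> real^'n \<Rightarrow> real^'n"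
  assume q': "q' \<in> broken_polys \<T> N" and v': "v' \<in> broken_vpolys \<T> N"
  note sq = mesh_form_square[OF q q' v v']
  have "sqrt (mesh_form N q v q v + 2 * mesh_form N q v q' v' + mesh_form N q' v' q' v')
     \<le> sqrt (mesh_form N q v q v) + sqrt (mesh_form N q' v' q' v')"
  proof (rule sqrt_triangle)
    show "0 \<le> mesh_form N q v q v + 2 * t * mesh_form N q v q' v' + t\<^sup>2 * mesh_form N q' v' q' v'" for t
      unfolding sq[symmetric] by (rule mesh_form_definite(1)[OF broken_add(1)[OF q q'] broken_add(2)[OF v v']])
  qed (rule mesh_form_definite(1)[OF q' v'])
  then show "sqrt (mesh_form N (\<lambda>K x. q K x + q' K x) (\<lambda>K x. v K x + v' K x) (\<lambda>K x. q K x + q' K x) (\<lambda>K x. v K x + v' K x))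
     \<le> sqrt (mesh_form N q v q v) + sqrt (mesh_form N q' v' q' v')"
    using sq[of 1] by simp
qed

text \<open>
Here \<open>lo\<close> and \<open>hi\<close> bound the squared wavespeed; so their inverses bound \<open>w\<close> from above and below.
\<close>

lemma energy_bounds:
  assumes q: "q \<in> broken_polys \<T> N" and v: "v \<in> broken_vpolys \<T> N"
  shows "(l2norm \<Omega> (assemble \<T> q))\<^sup>2 / hi + (l2norm \<Omega> (assemble \<T> v))\<^sup>2 \<le> energy \<T> N w q v"
    and "energy \<T> N w q v \<le> (l2norm \<Omega> (assemble \<T> q))\<^sup>2 / lo + (l2norm \<Omega> (assemble \<T> v))\<^sup>2"
proof -
  have in_K: "q K \<in> polys N" "v K \<in> vpolys N" if "K \<in> \<T>" for K
    using q v that by (auto simp: broken_polys_def broken_vpolys_def)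
  have l2: "(l2norm \<Omega> (assemble \<T> q))\<^sup>2 = (\<Sum>K\<in>\<T>. LINT x|lebesgue_on K. (q K x)\<^sup>2)"
    "(l2norm \<Omega> (assemble \<T> v))\<^sup>2 = (\<Sum>K\<in>\<T>. LINT x|lebesgue_on K. (norm (v K x))\<^sup>2)"
    using l2norm_assemble[OF polys_C1(3)[OF in_K(1)]] l2norm_assemble[OF continuous_vpolys[OF in_K(2)]] by simp_all
  have el: "(LINT x|lebesgue_on K. (q K x)\<^sup>2) / hi + (LINT x|lebesgue_on K. (norm (v K x))\<^sup>2)
        \<le> element_form N K csq (q K) (v K) (q K) (v K) \<and>
     element_form N K csq (q K) (v K) (q K) (v K)
        \<le> (LINT x|lebesgue_on K. (q K x)\<^sup>2) / lo + (LINT x|lebesgue_on K. (norm (v K x))\<^sup>2)"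
    if K: "K \<in> \<T>" for K
  proof -
    obtain V a b where "weighted_element K V a b csq lo hi" using element[OF K] .
    then interpret weighted_element K V a b N csq lo hi .
    show ?thesis using element_form_bounds[OF in_K[OF K]] by blast
  qed
  show "(l2norm \<Omega> (assemble \<T> q))\<^sup>2 / hi + (l2norm \<Omega> (assemble \<T> v))\<^sup>2 \<le> energy \<T> N w q v"
    "energy \<T> N w q v \<le> (l2norm \<Omega> (assemble \<T> q))\<^sup>2 / lo + (l2norm \<Omega> (assemble \<T> v))\<^sup>2"
    unfolding energy_form[OF q v] l2 mesh_form_def sum_divide_distrib sum.distrib[symmetric]
    using el by (intro sum_mono; blast)+
qed

lemma energy_derivative:
  assumes sol: "wadg_solution \<T> N w \<tau>p \<tau>u J p u" and \<tau>: "penalty \<T> \<tau>p" "penalty \<T> \<tau>u"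
    and t: "t \<in> J" "at t within J \<noteq> bot"
  shows "((\<lambda>s. energy \<T> N w (p s) (u s)) has_real_derivative
     - (\<Sum>K\<in>\<T>. 1/2 * boundary_integral K (\<lambda>F x.
          \<tau>p F x * (jump \<T> (p t) K F x)\<^sup>2 + \<tau>u F x * (normal_jump \<T> (u t) K F x)\<^sup>2))) (at t within J)"
proof -
  have pu: "p s \<in> broken_polys \<T> N" "u s \<in> broken_vpolys \<T> N" if "s \<in> J" for s
    using sol that by (auto simp: wadg_solution_def)
  obtain dp du where C1: "C1_in_time \<T> J p dp" "C1_in_time \<T> J u du"
    and eqp: "\<And>K v. K \<in> \<T> \<Longrightarrow> v \<in> polys N \<Longrightarrow>
            (LINT x|lebesgue_on K. Tinv N K (\<lambda>y. 1 / w y) (dp t K) x * v x)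
            = - (LINT x|lebesgue_on K. divergence (u t K) x * v x)
              + boundary_integral K (\<lambda>F x.
                  1/2 * (\<tau>p F x * jump \<T> (p t) K F x - normal_jump \<T> (u t) K F x) * v x)"
    and equ: "\<And>K v. K \<in> \<T> \<Longrightarrow> v \<in> vpolys N \<Longrightarrow>
            (LINT x|lebesgue_on K. du t K x \<bullet> v x)
            = - (LINT x|lebesgue_on K. gradient (p t K) x \<bullet> v x)
              + boundary_integral K (\<lambda>F x.
                  1/2 * (\<tau>u F x * normal_jump \<T> (u t) K F x - jump \<T> (p t) K F x)
                      * (v x \<bullet> outward_normal K F))"
    using sol t(1) unfolding wadg_solution_def by blast
  have el: "((\<lambda>s. LINT x|lebesgue_on K. Tinv N K (\<lambda>y. 1 / w y) (p s K) x * p s K x + (norm (u s K x))\<^sup>2)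
     has_real_derivative 2 *
      (- boundary_integral K (\<lambda>F x. p t K x * (u t K x \<bullet> outward_normal K F))
       + boundary_integral K (\<lambda>F x. 1/2 * (\<tau>p F x * jump \<T> (p t) K F x - normal_jump \<T> (u t) K F x) * p t K x)
       + boundary_integral K (\<lambda>F x. 1/2 * (\<tau>u F x * normal_jump \<T> (u t) K F x - jump \<T> (p t) K F x)
            * (u t K x \<bullet> outward_normal K F)))) (at t within J)" if K: "K \<in> \<T>" for K
  proof -
    obtain V a b where "weighted_element K V a b csq lo hi" using element[OF K] .
    then interpret weighted_element K V a b N csq lo hi .
    have in_K: "p s K \<in> polys N" "u s K \<in> vpolys N" if "s \<in> J" for s
      using pu[OF that] K by (auto simp: broken_polys_def broken_vpolys_def)
    have dpK: "((\<lambda>s. p s K x) has_vector_derivative dp t K x) (at t within J)"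
      and duK: "((\<lambda>s. u s K x) has_vector_derivative du t K x) (at t within J)" if "x \<in> K" for x
      using C1 K t(1) that by (auto simp: C1_in_time_def)
    have "((\<lambda>s. LINT x|lebesgue_on K. Tinv N K csq (p s K) x * p s K x + (norm (u s K x))\<^sup>2) has_real_derivative
       2 * ((LINT x|lebesgue_on K. Tinv N K csq (dp t K) x * p t K x) + (LINT x|lebesgue_on K. du t K x \<bullet> u t K x)))
       (at t within J)"
      by (rule element_energy_derivative[OF in_K dpK duK t])
    moreover have "(LINT x|lebesgue_on K. Tinv N K csq (dp t K) x * p t K x) + (LINT x|lebesgue_on K. du t K x \<bullet> u t K x)
      = (- boundary_integral K (\<lambda>F x. p t K x * (u t K x \<bullet> outward_normal K F))
       + boundary_integral K (\<lambda>F x. 1/2 * (\<tau>p F x * jump \<T> (p t) K F x - normal_jump \<T> (u t) K F x) * p t K x)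
       + boundary_integral K (\<lambda>F x. 1/2 * (\<tau>u F x * normal_jump \<T> (u t) K F x - jump \<T> (p t) K F x)
            * (u t K x \<bullet> outward_normal K F)))"
      using eqp[OF K in_K(1)[OF t(1)]] equ[OF K in_K(2)[OF t(1)]]
        gauss_product[OF K in_K(1)[OF t(1)] in_K(2)[OF t(1)]] by simp
    ultimately show ?thesis by simp
  qed
  have "((\<lambda>s. energy \<T> N w (p s) (u s)) has_real_derivative
    (\<Sum>K\<in>\<T>. 2 *
      (- boundary_integral K (\<lambda>F x. p t K x * (u t K x \<bullet> outward_normal K F))
       + boundary_integral K (\<lambda>F x. 1/2 * (\<tau>p F x * jump \<T> (p t) K F x - normal_jump \<T> (u t) K F x) * p t K x)
       + boundary_integral K (\<lambda>F x. 1/2 * (\<tau>u F x * normal_jump \<T> (u t) K F x - jump \<T> (p t) K F x)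
            * (u t K x \<bullet> outward_normal K F))))) (at t within J)"
    unfolding energy_def by (intro DERIV_sum el)
  then show ?thesis unfolding flux_balance[OF pu(1)[OF t(1)] pu(2)[OF t(1)] \<tau>] .
qed

end

theorem mainTheorem2:
  fixes \<Omega> :: "(real^'n) set" and \<T> :: "(real^'n) set set" and N :: nat
    and csq w :: "real^'n \<Rightarrow> real"
    and \<tau>p \<tau>u :: "(real^'n) set \<Rightarrow> real^'n \<Rightarrow> real"
    and J :: "real set"
    and p :: "real \<Rightarrow> (real^'n) set \<Rightarrow> real^'n \<Rightarrow> real"
    and u :: "real \<Rightarrow> (real^'n) set \<Rightarrow> real^'n \<Rightarrow> real^'n"
  assumes dim: "CARD('n) \<in> {2, 3}"
    and domain: "bounded \<Omega>" "lipschitz_domain \<Omega>"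
    and mesh: "conforming_mesh \<Omega> \<T>"
    and wavespeed: "csq \<in> borel_measurable (lebesgue_on \<Omega>)"
      "\<exists>a b. 0 < a \<and> (\<forall>x\<in>\<Omega>. a \<le> csq x \<and> csq x \<le> b)"
    and weight: "w = (\<lambda>x. 1 / csq x)"
    and penalties: "penalty \<T> \<tau>p" "penalty \<T> \<tau>u"
    and time: "is_interval J" "\<exists>a\<in>J. \<exists>b\<in>J. a < b"
    and solution: "wadg_solution \<T> N w \<tau>p \<tau>u J p u"
  shows "(\<forall>t\<in>J.
            ((\<lambda>s. energy \<T> N w (p s) (u s)) has_real_derivative
               - (\<Sum>K\<in>\<T>. 1/2 * boundary_integral K (\<lambda>F x.
                    \<tau>p F x * (jump \<T> (p t) K F x)\<^sup>2 + \<tau>u F x * (normal_jump \<T> (u t) K F x)\<^sup>2)))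
              (at t within J) \<and>
            - (\<Sum>K\<in>\<T>. 1/2 * boundary_integral K (\<lambda>F x.
                 \<tau>p F x * (jump \<T> (p t) K F x)\<^sup>2 + \<tau>u F x * (normal_jump \<T> (u t) K F x)\<^sup>2)) \<le> 0) \<and>
         (\<exists>\<nu>. broken_norm \<T> N \<nu> \<and>
            (\<forall>q\<in>broken_polys \<T> N. \<forall>v\<in>broken_vpolys \<T> N. energy \<T> N w q v = (\<nu> q v)\<^sup>2)) \<and>
         (\<forall>w_min w_max. 0 < w_min \<longrightarrow> (\<forall>x\<in>\<Omega>. w_min \<le> w x \<and> w x \<le> w_max) \<longrightarrow>
            (\<forall>q\<in>broken_polys \<T> N. \<forall>v\<in>broken_vpolys \<T> N.
               w_min * (l2norm \<Omega> (assemble \<T> q))\<^sup>2 + (l2norm \<Omega> (assemble \<T> v))\<^sup>2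
                 \<le> energy \<T> N w q v \<and>
               energy \<T> N w q v
                 \<le> w_max * (l2norm \<Omega> (assemble \<T> q))\<^sup>2 + (l2norm \<Omega> (assemble \<T> v))\<^sup>2))"
proof -
  obtain a b where ab: "0 < a" "\<And>x. x \<in> \<Omega> \<Longrightarrow> a \<le> csq x \<and> csq x \<le> b"
    using wavespeed(2) by blast
  interpret weighted_mesh \<Omega> \<T> csq a b
    using domain mesh wavespeed(1) ab by unfold_locales
  have islimpt: "at t within J \<noteq> bot" if "t \<in> J" for t
  proof -
    obtain r s where "r \<in> J" "s \<in> J" "r < s" using time(2) by blast
    then have "J \<noteq> {x}" for x by auto
    then have "t islimpt J"
      using connected_imp_perfect[OF _ that] time(1) by (simp add: is_interval_connected)
    then show ?thesis by (simp add: trivial_limit_within)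
  qed
  have "((\<lambda>s. energy \<T> N w (p s) (u s)) has_real_derivative
               - (\<Sum>K\<in>\<T>. 1/2 * boundary_integral K (\<lambda>F x.
                    \<tau>p F x * (jump \<T> (p t) K F x)\<^sup>2 + \<tau>u F x * (normal_jump \<T> (u t) K F x)\<^sup>2)))
              (at t within J) \<and>
            - (\<Sum>K\<in>\<T>. 1/2 * boundary_integral K (\<lambda>F x.
                 \<tau>p F x * (jump \<T> (p t) K F x)\<^sup>2 + \<tau>u F x * (normal_jump \<T> (u t) K F x)\<^sup>2)) \<le> 0"
    if "t \<in> J" for t
  proof
    show "((\<lambda>s. energy \<T> N w (p s) (u s)) has_real_derivative
               - (\<Sum>K\<in>\<T>. 1/2 * boundary_integral K (\<lambda>F x.
                    \<tau>p F x * (jump \<T> (p t) K F x)\<^sup>2 + \<tau>u F x * (normal_jump \<T> (u t) K F x)\<^sup>2)))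
              (at t within J)"
      using energy_derivative[OF _ penalties that islimpt[OF that]] solution unfolding weight by blast
    have "0 \<le> (\<Sum>K\<in>\<T>. 1/2 * boundary_integral K (\<lambda>F x.
                 \<tau>p F x * (jump \<T> (p t) K F x)\<^sup>2 + \<tau>u F x * (normal_jump \<T> (u t) K F x)\<^sup>2))"
      by (intro sum_nonneg mult_nonneg_nonneg dissipation_nonneg[OF penalties]) simp_all
    then show "- (\<Sum>K\<in>\<T>. 1/2 * boundary_integral K (\<lambda>F x.
                 \<tau>p F x * (jump \<T> (p t) K F x)\<^sup>2 + \<tau>u F x * (normal_jump \<T> (u t) K F x)\<^sup>2)) \<le> 0" by simp
  qed
  moreover have "\<exists>\<nu>. broken_norm \<T> N \<nu> \<and>
            (\<forall>q\<in>broken_polys \<T> N. \<forall>v\<in>broken_vpolys \<T> N. energy \<T> N w q v = (\<nu> q v)\<^sup>2)"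
  proof (intro exI conjI ballI)
    show "broken_norm \<T> N (\<lambda>q v. sqrt (mesh_form N q v q v))" by (rule energy_norm)
    fix q v assume qv: "q \<in> broken_polys \<T> N" "v \<in> broken_vpolys \<T> N"
    show "energy \<T> N w q v = (sqrt (mesh_form N q v q v))\<^sup>2"
      using energy_form[OF qv] mesh_form_definite(1)[OF qv] by (simp add: weight)
  qed
  moreover have "w_min * (l2norm \<Omega> (assemble \<T> q))\<^sup>2 + (l2norm \<Omega> (assemble \<T> v))\<^sup>2 \<le> energy \<T> N w q v \<and>
      energy \<T> N w q v \<le> w_max * (l2norm \<Omega> (assemble \<T> q))\<^sup>2 + (l2norm \<Omega> (assemble \<T> v))\<^sup>2"
    if w_min: "0 < w_min" and bd: "\<forall>x\<in>\<Omega>. w_min \<le> w x \<and> w x \<le> w_max"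
      and qv: "q \<in> broken_polys \<T> N" "v \<in> broken_vpolys \<T> N" for w_min w_max q v
  proof -
    obtain z where "z \<in> \<Omega>" using domain(2) by (auto simp: lipschitz_domain_def)
    then have w_max: "0 < w_max" using w_min bd by (meson less_le_trans)
    have csq_bd: "1 / w_max \<le> csq x \<and> csq x \<le> 1 / w_min" if x: "x \<in> \<Omega>" for x
    proof -
      have "0 < csq x" using ab(1) ab(2)[OF x] by linarith
      then show ?thesis using bd x w_min w_max by (auto simp: weight field_simps)
    qed
    have "weighted_mesh \<Omega> \<T> csq (1 / w_max) (1 / w_min)"
      using domain mesh wavespeed(1) w_max csq_bd by unfold_locales simp_all
    from weighted_mesh.energy_bounds[OF this qv] show ?thesis
      by (simp add: weight mult.commute)
  qed
  ultimately show ?thesis by (intro conjI) blast+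
qed

end
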